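(* Let $\Omega\subseteq\Xi$ be closed under variable substitution. Suppose $\Omega$ is transitive and normal, and $\operatorname{D}_\Delta(\emptyset)<\infty$ for every tuple of variables $\bar x$ and every finite $\Delta\subseteq\Omega\restriction\bar x$. Then for every tuple $\bar a$ and all sets $B$, $C$ (with $\bar x$ a tuple of variables compatible with $\bar a$) the following conditions are equivalent: (1) $\bar a\perp^{\Omega*}_CB$. (2) $\operatorname{D}_\Delta(\bar a/BC)=\operatorname{D}_\Delta(\bar a/C)$ for all finite $\Delta\subseteq\Omega\restriction\bar x$. (3) $B\perp^{\Omega*}_C\bar a$.
   Context: $T$ is a complete consistent first-order theory (possibly many-sorted); we work in a big saturated model of $T$. All sets are small subsets of the big model; $BC$ means $B\cup C$. Tuples may be infinite; a tuple also denotes the set of its entries, and $\bar a\in A$ means that all entries of $\bar a$ lie in $A$. $A\equiv_BA'$ means that some automorphism fixing $B$ pointwise maps the set $A$ onto $A'$. Writing a formula as $\varphi(\bar x)$ means that each of its free variables appears in the (possibly infinite) tuple $\bar x$, dummy variables being allowed. Inconsistency pairs. For a formula $\varphi(\bar x;\bar y)$ whose free variables are partitioned into two blocks, a formula $\psi(\bar y_0,\dots,\bar y_{k-1})$ (also written $\psi(\bar y_{<k})$; no parameters) is a $k$-inconsistency witness for $\varphi(\bar x;\bar y)$ if $\big(\bigwedge_{i<k}\varphi(\bar x;\bar y_i)\big)\wedge\psi(\bar y_{<k})$ is inconsistent. $\Xi$ is the set of all pairs $(\varphi(\bar x;\bar y),\psi(\bar y_{<k}))$, $k<\omega$, such that $\psi$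 is a $k$-inconsistency witness for $\varphi$. For $\Omega\subseteq\Xi$, $\Omega\restriction\bar x$ is the set of pairs $(\varphi,\psi)\in\Omega$ such that $\varphi$ has the form $\varphi(\bar x;\bar y)$, with arbitrary $\bar y$ (i.e. the left-hand block of variables of $\varphi$ is taken from $\bar x$). Dividing. For $(\varphi,\psi)\in\Xi$, a formula $\varphi(\bar x;\bar b)$ $(\varphi,\psi)$-divides over a set $C$ if there is a sequence $(\bar b_i)_{i<\omega}$ such that each $\bar b_i$ realises $\operatorname{tp}(\bar b/C)$ and $\models\psi(\bar b_{i_0},\dots,\bar b_{i_{k-1}})$ for all $i_0<\dots<i_{k-1}<\omega$. A partial type $(\varphi,\psi)$-divides over $C$ if it contains a formula $\varphi(\bar x;\bar b)$ that $(\varphi,\psi)$-divides over $C$. A set $\Omega\subseteq\Xi$ is closed under variable substitution if whenever $(\varphi(\bar x;\bar y),\psi(\bar y_{<k}))\in\Omega$ and $\bar u,\bar v,\bar v_0,\dots,\bar v_{k-1}$ are tuples of variables of appropriate lengths and sorts (possibly with repetitions inside a tuple, but pairwise disjoint from each other), then $(\varphi(\bar u;\bar v),\psi(\bar v_{<k}))\in\Omega$. A partial type $\Omega$-divides over $C$ if it $(\varphi,\psi)$-divides over $C$ for some $(\varphi,\psi)\in\Omega$. Define $A\perp^{\Omega}_CB$ iff there is no $\bar a\in A$ such that $\operatorname{tp}(\bar a/BC)$ $\Omega$-divides over $C$; and $A\perp^{\Omega*}_CB$ iff for all $\hat B\supseteq B$ there is $A'\equiv_{BC}A$ such that $A'\perp^\Omega_C\hat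 B$. For $\Omega\subseteq\Xi$ closed under variable substitution: - $\Omega$ is transitive if: whenever $(\varphi(\bar y;\bar x),\psi(\bar x_{<k}))\in\Omega$, $D\subseteq C$, $C\perp^\Omega_D\bar a$ and $\varphi(\bar y;\bar a)$ $(\varphi,\psi)$-divides over $D$, then $\varphi(\bar y;\bar a)$ $(\varphi,\psi)$-divides over $C$. - $\Omega$ is normal if: whenever $(\varphi(\bar x,\bar z;\bar y),\psi(\bar y_{<k}))\in\Omega$, then also $(\varphi(\bar x;\bar z,\bar y),\psi'(\bar y_{<k},\bar z_{<k}))\in\Omega$, where $\psi'$ is $\psi(\bar y_{<k})\wedge(\bar z_0=\bar z_1=\dots=\bar z_{k-1})$. Local rank. Let $p(\bar x)$ be a partial type over $C$, $I$ a linearly ordered set and $\Delta\subseteq\Xi\restriction\bar x$. A sequence $\xi=((\varphi^i,\psi^i))_{i\in I}\in\Delta^I$ is a $\Delta$-dividing pattern for $p(\bar x)$ if there is a sequence $(\bar b^i)_{i\in I}$ such that $p(\bar x)\cup\{\varphi^i(\bar x;\bar b^i)\mid i\in I\}$ is consistent and each formula $\varphi^i(\bar x;\bar b^i)$ $(\varphi^i,\psi^i)$-divides over $C\cup\bigcup_{j<i}\bar b^j$. (This does not depend on the choice of the set $C$ over which $p$ is defined.) For finite $\Delta\subseteq\Xi\restriction\bar x$, $\operatorname{D}_\Delta(p)\in\omega\cup\{\infty\}$ is $\infty$ if $p$ has $\Delta$-dividing patterns of arbitrary order type, and otherwise the greatest $n<\omega$ such that $p$ has a $\Delta$-dividing pattern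 of length $n$. $\operatorname{D}_\Delta(\bar a/B)$ means $\operatorname{D}_\Delta(\operatorname{tp}(\bar a/B))$, and $\operatorname{D}_\Delta(\emptyset)$ is the rank of the empty partial type in $\bar x$. *)

theory Defs
  imports Main "HOL-Library.Extended_Nat"
begin

unbundle cardinal_syntax

section \<open>Many-sorted first-order formulas\<close>

text \<open>
  Bound variables are de Bruijn indices and free variables are named, so that formulas that differ
  only in their bound variables are equal and substitution for free variables cannot capture.
  Elements of a structure may occur as parameters.
\<close>

datatype (tm_vars: 'x, 'f, tm_params: 'm) tm =
    Var 'x
  | Bnd nat
  | Par 'm
  | Fn 'f "('x, 'f, 'm) tm list"

datatype ('s, fm_vars: 'x, 'f, 'r, fm_params: 'm) fm =
    Tru
  | Eq "('x, 'f, 'm) tm" "('x, 'f, 'm) tm"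
  | Rel 'r "('x, 'f, 'm) tm list"
  | Neg "('s, 'x, 'f, 'r, 'm) fm"
  | Conj "('s, 'x, 'f, 'r, 'm) fm" "('s, 'x, 'f, 'r, 'm) fm"
  | Ex 's "('s, 'x, 'f, 'r, 'm) fm"

text \<open>A variable carries its sort.\<close>

type_synonym ('s, 'v) var = "'s \<times> 'v"

type_synonym ('s, 'f, 'r, 'm, 'v) form = "('s, ('s, 'v) var, 'f, 'r, 'm) fm"

primrec subst_tm :: "('x \<Rightarrow> ('x, 'f, 'm) tm) \<Rightarrow> ('x, 'f, 'm) tm \<Rightarrow> ('x, 'f, 'm) tm" where
  "subst_tm \<sigma> (Var x) = \<sigma> x"
| "subst_tm \<sigma> (Bnd n) = Bnd n"
| "subst_tm \<sigma> (Par m) = Par m"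
| "subst_tm \<sigma> (Fn f ts) = Fn f (map (subst_tm \<sigma>) ts)"

text \<open>Only to be used when no \<open>\<sigma> x\<close> contains a bound variable, since nothing is lifted.\<close>

primrec subst :: "('x \<Rightarrow> ('x, 'f, 'm) tm) \<Rightarrow> ('s, 'x, 'f, 'r, 'm) fm \<Rightarrow> ('s, 'x, 'f, 'r, 'm) fm" where
  "subst \<sigma> Tru = Tru"
| "subst \<sigma> (Eq t u) = Eq (subst_tm \<sigma> t) (subst_tm \<sigma> u)"
| "subst \<sigma> (Rel r ts) = Rel r (map (subst_tm \<sigma>) ts)"
| "subst \<sigma> (Neg \<phi>) = Neg (subst \<sigma> \<phi>)"
| "subst \<sigma> (Conj \<phi> \<chi>) = Conj (subst \<sigma> \<phi>) (subst \<sigma> \<chi>)"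
| "subst \<sigma> (Ex s \<phi>) = Ex s (subst \<sigma> \<phi>)"


section \<open>Structures\<close>

text \<open>
  A structure together with its language. The type \<open>'s\<close> is the set of sorts, the symbols are the
  elements of the domains of \<open>fun_type\<close> and \<open>rel_type\<close>, and the type \<open>'m\<close> is the disjoint union of
  the carriers of all sorts. Values of \<open>fun_int\<close> and \<open>rel_int\<close> at ill-sorted arguments play no role.
\<close>

record ('s, 'f, 'r, 'm) struct =
  fun_type :: "'f \<Rightarrow> ('s list \<times> 's) option"
  rel_type :: "'r \<Rightarrow> 's list option"
  sort_of :: "'m \<Rightarrow> 's"
  fun_int :: "'f \<Rightarrow> 'm list \<Rightarrow> 'm"
  rel_int :: "'r \<Rightarrow> 'm list \<Rightarrow> bool"

definition is_structure :: "('s, 'f, 'r, 'm) struct \<Rightarrow> bool" where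
  "is_structure M \<longleftrightarrow>
     (\<forall>s. \<exists>m. sort_of M m = s) \<and>
     (\<forall>f ss s ms. fun_type M f = Some (ss, s) \<longrightarrow> map (sort_of M) ms = ss \<longrightarrow>
        sort_of M (fun_int M f ms) = s)"

text \<open>The list \<open>\<Gamma>\<close> holds the sorts of the bound variables, innermost first.\<close>

fun has_sort :: "('s, 'f, 'r, 'm) struct \<Rightarrow> 's list \<Rightarrow> (('s, 'v) var, 'f, 'm) tm \<Rightarrow> 's \<Rightarrow> bool" where
  "has_sort M \<Gamma> (Var v) s \<longleftrightarrow> fst v = s"
| "has_sort M \<Gamma> (Bnd n) s \<longleftrightarrow> n < length \<Gamma> \<and> \<Gamma> ! n = s"
| "has_sort M \<Gamma> (Par m) s \<longleftrightarrow> sort_of M m = s"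
| "has_sort M \<Gamma> (Fn f ts) s \<longleftrightarrow>
     (\<exists>ss. fun_type M f = Some (ss, s) \<and> list_all2 (has_sort M \<Gamma>) ts ss)"

primrec wf_fm :: "('s, 'f, 'r, 'm) struct \<Rightarrow> 's list \<Rightarrow> ('s, 'f, 'r, 'm, 'v) form \<Rightarrow> bool" where
  "wf_fm M \<Gamma> Tru \<longleftrightarrow> True"
| "wf_fm M \<Gamma> (Eq t u) \<longleftrightarrow> (\<exists>s. has_sort M \<Gamma> t s \<and> has_sort M \<Gamma> u s)"
| "wf_fm M \<Gamma> (Rel r ts) \<longleftrightarrow> (\<exists>ss. rel_type M r = Some ss \<and> list_all2 (has_sort M \<Gamma>) ts ss)"
| "wf_fm M \<Gamma> (Neg \<phi>) \<longleftrightarrow> wf_fm M \<Gamma> \<phi>"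
| "wf_fm M \<Gamma> (Conj \<phi> \<chi>) \<longleftrightarrow> wf_fm M \<Gamma> \<phi> \<and> wf_fm M \<Gamma> \<chi>"
| "wf_fm M \<Gamma> (Ex s \<phi>) \<longleftrightarrow> wf_fm M (s # \<Gamma>) \<phi>"

text \<open>The formulas with free variables in \<open>X\<close> and parameters in \<open>B\<close>.\<close>

definition forms_over ::
  "('s, 'f, 'r, 'm) struct \<Rightarrow> ('s, 'v) var set \<Rightarrow> 'm set \<Rightarrow> ('s, 'f, 'r, 'm, 'v) form set" where
  "forms_over M X B = {\<phi>. wf_fm M [] \<phi> \<and> fm_vars \<phi> \<subseteq> X \<and> fm_params \<phi> \<subseteq> B}"

primrec eval :: "('s, 'f, 'r, 'm) struct \<Rightarrow> ('x \<Rightarrow> 'm) \<Rightarrow> 'm list \<Rightarrow> ('x, 'f, 'm) tm \<Rightarrow> 'm" where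
  "eval M a e (Var x) = a x"
| "eval M a e (Bnd n) = e ! n"
| "eval M a e (Par m) = m"
| "eval M a e (Fn f ts) = fun_int M f (map (eval M a e) ts)"

primrec sat :: "('s, 'f, 'r, 'm) struct \<Rightarrow> ('x \<Rightarrow> 'm) \<Rightarrow> 'm list \<Rightarrow> ('s, 'x, 'f, 'r, 'm) fm \<Rightarrow> bool" where
  "sat M a e Tru \<longleftrightarrow> True"
| "sat M a e (Eq t u) \<longleftrightarrow> eval M a e t = eval M a e u"
| "sat M a e (Rel r ts) \<longleftrightarrow> rel_int M r (map (eval M a e) ts)"
| "sat M a e (Neg \<phi>) \<longleftrightarrow> \<not> sat M a e \<phi>"
| "sat M a e (Conj \<phi> \<chi>) \<longleftrightarrow> sat M a e \<phi> \<and> sat M a e \<chi>"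
| "sat M a e (Ex s \<phi>) \<longleftrightarrow> (\<exists>m. sort_of M m = s \<and> sat M a (m # e) \<phi>)"


section \<open>Tuples and types\<close>

text \<open>
  A possibly infinite tuple of distinct variables is given by the set \<open>X\<close> of its entries, and a tuple
  of elements compatible with it is a family indexed by \<open>X\<close>, i.e. an assignment that respects
  sorts on \<open>X\<close>; its values outside \<open>X\<close> are irrelevant. The set of entries of the tuple is \<open>a ` X\<close>.
\<close>

definition compat :: "('s, 'f, 'r, 'm) struct \<Rightarrow> ('s, 'v) var set \<Rightarrow> (('s, 'v) var \<Rightarrow> 'm) \<Rightarrow> bool" where
  "compat M X a \<longleftrightarrow> (\<forall>v\<in>X. sort_of M (a v) = fst v)"

definition tp ::
  "('s, 'f, 'r, 'm) struct \<Rightarrow> ('s, 'v) var set \<Rightarrow> (('s, 'v) var \<Rightarrow> 'm) \<Rightarrow> 'm set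
    \<Rightarrow> ('s, 'f, 'r, 'm, 'v) form set" where
  "tp M X a B = {\<phi> \<in> forms_over M X B. sat M a [] \<phi>}"

definition realises ::
  "('s, 'f, 'r, 'm) struct \<Rightarrow> ('s, 'v) var set \<Rightarrow> (('s, 'v) var \<Rightarrow> 'm)
    \<Rightarrow> ('s, 'f, 'r, 'm, 'v) form set \<Rightarrow> bool" where
  "realises M X a p \<longleftrightarrow> compat M X a \<and> (\<forall>\<phi>\<in>p. sat M a [] \<phi>)"

text \<open>Consistency of a set of formulas in \<open>X\<close> with the elementary diagram of \<open>M\<close>.\<close>

definition consistent ::
  "('s, 'f, 'r, 'm) struct \<Rightarrow> ('s, 'v) var set \<Rightarrow> ('s, 'f, 'r, 'm, 'v) form set \<Rightarrow> bool" where
  "consistent M X p \<longleftrightarrow> (\<forall>q \<subseteq> p. finite q \<longrightarrow> (\<exists>a. realises M X a q))"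


section \<open>The big model\<close>

definition small :: "'k rel \<Rightarrow> 'a set \<Rightarrow> bool" where
  "small \<kappa> A \<longleftrightarrow> |A| <o \<kappa>"

definition automorphism :: "('s, 'f, 'r, 'm) struct \<Rightarrow> ('m \<Rightarrow> 'm) \<Rightarrow> bool" where
  "automorphism M g \<longleftrightarrow>
     bij g \<and> (\<forall>m. sort_of M (g m) = sort_of M m) \<and>
     (\<forall>f ss s ms. fun_type M f = Some (ss, s) \<longrightarrow> map (sort_of M) ms = ss \<longrightarrow>
        g (fun_int M f ms) = fun_int M f (map g ms)) \<and>
     (\<forall>r ss ms. rel_type M r = Some ss \<longrightarrow> map (sort_of M) ms = ss \<longrightarrow>
        rel_int M r (map g ms) = rel_int M r ms)"

text \<open>The paper's \<open>A \<equiv>\<^sub>B A'\<close>.\<close>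

definition conj_over :: "('s, 'f, 'r, 'm) struct \<Rightarrow> 'm set \<Rightarrow> 'm set \<Rightarrow> 'm set \<Rightarrow> bool" where
  "conj_over M B A A' \<longleftrightarrow> (\<exists>g. automorphism M g \<and> (\<forall>b\<in>B. g b = b) \<and> g ` A = A')"

text \<open>
  Theories are taken to be deductively closed, so a complete one contains each sentence or its negation.
\<close>

definition complete_theory ::
  "('s, 'f, 'r, 'm) struct \<Rightarrow> ('s, 'f, 'r, 'm, 'v) form set \<Rightarrow> bool" where
  "complete_theory M T \<longleftrightarrow>
     T \<subseteq> forms_over M {} {} \<and> (\<forall>\<sigma> \<in> forms_over M {} {}. \<sigma> \<in> T \<or> Neg \<sigma> \<in> T)"

definition models ::
  "('s, 'f, 'r, 'm) struct \<Rightarrow> ('s, 'f, 'r, 'm, 'v) form set \<Rightarrow> bool" where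
  "models M T \<longleftrightarrow> is_structure M \<and> (\<forall>\<sigma>\<in>T. \<forall>a. sat M a [] \<sigma>)"

text \<open>The witness \<open>T\<close> only determines the type of variables.\<close>

definition saturated ::
  "'k rel \<Rightarrow> ('s, 'f, 'r, 'm) struct \<Rightarrow> ('s, 'f, 'r, 'm, 'v) form set \<Rightarrow> bool" where
  "saturated \<kappa> M T \<longleftrightarrow>
     (\<forall>A (x :: ('s, 'v) var) p. small \<kappa> A \<longrightarrow> p \<subseteq> forms_over M {x} A \<longrightarrow>
        consistent M {x} p \<longrightarrow> (\<exists>a. realises M {x} a p))"

definition strongly_homogeneous ::
  "'k rel \<Rightarrow> ('s, 'f, 'r, 'm) struct \<Rightarrow> ('s, 'f, 'r, 'm, 'v) form set \<Rightarrow> bool" where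
  "strongly_homogeneous \<kappa> M T \<longleftrightarrow>
     (\<forall>(X :: ('s, 'v) var set) a a'. small \<kappa> X \<longrightarrow> compat M X a \<longrightarrow> compat M X a' \<longrightarrow>
        tp M X a {} = tp M X a' {} \<longrightarrow>
        (\<exists>g. automorphism M g \<and> (\<forall>v\<in>X. g (a v) = a' v)))"

text \<open>
  A big saturated model of \<open>T\<close>: \<open>\<kappa>\<close>-saturated and strongly \<open>\<kappa>\<close>-homogeneous, for a cardinal \<open>\<kappa>\<close>
  that exceeds the size of the language and below which sets count as small. A saturated model
  whose cardinality exceeds that of the language is the case where \<open>\<kappa>\<close> is its cardinality. The
  supply of variables of each sort must suffice for all small tuples.
\<close>

definition big_model ::
  "'k rel \<Rightarrow> ('s, 'f, 'r, 'm, 'v) form set \<Rightarrow> ('s, 'f, 'r, 'm) struct \<Rightarrow> bool" where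
  "big_model \<kappa> T M \<longleftrightarrow>
     models M T \<and>
     Card_order \<kappa> \<and> natLeq <o \<kappa> \<and>
     |UNIV :: 's set| <o \<kappa> \<and> |dom (fun_type M)| <o \<kappa> \<and> |dom (rel_type M)| <o \<kappa> \<and>
     \<kappa> \<le>o |UNIV :: 'v set| \<and>
     saturated \<kappa> M T \<and> strongly_homogeneous \<kappa> M T"


section \<open>Inconsistency pairs\<close>

text \<open>
  A pair \<open>(\<phi>(x;y), \<psi>(y\<^sub>0,\<dots>,y\<^sub>k\<^sub>-\<^sub>1))\<close>. The tuple \<open>y\<close> is \<open>rblock\<close>, the tuples \<open>y\<^sub>0,\<dots>,y\<^sub>k\<^sub>-\<^sub>1\<close> are \<open>wblocks\<close>;
  repetitions within them and dummy variables are allowed. The left-hand block of \<open>\<phi>\<close> consists of its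
  free variables outside \<open>y\<close>.
\<close>

record ('s, 'f, 'r, 'm, 'v) ipair =
  phi :: "('s, 'f, 'r, 'm, 'v) form"
  rblock :: "('s, 'v) var list"
  psi :: "('s, 'f, 'r, 'm, 'v) form"
  wblocks :: "('s, 'v) var list list"

definition lblock :: "('s, 'f, 'r, 'm, 'v) ipair \<Rightarrow> ('s, 'v) var set" where
  "lblock e = fm_vars (phi e) - set (rblock e)"

text \<open>The formula \<open>\<phi>(x;b)\<close>, where \<open>b\<close> is compatible with \<open>y\<close>.\<close>

definition inst ::
  "('s, 'f, 'r, 'm, 'v) ipair \<Rightarrow> (('s, 'v) var \<Rightarrow> 'm) \<Rightarrow> ('s, 'f, 'r, 'm, 'v) form" where
  "inst e b = subst (\<lambda>v. if v \<in> set (rblock e) then Par (b v) else Var v) (phi e)"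

text \<open>
  \<open>\<psi>(b\<^sub>0,\<dots>,b\<^sub>k\<^sub>-\<^sub>1)\<close> holds, where \<open>bs = [b\<^sub>0,\<dots>,b\<^sub>k\<^sub>-\<^sub>1]\<close> and each \<open>b\<^sub>j\<close> is a tuple compatible with \<open>y\<close>.
  In particular, if \<open>y\<^sub>j\<close> repeats a variable then the corresponding entries of \<open>b\<^sub>j\<close> must agree.
\<close>

definition psi_holds ::
  "('s, 'f, 'r, 'm) struct \<Rightarrow> ('s, 'f, 'r, 'm, 'v) ipair \<Rightarrow> (('s, 'v) var \<Rightarrow> 'm) list \<Rightarrow> bool" where
  "psi_holds M e bs \<longleftrightarrow>
     (\<exists>s. list_all2 (\<lambda>ys b. map s ys = map b (rblock e)) (wblocks e) bs \<and> sat M s [] (psi e))"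

text \<open>The tuples \<open>x\<close>, \<open>y\<close>, \<open>y\<^sub>0,\<dots>,y\<^sub>k\<^sub>-\<^sub>1\<close> are pairwise disjoint.\<close>

definition disjoint_blocks :: "('s, 'f, 'r, 'm, 'v) ipair \<Rightarrow> bool" where
  "disjoint_blocks e \<longleftrightarrow> sorted_wrt disjnt (lblock e # set (rblock e) # map set (wblocks e))"

text \<open>
  The last clause says that \<open>\<phi>(x;y\<^sub>0) \<and> \<dots> \<and> \<phi>(x;y\<^sub>k\<^sub>-\<^sub>1) \<and> \<psi>(y\<^sub>0,\<dots>,y\<^sub>k\<^sub>-\<^sub>1)\<close> is inconsistent with the complete
  theory of \<open>M\<close>, i.e. not satisfiable in \<open>M\<close>.
\<close>

definition Xi :: "('s, 'f, 'r, 'm) struct \<Rightarrow> ('s, 'f, 'r, 'm, 'v) ipair set" where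
  "Xi M = {e.
     phi e \<in> forms_over M UNIV {} \<and>
     psi e \<in> forms_over M (\<Union>ys\<in>set (wblocks e). set ys) {} \<and>
     (\<forall>ys\<in>set (wblocks e). map fst ys = map fst (rblock e)) \<and>
     disjoint_blocks e \<and>
     \<not> (\<exists>a bs. compat M (lblock e) a \<and> length bs = length (wblocks e) \<and>
          (\<forall>b\<in>set bs. compat M (set (rblock e)) b \<and> sat M a [] (inst e b)) \<and>
          psi_holds M e bs)}"

definition restrict_left ::
  "('s, 'f, 'r, 'm, 'v) ipair set \<Rightarrow> ('s, 'v) var set \<Rightarrow> ('s, 'f, 'r, 'm, 'v) ipair set" where
  "restrict_left \<Omega> X = {e \<in> \<Omega>. lblock e \<subseteq> X \<and> disjnt X (set (rblock e))}"

definition rename_ipair ::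
  "(('s, 'v) var \<Rightarrow> ('s, 'v) var) \<Rightarrow> ('s, 'f, 'r, 'm, 'v) ipair \<Rightarrow> ('s, 'f, 'r, 'm, 'v) ipair" where
  "rename_ipair \<rho> e =
     \<lparr>phi = subst (\<lambda>v. Var (\<rho> v)) (phi e), rblock = map \<rho> (rblock e),
      psi = subst (\<lambda>v. Var (\<rho> v)) (psi e), wblocks = map (map \<rho>) (wblocks e)\<rparr>"

text \<open>
  As the blocks of \<open>e\<close> are disjoint, one map \<open>\<rho>\<close> describes an arbitrary choice of new tuples. It need not
  be injective on a block; new left- and right-hand variables must be kept apart even though
  \<open>lblock (rename_ipair \<rho> e)\<close> is computed by subtraction, hence the second premise.
\<close>

definition subst_closed :: "('s, 'f, 'r, 'm, 'v) ipair set \<Rightarrow> bool" where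
  "subst_closed \<Omega> \<longleftrightarrow>
     (\<forall>e\<in>\<Omega>. \<forall>\<rho>. (\<forall>v. fst (\<rho> v) = fst v) \<longrightarrow>
        disjnt (\<rho> ` lblock e) (\<rho> ` set (rblock e)) \<longrightarrow>
        disjoint_blocks (rename_ipair \<rho> e) \<longrightarrow> rename_ipair \<rho> e \<in> \<Omega>)"


section \<open>Dividing and independence\<close>

text \<open>The formula \<open>\<phi>(x;b)\<close> divides over \<open>C\<close> with respect to the pair \<open>e = (\<phi>,\<psi>)\<close>.\<close>

definition divides ::
  "('s, 'f, 'r, 'm) struct \<Rightarrow> ('s, 'f, 'r, 'm, 'v) ipair \<Rightarrow> (('s, 'v) var \<Rightarrow> 'm) \<Rightarrow> 'm set \<Rightarrow> bool" where
  "divides M e b C \<longleftrightarrow>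
     (\<exists>\<beta> :: nat \<Rightarrow> ('s, 'v) var \<Rightarrow> 'm.
        (\<forall>i. realises M (set (rblock e)) (\<beta> i) (tp M (set (rblock e)) b C)) \<and>
        (\<forall>js. sorted_wrt (<) js \<longrightarrow> length js = length (wblocks e) \<longrightarrow> psi_holds M e (map \<beta> js)))"

text \<open>
  A partial type \<open>p\<close> over \<open>B\<close> divides over \<open>C\<close>. That \<open>\<phi>(x;b)\<close> is a formula over \<open>B\<close> also
  constrains the entries of \<open>b\<close> at dummy variables of \<open>y\<close>.
\<close>

definition type_divides ::
  "('s, 'f, 'r, 'm) struct \<Rightarrow> ('s, 'f, 'r, 'm, 'v) ipair set \<Rightarrow> ('s, 'f, 'r, 'm, 'v) form set
    \<Rightarrow> 'm set \<Rightarrow> 'm set \<Rightarrow> bool" where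
  "type_divides M \<Omega> p B C \<longleftrightarrow>
     (\<exists>e\<in>\<Omega>. \<exists>b. compat M (set (rblock e)) b \<and> b ` set (rblock e) \<subseteq> B \<and>
        inst e b \<in> p \<and> divides M e b C)"

definition indep ::
  "'k rel \<Rightarrow> ('s, 'f, 'r, 'm) struct \<Rightarrow> ('s, 'f, 'r, 'm, 'v) ipair set
    \<Rightarrow> 'm set \<Rightarrow> 'm set \<Rightarrow> 'm set \<Rightarrow> bool" where
  "indep \<kappa> M \<Omega> A C B \<longleftrightarrow>
     \<not> (\<exists>X a. small \<kappa> X \<and> compat M X a \<and> a ` X \<subseteq> A \<and>
          type_divides M \<Omega> (tp M X a (B \<union> C)) (B \<union> C) C)"

definition indep_star ::
  "'k rel \<Rightarrow> ('s, 'f, 'r, 'm) struct \<Rightarrow> ('s, 'f, 'r, 'm, 'v) ipair set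
    \<Rightarrow> 'm set \<Rightarrow> 'm set \<Rightarrow> 'm set \<Rightarrow> bool" where
  "indep_star \<kappa> M \<Omega> A C B \<longleftrightarrow>
     (\<forall>B'. small \<kappa> B' \<longrightarrow> B \<subseteq> B' \<longrightarrow> (\<exists>A'. conj_over M (B \<union> C) A A' \<and> indep \<kappa> M \<Omega> A' C B'))"

definition transitive ::
  "'k rel \<Rightarrow> ('s, 'f, 'r, 'm) struct \<Rightarrow> ('s, 'f, 'r, 'm, 'v) ipair set \<Rightarrow> bool" where
  "transitive \<kappa> M \<Omega> \<longleftrightarrow>
     (\<forall>e\<in>\<Omega>. \<forall>a C D. small \<kappa> C \<longrightarrow> D \<subseteq> C \<longrightarrow> compat M (set (rblock e)) a \<longrightarrow>
        indep \<kappa> M \<Omega> C D (a ` set (rblock e)) \<longrightarrow> divides M e a D \<longrightarrow> divides M e a C)"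

text \<open>The formula \<open>z\<^sub>0 = z\<^sub>1 = \<dots> = z\<^sub>k\<^sub>-\<^sub>1\<close> for tuples \<open>z\<^sub>i\<close> of equal length.\<close>

definition all_equal :: "('s, 'v) var list list \<Rightarrow> ('s, 'f, 'r, 'm, 'v) form" where
  "all_equal zss =
     foldr Conj
       (concat (map (\<lambda>(zs, zs'). map2 (\<lambda>z z'. Eq (Var z) (Var z')) zs zs') (zip zss (tl zss))))
       Tru"

text \<open>
  From \<open>(\<phi>(x,z;y), \<psi>(y\<^sub>0,\<dots>))\<close> to \<open>(\<phi>(x;z,y), \<psi>(y\<^sub>0,\<dots>) \<and> z\<^sub>0 = z\<^sub>1 = \<dots>)\<close>; \<open>zss\<close> lists \<open>z\<^sub>0,\<dots>,z\<^sub>k\<^sub>-\<^sub>1\<close>.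
\<close>

definition shift_ipair ::
  "('s, 'v) var list \<Rightarrow> ('s, 'v) var list list \<Rightarrow> ('s, 'f, 'r, 'm, 'v) ipair
    \<Rightarrow> ('s, 'f, 'r, 'm, 'v) ipair" where
  "shift_ipair zs zss e =
     \<lparr>phi = phi e, rblock = zs @ rblock e,
      psi = Conj (psi e) (all_equal zss), wblocks = map2 (@) zss (wblocks e)\<rparr>"

definition normal :: "('s, 'f, 'r, 'm, 'v) ipair set \<Rightarrow> bool" where
  "normal \<Omega> \<longleftrightarrow>
     (\<forall>e\<in>\<Omega>. \<forall>zs zss. length zss = length (wblocks e) \<longrightarrow>
        (\<forall>zs'\<in>set zss. map fst zs' = map fst zs) \<longrightarrow>
        sorted_wrt disjnt ((lblock e - set zs) # set zs # set (rblock e) #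
          map set zss @ map set (wblocks e)) \<longrightarrow>
        shift_ipair zs zss e \<in> \<Omega>)"


section \<open>Local rank\<close>

text \<open>
  \<open>\<xi>\<close> is a dividing pattern indexed by the linear order \<open>(I, r)\<close> for the partial type \<open>p\<close> over \<open>C\<close>
  in the variables \<open>X\<close>.
\<close>

definition dividing_pattern ::
  "('s, 'f, 'r, 'm) struct \<Rightarrow> ('s, 'v) var set \<Rightarrow> ('s, 'f, 'r, 'm, 'v) ipair set
    \<Rightarrow> ('s, 'f, 'r, 'm, 'v) form set \<Rightarrow> 'm set \<Rightarrow> 'i set \<Rightarrow> 'i rel
    \<Rightarrow> ('i \<Rightarrow> ('s, 'f, 'r, 'm, 'v) ipair) \<Rightarrow> bool" where
  "dividing_pattern M X \<Delta> p C I r \<xi> \<longleftrightarrow>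
     (\<forall>i\<in>I. \<xi> i \<in> \<Delta>) \<and>
     (\<exists>b. (\<forall>i\<in>I. compat M (set (rblock (\<xi> i))) (b i)) \<and>
        consistent M X (p \<union> {inst (\<xi> i) (b i) | i. i \<in> I}) \<and>
        (\<forall>i\<in>I. divides M (\<xi> i) (b i)
           (C \<union> (\<Union>j\<in>{j \<in> I. j \<noteq> i \<and> (j, i) \<in> r}. b j ` set (rblock (\<xi> j))))))"

text \<open>
  Order types are restricted to small ones, as all tuples live in the big model. Every small order
  type is realised on a subset of the type underlying \<open>\<kappa>\<close>.
\<close>

definition D_rank ::
  "'k rel \<Rightarrow> ('s, 'f, 'r, 'm) struct \<Rightarrow> ('s, 'v) var set \<Rightarrow> ('s, 'f, 'r, 'm, 'v) ipair set
    \<Rightarrow> ('s, 'f, 'r, 'm, 'v) form set \<Rightarrow> 'm set \<Rightarrow> enat" where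
  "D_rank \<kappa> M X \<Delta> p C =
     (if \<forall>(I :: 'k set) r. small \<kappa> I \<longrightarrow> linear_order_on I r \<longrightarrow>
           (\<exists>\<xi>. dividing_pattern M X \<Delta> p C I r \<xi>)
      then \<infinity>
      else enat (GREATEST n. \<exists>\<xi>. dividing_pattern M X \<Delta> p C {..<n} {(i, j). i \<le> j} \<xi>))"

definition D_tp ::
  "'k rel \<Rightarrow> ('s, 'f, 'r, 'm) struct \<Rightarrow> ('s, 'v) var set \<Rightarrow> ('s, 'f, 'r, 'm, 'v) ipair set
    \<Rightarrow> (('s, 'v) var \<Rightarrow> 'm) \<Rightarrow> 'm set \<Rightarrow> enat" where
  "D_tp \<kappa> M X \<Delta> a B = D_rank \<kappa> M X \<Delta> (tp M X a B) B"

end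

theory Submission
  imports Defs "HOL-Library.Infinite_Set"
begin

text \<open>
  From (3) to (2): move the parameters of a maximal dividing pattern for \<open>tp(a/C)\<close>, realised by \<open>a\<close>,
  so that \<open>B\<close> becomes \<open>\<Omega>\<close>-independent over \<open>C\<close> from \<open>a\<close> together with them. By normality and
  transitivity the pattern is then also one over \<open>BC\<close>. From (2) to (1): if (1) fails, then by
  compactness \<open>tp(a/BC)\<close> implies a finite disjunction of formulas that divide over \<open>C\<close> with respect
  to pairs from some finite \<open>\<Delta>\<close>; a maximal \<open>\<Delta>\<close>-pattern for \<open>tp(a/BC)\<close>, moved over a base that contains
  their parameters, is consistent with one of them and becomes longer when it is put in front. This
  needs \<open>D\<^sub>\<Delta>(a/C)\<close> to be finite. From (1) to (3): apply (3) to (1) with the roles of \<open>a\<close> and \<open>B\<close>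
  exchanged.
\<close>

section \<open>Syntax\<close>

text \<open>Parameters must be moved because independence of \<open>B\<close> from \<open>a\<close>
  alone says nothing about them, whereas transitivity at position i needs \<open>B\<close>
  independent from the i-th parameter over \<open>C\<close> and the earlier ones. The starred
  relation supplies this, since it tolerates any small enlargement of its right-hand side. Normality
  enters because the earlier parameters join the base, and then tuples on the left may contain them
  too. Finiteness needs an argument of its own: the rank is infinite only if patterns of every small
  order type exist, and is otherwise a \<open>GREATEST\<close>, which is meaningful only for bounded
  lengths. If the patterns that are constantly e have bounded length for each e in \<Delta>, the sum
  of the bounds limits all patterns; if some pair has no bound, compactness stretches its constant
  patterns to every small order type. Homogeneity is given over the empty set and saturation for one
  variable. Elements of a base are therefore named by fresh variables, and unknown sequences become
  assignments to small sets of variables.\<close>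

lemma finite_tm_vars: "finite (tm_vars t)"
  by (induction t) auto

lemma finite_fm_vars: "finite (fm_vars \<phi>)"
  by (induction \<phi>) (auto simp: finite_tm_vars)

lemma eval_cong: "(\<And>v. v \<in> tm_vars t \<Longrightarrow> a v = b v) \<Longrightarrow> eval M a e t = eval M b e t"
proof (induction t)
  case (Fn f ts)
  then have "map (eval M a e) ts = map (eval M b e) ts"
    unfolding map_eq_conv by (metis UN_I tm.set(4))
  then show ?case by (simp only: eval.simps)
qed auto

lemma sat_cong: "(\<And>v. v \<in> fm_vars \<phi> \<Longrightarrow> a v = b v) \<Longrightarrow> sat M a e \<phi> \<longleftrightarrow> sat M b e \<phi>"
proof (induction \<phi> arbitrary: e)
  case (Rel r ts)
  then have "map (eval M a e) ts = map (eval M b e) ts"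
    by (auto intro!: eval_cong)
  then show ?case by (simp only: sat.simps)
qed (auto cong: eval_cong)

text \<open>\<open>subst\<close> does not lift bound variables, so it is safe only for values
  without them. Variables and parameters are all that the proof ever substitutes.\<close>

definition atomic_tm :: "('x, 'f, 'm) tm \<Rightarrow> bool" where
  "atomic_tm t \<longleftrightarrow> (\<exists>w. t = Var w) \<or> (\<exists>m. t = Par m)"

lemma eval_subst:
  assumes "\<And>v. atomic_tm (\<sigma> v)"
  shows "eval M a e (subst_tm \<sigma> t) = eval M (\<lambda>v. eval M a [] (\<sigma> v)) e t"
proof (induction t)
  case (Var x)
  then show ?case using assms[of x] by (auto simp: atomic_tm_def)
next
  case (Fn f ts)
  then have "map (eval M a e \<circ> subst_tm \<sigma>) ts = map (eval M (\<lambda>v. eval M a [] (\<sigma> v)) e) ts"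
    by auto
  then show ?case by (simp only: eval.simps subst_tm.simps map_map)
qed auto

lemma sat_subst:
  assumes "\<And>v. atomic_tm (\<sigma> v)"
  shows "sat M a e (subst \<sigma> \<phi>) \<longleftrightarrow> sat M (\<lambda>v. eval M a [] (\<sigma> v)) e \<phi>"
  by (induction \<phi> arbitrary: e) (auto simp: eval_subst[OF assms] comp_def)

lemma tm_vars_subst: "tm_vars (subst_tm \<sigma> t) = (\<Union>v\<in>tm_vars t. tm_vars (\<sigma> v))"
  by (induction t) auto

lemma fm_vars_subst: "fm_vars (subst \<sigma> \<phi>) = (\<Union>v\<in>fm_vars \<phi>. tm_vars (\<sigma> v))"
  by (induction \<phi>) (auto simp: tm_vars_subst)

lemma tm_params_subst:
  "tm_params (subst_tm \<sigma> t) = tm_params t \<union> (\<Union>v\<in>tm_vars t. tm_params (\<sigma> v))"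
  by (induction t) auto

lemma fm_params_subst:
  "fm_params (subst \<sigma> \<phi>) = fm_params \<phi> \<union> (\<Union>v\<in>fm_vars \<phi>. tm_params (\<sigma> v))"
  by (induction \<phi>) (auto simp: tm_params_subst)

lemma has_sort_subst:
  assumes "\<And>v. atomic_tm (\<sigma> v)" "\<And>v. v \<in> tm_vars t \<Longrightarrow> has_sort M [] (\<sigma> v) (fst v)"
    and "has_sort M \<Gamma> t s"
  shows "has_sort M \<Gamma> (subst_tm \<sigma> t) s"
  using assms(2,3)
proof (induction t arbitrary: s)
  case (Var x)
  then show ?case using assms(1)[of x] by (auto simp: atomic_tm_def)
next
  case (Fn f ts)
  then show ?case by (auto simp: list_all2_conv_all_nth) (metis nth_mem)
qed auto

lemma wf_fm_subst:
  assumes "\<And>v. atomic_tm (\<sigma> v)" "\<And>v. v \<in> fm_vars \<phi> \<Longrightarrow> has_sort M [] (\<sigma> v) (fst v)"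
    and "wf_fm M \<Gamma> \<phi>"
  shows "wf_fm M \<Gamma> (subst \<sigma> \<phi>)"
  using assms(2,3)
proof (induction \<phi> arbitrary: \<Gamma>)
  case (Eq t u)
  then show ?case by (auto intro!: has_sort_subst assms(1))
next
  case (Rel r ts)
  then show ?case
    by (auto simp: list_all2_conv_all_nth intro!: has_sort_subst assms(1)) (metis nth_mem)
qed auto

text \<open>Abstraction of a free variable into the bound variable of index \<open>k\<close>, i.e. the one outermost
  at depth \<open>k\<close>.\<close>

primrec abs_tm :: "'x \<Rightarrow> nat \<Rightarrow> ('x, 'f, 'm) tm \<Rightarrow> ('x, 'f, 'm) tm" where
  "abs_tm x k (Var y) = (if y = x then Bnd k else Var y)"
| "abs_tm x k (Bnd n) = Bnd n"
| "abs_tm x k (Par m) = Par m"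
| "abs_tm x k (Fn f ts) = Fn f (map (abs_tm x k) ts)"

primrec abs_fm :: "'x \<Rightarrow> nat \<Rightarrow> ('s, 'x, 'f, 'r, 'm) fm \<Rightarrow> ('s, 'x, 'f, 'r, 'm) fm" where
  "abs_fm x k Tru = Tru"
| "abs_fm x k (Eq t u) = Eq (abs_tm x k t) (abs_tm x k u)"
| "abs_fm x k (Rel r ts) = Rel r (map (abs_tm x k) ts)"
| "abs_fm x k (Neg \<phi>) = Neg (abs_fm x k \<phi>)"
| "abs_fm x k (Conj \<phi> \<chi>) = Conj (abs_fm x k \<phi>) (abs_fm x k \<chi>)"
| "abs_fm x k (Ex s \<phi>) = Ex s (abs_fm x (Suc k) \<phi>)"

text \<open>The new binder is the outermost one, so its value comes last in the environment. Sorting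
  keeps every bound index of \<open>t\<close> below \<open>length e\<close>; hence none of them
  reads the appended \<open>m\<close>.\<close>

lemma eval_abs_tm:
  "has_sort M \<Gamma> t s \<Longrightarrow> length \<Gamma> = length e \<Longrightarrow>
    eval M a (e @ [m]) (abs_tm x (length e) t) = eval M (a(x := m)) e t"
proof (induction t arbitrary: s)
  case (Fn f ts)
  from Fn.prems obtain ss where ss: "list_all2 (has_sort M \<Gamma>) ts ss" by auto
  have "eval M a (e @ [m]) (abs_tm x (length e) t) = eval M (a(x := m)) e t" if "t \<in> set ts" for t
  proof -
    from ss that obtain s' where "has_sort M \<Gamma> t s'"
      by (metis in_set_conv_nth list_all2_conv_all_nth)
    with Fn.IH[OF that] Fn.prems(2) show ?thesis by blast
  qed
  then have "map (eval M a (e @ [m]) \<circ> abs_tm x (length e)) ts = map (eval M (a(x := m)) e) ts"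
    unfolding map_eq_conv comp_apply by blast
  then show ?case by (simp only: eval.simps abs_tm.simps map_map)
qed (auto simp: nth_append)

lemma sat_abs_fm:
  "wf_fm M \<Gamma> \<phi> \<Longrightarrow> length \<Gamma> = length e \<Longrightarrow>
    sat M a (e @ [m]) (abs_fm x (length e) \<phi>) \<longleftrightarrow> sat M (a(x := m)) e \<phi>"
proof (induction \<phi> arbitrary: \<Gamma> e)
  case (Rel r ts)
  from Rel.prems obtain ss where ss: "list_all2 (has_sort M \<Gamma>) ts ss" by auto
  have "eval M a (e @ [m]) (abs_tm x (length e) t) = eval M (a(x := m)) e t" if "t \<in> set ts" for t
  proof -
    from ss that obtain s' where "has_sort M \<Gamma> t s'"
      by (metis in_set_conv_nth list_all2_conv_all_nth)
    with Rel.prems(2) show ?thesis by (blast intro: eval_abs_tm)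
  qed
  then have "map (eval M a (e @ [m]) \<circ> abs_tm x (length e)) ts = map (eval M (a(x := m)) e) ts"
    unfolding map_eq_conv comp_apply by blast
  then show ?case by (simp only: sat.simps abs_fm.simps map_map)
next
  case (Ex s \<phi>)
  then show ?case using Ex.IH[of "s # \<Gamma>" "_ # e"] by simp
qed (auto simp: eval_abs_tm)

lemma has_sort_abs_tm:
  "has_sort M \<Gamma> t s \<Longrightarrow> has_sort M (\<Gamma> @ [fst x]) (abs_tm x (length \<Gamma>) t) s"
proof (induction t arbitrary: s)
  case (Fn f ts)
  then show ?case by (auto simp: list_all2_conv_all_nth)
qed (auto simp: nth_append)

lemma wf_fm_abs_fm:
  "wf_fm M \<Gamma> \<phi> \<Longrightarrow> wf_fm M (\<Gamma> @ [fst x]) (abs_fm x (length \<Gamma>) \<phi>)"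
proof (induction \<phi> arbitrary: \<Gamma>)
  case (Rel r ts)
  then show ?case by (auto simp: list_all2_conv_all_nth intro!: has_sort_abs_tm)
next
  case (Ex s \<phi>)
  then show ?case using Ex.IH[of "s # \<Gamma>"] by simp
qed (auto intro: has_sort_abs_tm)

lemma tm_vars_abs_tm: "tm_vars (abs_tm x k t) = tm_vars t - {x}"
  by (induction t) auto

lemma fm_vars_abs_fm: "fm_vars (abs_fm x k \<phi>) = fm_vars \<phi> - {x}"
  by (induction \<phi> arbitrary: k) (auto simp: tm_vars_abs_tm)

lemma tm_params_abs_tm: "tm_params (abs_tm x k t) = tm_params t"
  by (induction t) auto

lemma fm_params_abs_fm: "fm_params (abs_fm x k \<phi>) = fm_params \<phi>"
  by (induction \<phi> arbitrary: k) (auto simp: tm_params_abs_tm)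

section \<open>Existential quantification over finitely many free variables\<close>

lemma exists_closure1:
  assumes "\<phi> \<in> forms_over M X A"
  obtains \<phi>' where "\<phi>' \<in> forms_over M (X - {x}) A"
    and "\<And>a. sat M a [] \<phi>' \<longleftrightarrow> (\<exists>m. sort_of M m = fst x \<and> sat M (a(x := m)) [] \<phi>)"
proof
  let ?\<phi>' = "Ex (fst x) (abs_fm x 0 \<phi>)"
  show "?\<phi>' \<in> forms_over M (X - {x}) A"
    using assms wf_fm_abs_fm[of M "[]" \<phi> x]
    by (auto simp: forms_over_def fm_vars_abs_fm fm_params_abs_fm)
  show "sat M a [] ?\<phi>' \<longleftrightarrow> (\<exists>m. sort_of M m = fst x \<and> sat M (a(x := m)) [] \<phi>)" for a
    using assms sat_abs_fm[of M "[]" \<phi> "[]" a] by (auto simp: forms_over_def)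
qed

lemma exists_closure:
  fixes M :: "('s, 'f, 'r, 'm) struct" and W X :: "('s, 'v) var set"
  assumes "finite W" "\<phi> \<in> forms_over M X A"
  shows "\<exists>\<phi>'\<in>forms_over M (X - W) A. \<forall>a. sat M a [] \<phi>' \<longleftrightarrow>
    (\<exists>a'. compat M W a' \<and> (\<forall>v. v \<notin> W \<longrightarrow> a' v = a v) \<and> sat M a' [] \<phi>)"
  using assms
proof (induction W arbitrary: \<phi> X rule: finite_induct)
  case empty
  have "(\<forall>v. v \<notin> {} \<longrightarrow> a' v = a v) \<longleftrightarrow> a' = a" for a' a :: "('s, 'v) var \<Rightarrow> 'm"
    unfolding fun_eq_iff by simp
  then have "(\<exists>a'. compat M {} a' \<and> (\<forall>v. v \<notin> {} \<longrightarrow> a' v = a v) \<and> sat M a' [] \<phi>) \<longleftrightarrow> sat M a [] \<phi>" for a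
    by (simp add: compat_def del: split_paired_All)
  with empty show ?case by (metis Diff_empty)
next
  case (insert x W)
  from exists_closure1[OF insert.prems] obtain \<phi>1 where
    1: "\<phi>1 \<in> forms_over M (X - {x}) A"
    "\<And>a. sat M a [] \<phi>1 \<longleftrightarrow> (\<exists>m. sort_of M m = fst x \<and> sat M (a(x := m)) [] \<phi>)" by blast
  have "X - {x} - W = X - insert x W" by auto
  then obtain \<phi>2 where
    2: "\<phi>2 \<in> forms_over M (X - insert x W) A"
    "\<And>a. sat M a [] \<phi>2 \<longleftrightarrow>
    (\<exists>a'. compat M W a' \<and> (\<forall>v. v \<notin> W \<longrightarrow> a' v = a v) \<and> sat M a' [] \<phi>1)"
    using insert.IH[OF 1(1)] by metis
  have "(\<exists>a'. compat M W a' \<and> (\<forall>v. v \<notin> W \<longrightarrow> a' v = a v) \<and> sat M a' [] \<phi>1) \<longleftrightarrow>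
    (\<exists>a'. compat M (insert x W) a' \<and> (\<forall>v. v \<notin> insert x W \<longrightarrow> a' v = a v) \<and> sat M a' [] \<phi>)" for a
  proof
    assume "\<exists>a'. compat M W a' \<and> (\<forall>v. v \<notin> W \<longrightarrow> a' v = a v) \<and> sat M a' [] \<phi>1"
    then obtain a' m where a': "compat M W a'" "\<And>v. v \<notin> W \<Longrightarrow> a' v = a v"
      and m: "sort_of M m = fst x" "sat M (a'(x := m)) [] \<phi>" using 1(2) by blast
    have "compat M (insert x W) (a'(x := m))" using a'(1) m(1) by (simp add: compat_def)
    moreover have "(a'(x := m)) v = a v" if "v \<notin> insert x W" for v using a'(2)[of v] that by simp
    ultimately show "\<exists>a'. compat M (insert x W) a' \<and> (\<forall>v. v \<notin> insert x W \<longrightarrow> a' v = a v) \<and> sat M a' [] \<phi>"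
      using m(2) by blast
  next
    assume "\<exists>a'. compat M (insert x W) a' \<and> (\<forall>v. v \<notin> insert x W \<longrightarrow> a' v = a v) \<and> sat M a' [] \<phi>"
    then obtain a' where a': "compat M (insert x W) a'" "\<And>v. v \<notin> insert x W \<Longrightarrow> a' v = a v"
      "sat M a' [] \<phi>" by blast
    \<comment> \<open>The value at \<open>x\<close> is reset to \<open>a x\<close>, as the inner
      assignment may differ from \<open>a\<close> on \<open>W\<close> only; the quantifier in
      \<open>\<phi>1\<close> restores \<open>a' x\<close>.\<close>
    let ?a = "a'(x := a x)"
    have "?a(x := a' x) = a'" by simp
    moreover have "sort_of M (a' x) = fst x" using a'(1) by (simp add: compat_def)
    ultimately have "sat M ?a [] \<phi>1" unfolding 1(2) using a'(3) by metis
    moreover have "compat M W ?a" using a'(1) insert.hyps(2) by (simp add: compat_def)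
    moreover have "?a v = a v" if "v \<notin> W" for v using a'(2)[of v] that by simp
    ultimately show "\<exists>a'. compat M W a' \<and> (\<forall>v. v \<notin> W \<longrightarrow> a' v = a v) \<and> sat M a' [] \<phi>1"
      by blast
  qed
  with 2 show ?case by (intro bexI[of _ \<phi>2]) simp_all
qed

section \<open>Definable predicates on assignments\<close>

text \<open>Closure properties of definable predicates replace the construction of explicit
  formulas. Agreement is asked at assignments that respect sorts, as these are the ones that
  represent tuples.\<close>

definition definable ::
  "('s, 'f, 'r, 'm) struct \<Rightarrow> ('s, 'v) var set \<Rightarrow> 'm set \<Rightarrow> ((('s, 'v) var \<Rightarrow> 'm) \<Rightarrow> bool) \<Rightarrow> bool" where
  "definable M X A P \<longleftrightarrow>
     (\<exists>\<phi>\<in>forms_over M X A. \<forall>a. compat M X a \<longrightarrow> (sat M a [] \<phi> \<longleftrightarrow> P a))"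

lemma definable_sat: "\<phi> \<in> forms_over M X A \<Longrightarrow> definable M X A (\<lambda>a. sat M a [] \<phi>)"
  unfolding definable_def by blast

lemma definable_cong:
  assumes "definable M X A P" "\<And>a. compat M X a \<Longrightarrow> P a \<longleftrightarrow> Q a"
  shows "definable M X A Q"
  using assms unfolding definable_def by blast

lemma definable_mono:
  "definable M X A P \<Longrightarrow> X \<subseteq> X' \<Longrightarrow> A \<subseteq> A' \<Longrightarrow> definable M X' A' P"
  unfolding definable_def forms_over_def compat_def by (smt (verit) mem_Collect_eq order_trans subsetD)

lemma definable_not: "definable M X A P \<Longrightarrow> definable M X A (\<lambda>a. \<not> P a)"
  unfolding definable_def
  by (erule bexE, rule_tac x = "Neg \<phi>" in bexI) (auto simp: forms_over_def)

lemma definable_True: "definable M X A (\<lambda>a. True)"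
  unfolding definable_def by (rule bexI[of _ Tru]) (auto simp: forms_over_def)

lemma definable_conj:
  assumes "definable M X A P" "definable M X A Q"
  shows "definable M X A (\<lambda>a. P a \<and> Q a)"
proof -
  from assms obtain \<phi> \<chi> where "\<phi> \<in> forms_over M X A" "\<chi> \<in> forms_over M X A"
    "\<forall>a. compat M X a \<longrightarrow> (sat M a [] \<phi> \<longleftrightarrow> P a)" "\<forall>a. compat M X a \<longrightarrow> (sat M a [] \<chi> \<longleftrightarrow> Q a)"
    unfolding definable_def by blast
  then show ?thesis unfolding definable_def
    by (intro bexI[of _ "Conj \<phi> \<chi>"]) (auto simp: forms_over_def)
qed

lemma definable_iff:
  assumes "definable M X A P" "definable M X A Q"
  shows "definable M X A (\<lambda>a. P a \<longleftrightarrow> Q a)"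
  by (rule definable_cong[OF definable_conj[OF
          definable_not[OF definable_conj[OF assms(1) definable_not[OF assms(2)]]]
          definable_not[OF definable_conj[OF assms(2) definable_not[OF assms(1)]]]]]) blast

lemma definable_ball:
  "finite F \<Longrightarrow> (\<And>i. i \<in> F \<Longrightarrow> definable M X A (P i)) \<Longrightarrow> definable M X A (\<lambda>a. \<forall>i\<in>F. P i a)"
proof (induction F rule: finite_induct)
  case (insert i F)
  then have "definable M X A (\<lambda>a. P i a \<and> (\<forall>i\<in>F. P i a))" by (intro definable_conj) auto
  then show ?case by simp
qed (simp add: definable_True)

lemma definable_eq_vars:
  "v \<in> X \<Longrightarrow> w \<in> X \<Longrightarrow> fst v = fst w \<Longrightarrow> definable M X A (\<lambda>a. a v = a w)"
  unfolding definable_def by (rule bexI[of _ "Eq (Var v) (Var w)"]) (auto simp: forms_over_def)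

lemma definable_eq_par:
  "v \<in> X \<Longrightarrow> m \<in> A \<Longrightarrow> sort_of M m = fst v \<Longrightarrow> definable M X A (\<lambda>a. a v = m)"
  unfolding definable_def by (rule bexI[of _ "Eq (Var v) (Par m)"]) (auto simp: forms_over_def)

lemma definable_rename:
  fixes M :: "('s, 'f, 'r, 'm) struct" and X Y :: "('s, 'v) var set"
  assumes "definable M X A P" "\<And>v. fst (\<rho> v) = fst v" "\<rho> ` X \<subseteq> Y"
  shows "definable M Y A (\<lambda>a. P (\<lambda>v. a (\<rho> v)))"
proof -
  from assms(1) obtain \<phi> where \<phi>: "\<phi> \<in> forms_over M X A"
    "\<And>a. compat M X a \<Longrightarrow> (sat M a [] \<phi> \<longleftrightarrow> P a)"
    unfolding definable_def by blast
  have "subst (\<lambda>v. Var (\<rho> v)) \<phi> \<in> forms_over M Y A"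
    using \<phi>(1) assms(2,3) unfolding forms_over_def
    by (auto simp: fm_vars_subst fm_params_subst atomic_tm_def image_subset_iff intro!: wf_fm_subst)
  moreover have "compat M X (\<lambda>v. a (\<rho> v))" if "compat M Y a" for a
    using that assms(2,3) by (auto simp: compat_def image_subset_iff)
  ultimately show ?thesis unfolding definable_def
    by (intro bexI[of _ "subst (\<lambda>v. Var (\<rho> v)) \<phi>"]) (auto simp: sat_subst atomic_tm_def \<phi>(2))
qed

text \<open>A formula has finitely many free variables, so quantifying over those outside
  \<open>Y\<close> suffices even for infinite \<open>X\<close>. The other variables of
  \<open>X\<close> take the default elements \<open>d\<close>, which exist as no sort is
  empty.\<close>

lemma definable_project:
  fixes M :: "('s, 'f, 'r, 'm) struct" and X Y :: "('s, 'v) var set"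
  assumes "definable M X A P" "Y \<subseteq> X" "is_structure M"
  shows "definable M Y A (\<lambda>b. \<exists>a. compat M X a \<and> (\<forall>v\<in>Y. a v = b v) \<and> P a)"
proof -
  from assms(1) obtain \<phi> where \<phi>: "\<phi> \<in> forms_over M X A"
    "\<And>a. compat M X a \<Longrightarrow> (sat M a [] \<phi> \<longleftrightarrow> P a)"
    unfolding definable_def by blast
  define W where "W = fm_vars \<phi> - Y"
  have W: "W \<subseteq> X" "W \<inter> Y = {}" "fm_vars \<phi> \<subseteq> W \<union> Y"
    using \<phi>(1) by (auto simp: forms_over_def W_def)
  have "finite W" by (simp add: W_def finite_fm_vars)
  moreover have "\<phi> \<in> forms_over M (W \<union> Y) A" using \<phi>(1) W(3) by (auto simp: forms_over_def)
  moreover have "W \<union> Y - W = Y" using W(2) by auto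
  ultimately obtain \<phi>' where \<phi>': "\<phi>' \<in> forms_over M Y A"
    "\<And>a. sat M a [] \<phi>' \<longleftrightarrow>
      (\<exists>a'. compat M W a' \<and> (\<forall>v. v \<notin> W \<longrightarrow> a' v = a v) \<and> sat M a' [] \<phi>)"
    using exists_closure[of W \<phi> M "W \<union> Y" A] by auto
  obtain d where d: "\<And>s. sort_of M (d s) = s"
    using assms(3) unfolding is_structure_def by metis
  show ?thesis unfolding definable_def
  proof (intro bexI[of _ \<phi>'] allI impI \<phi>'(1))
    fix b assume b: "compat M Y b"
    show "sat M b [] \<phi>' \<longleftrightarrow> (\<exists>a. compat M X a \<and> (\<forall>v\<in>Y. a v = b v) \<and> P a)"
    proof
      assume "sat M b [] \<phi>'"
      then obtain a' where a': "compat M W a'" "\<And>v. v \<notin> W \<Longrightarrow> a' v = b v" "sat M a' [] \<phi>"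
        unfolding \<phi>'(2) by blast
      let ?a = "\<lambda>v. if v \<in> W \<union> Y then a' v else d (fst v)"
      have "compat M X ?a" using a' b W(2) d unfolding compat_def by auto
      moreover have "sat M ?a [] \<phi>" using a'(3) W(3) sat_cong[of \<phi> ?a a' M "[]"] by (auto simp: subset_iff)
      moreover have "\<forall>v\<in>Y. ?a v = b v" using a'(2) W(2) by auto
      ultimately show "\<exists>a. compat M X a \<and> (\<forall>v\<in>Y. a v = b v) \<and> P a" using \<phi>(2) by blast
    next
      assume "\<exists>a. compat M X a \<and> (\<forall>v\<in>Y. a v = b v) \<and> P a"
      then obtain a where a: "compat M X a" "\<And>v. v \<in> Y \<Longrightarrow> a v = b v" "P a" by blast
      let ?a = "\<lambda>v. if v \<in> W then a v else b v"
      have "sat M a [] \<phi>" using a \<phi>(2) by blast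
      moreover have "?a v = a v" if "v \<in> fm_vars \<phi>" for v using a(2)[of v] that W(3) by auto
      ultimately have "sat M ?a [] \<phi>" using sat_cong[of \<phi> ?a a] by blast
      moreover have "compat M W ?a" using a(1) W(1) by (auto simp: compat_def)
      ultimately show "sat M b [] \<phi>'" unfolding \<phi>'(2) by (intro exI[of _ ?a]) auto
    qed
  qed
qed

section \<open>Automorphisms\<close>

lemma eval_sort:
  assumes "is_structure M"
  shows "has_sort M \<Gamma> t s \<Longrightarrow> map (sort_of M) e = \<Gamma> \<Longrightarrow>
    compat M (tm_vars t) a \<Longrightarrow> sort_of M (eval M a e t) = s"
proof (induction t arbitrary: s)
  case (Fn f ts)
  from Fn.prems obtain ss where ss: "fun_type M f = Some (ss, s)" "list_all2 (has_sort M \<Gamma>) ts ss"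
    by auto
  have "compat M (tm_vars t) a" if "t \<in> set ts" for t
    using Fn.prems(3) that by (auto simp: compat_def)
  then have "list_all2 (\<lambda>t s. sort_of M (eval M a e t) = s) ts ss"
    using ss(2) Fn.IH Fn.prems(2) by (blast intro: list.rel_mono_strong)
  then have "map (sort_of M) (map (eval M a e) ts) = ss"
    by (auto simp: list_all2_conv_all_nth intro: nth_equalityI)
  then show ?case using assms ss(1) unfolding is_structure_def eval.simps by blast
qed (auto simp: compat_def)

text \<open>Automorphisms commute with function symbols at well-sorted arguments, so the induction
  keeps the sorts of the argument values alongside, by \<open>eval_sort\<close>.\<close>

lemma eval_automorphism:
  assumes "is_structure M" "automorphism M g"
  shows "has_sort M \<Gamma> t s \<Longrightarrow> map (sort_of M) e = \<Gamma> \<Longrightarrow>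
    compat M (tm_vars t) a \<Longrightarrow> (\<And>m. m \<in> tm_params t \<Longrightarrow> g m = m) \<Longrightarrow>
    eval M (\<lambda>v. g (a v)) (map g e) t = g (eval M a e t)"
proof (induction t arbitrary: s)
  case (Fn f ts)
  from Fn.prems obtain ss where ss: "fun_type M f = Some (ss, s)" "list_all2 (has_sort M \<Gamma>) ts ss"
    by auto
  have "list_all2 (\<lambda>t s. sort_of M (eval M a e t) = s \<and>
      eval M (\<lambda>v. g (a v)) (map g e) t = g (eval M a e t)) ts ss"
    using ss(2)
  proof (rule list.rel_mono_strong)
    fix t s assume t: "t \<in> set ts" "has_sort M \<Gamma> t s"
    have "compat M (tm_vars t) a" using Fn.prems(3) t by (auto simp: compat_def)
    moreover have "g m = m" if "m \<in> tm_params t" for m using Fn.prems(4) t that by auto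
    ultimately show "sort_of M (eval M a e t) = s \<and>
      eval M (\<lambda>v. g (a v)) (map g e) t = g (eval M a e t)"
      using Fn.IH Fn.prems(2) t eval_sort[OF assms(1)] by blast
  qed
  then have "map (sort_of M) (map (eval M a e) ts) = ss"
    "map (eval M (\<lambda>v. g (a v)) (map g e)) ts = map g (map (eval M a e) ts)"
    by (auto simp: list_all2_conv_all_nth in_set_conv_nth intro: nth_equalityI)
  then show ?case using assms(2) ss(1) unfolding automorphism_def eval.simps by metis
qed auto

lemma sat_automorphism:
  assumes "is_structure M" "automorphism M g"
  shows "wf_fm M \<Gamma> \<phi> \<Longrightarrow> map (sort_of M) e = \<Gamma> \<Longrightarrow>
    compat M (fm_vars \<phi>) a \<Longrightarrow> (\<And>m. m \<in> fm_params \<phi> \<Longrightarrow> g m = m) \<Longrightarrow>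
    sat M (\<lambda>v. g (a v)) (map g e) \<phi> \<longleftrightarrow> sat M a e \<phi>"
proof (induction \<phi> arbitrary: \<Gamma> e)
  case (Eq t u)
  then obtain s where s: "has_sort M \<Gamma> t s" "has_sort M \<Gamma> u s" by auto
  have "compat M (tm_vars t) a" "compat M (tm_vars u) a" using Eq.prems(3) by (auto simp: compat_def)
  with s Eq eval_automorphism[OF assms, of \<Gamma> t s e a] eval_automorphism[OF assms, of \<Gamma> u s e a]
  show ?case using assms(2) by (auto simp: automorphism_def bij_def inj_eq)
next
  case (Rel r ts)
  from Rel.prems obtain ss where ss: "rel_type M r = Some ss" "list_all2 (has_sort M \<Gamma>) ts ss"
    by auto
  have "list_all2 (\<lambda>t s. sort_of M (eval M a e t) = s \<and>
      eval M (\<lambda>v. g (a v)) (map g e) t = g (eval M a e t)) ts ss"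
    using ss(2)
  proof (rule list.rel_mono_strong)
    fix t s assume t: "t \<in> set ts" "has_sort M \<Gamma> t s"
    have "compat M (tm_vars t) a" using Rel.prems(3) t by (auto simp: compat_def)
    moreover have "g m = m" if "m \<in> tm_params t" for m using Rel.prems(4) t that by auto
    ultimately show "sort_of M (eval M a e t) = s \<and>
      eval M (\<lambda>v. g (a v)) (map g e) t = g (eval M a e t)"
      using Rel.prems(2) t eval_sort[OF assms(1)] eval_automorphism[OF assms] by blast
  qed
  then have "map (sort_of M) (map (eval M a e) ts) = ss"
    "map (eval M (\<lambda>v. g (a v)) (map g e)) ts = map g (map (eval M a e) ts)"
    by (auto simp: list_all2_conv_all_nth in_set_conv_nth intro: nth_equalityI)
  then show ?case using assms(2) ss(1) unfolding automorphism_def sat.simps by metis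
next
  case (Ex s \<phi>)
  have IH: "sat M (\<lambda>v. g (a v)) (g m # map g e) \<phi> \<longleftrightarrow> sat M a (m # e) \<phi>" if "sort_of M m = s" for m
    using Ex.IH[of "s # \<Gamma>" "m # e"] Ex.prems that by auto
  have g: "bij g" "\<And>m. sort_of M (g m) = sort_of M m" using assms(2) by (auto simp: automorphism_def)
  \<comment> \<open>\<open>g\<close> permutes each sort, so the witness may be taken of the form
    \<open>g m\<close>.\<close>
  then have "(\<exists>m. sort_of M m = s \<and> sat M (\<lambda>v. g (a v)) (m # map g e) \<phi>) \<longleftrightarrow>
    (\<exists>m. sort_of M m = s \<and> sat M (\<lambda>v. g (a v)) (g m # map g e) \<phi>)"
    by (metis bij_pointE)
  with IH show ?case by auto
next
  case (Conj \<phi> \<chi>)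
  have "compat M (fm_vars \<phi>) a" "compat M (fm_vars \<chi>) a"
    using Conj.prems(3) by (auto simp: compat_def)
  with Conj show ?case by auto
qed auto

section \<open>Automorphisms form a group\<close>

lemma automorphism_sort: "automorphism M g \<Longrightarrow> sort_of M (g m) = sort_of M m"
  and automorphism_bij: "automorphism M g \<Longrightarrow> bij g"
  and automorphism_fun: "automorphism M g \<Longrightarrow> fun_type M f = Some (map (sort_of M) ms, s) \<Longrightarrow>
    g (fun_int M f ms) = fun_int M f (map g ms)"
  and automorphism_rel: "automorphism M g \<Longrightarrow> rel_type M r = Some (map (sort_of M) ms) \<Longrightarrow>
    rel_int M r (map g ms) = rel_int M r ms"
  by (simp_all add: automorphism_def)

lemma automorphismI:
  assumes "bij g" "\<And>m. sort_of M (g m) = sort_of M m"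
    and "\<And>f ms s. fun_type M f = Some (map (sort_of M) ms, s) \<Longrightarrow>
      g (fun_int M f ms) = fun_int M f (map g ms)"
    and "\<And>r ms. rel_type M r = Some (map (sort_of M) ms) \<Longrightarrow> rel_int M r (map g ms) = rel_int M r ms"
  shows "automorphism M g"
  using assms unfolding automorphism_def by auto

lemma automorphism_id: "automorphism M (\<lambda>x. x)"
  by (simp add: automorphism_def bij_def)

lemma automorphism_comp:
  assumes "automorphism M g" "automorphism M h"
  shows "automorphism M (\<lambda>x. g (h x))"
proof (rule automorphismI)
  have so: "map (sort_of M) (map h ms) = map (sort_of M) ms" for ms
    using assms(2) by (simp add: automorphism_sort)
  show "bij (\<lambda>x. g (h x))"
    using bij_comp[OF automorphism_bij[OF assms(2)] automorphism_bij[OF assms(1)]]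
    by (simp add: comp_def)
  show "sort_of M (g (h m)) = sort_of M m" for m using assms by (simp add: automorphism_sort)
  show "g (h (fun_int M f ms)) = fun_int M f (map (\<lambda>x. g (h x)) ms)"
    if "fun_type M f = Some (map (sort_of M) ms, s)" for f ms s
    using automorphism_fun[OF assms(2) that] automorphism_fun[OF assms(1), of f "map h ms" s] that so
    by (simp add: comp_def)
  show "rel_int M r (map (\<lambda>x. g (h x)) ms) = rel_int M r ms"
    if "rel_type M r = Some (map (sort_of M) ms)" for r ms
    using automorphism_rel[OF assms(2) that] automorphism_rel[OF assms(1), of r "map h ms"] that so
    by (simp add: comp_def)
qed

lemma automorphism_inv:
  assumes "automorphism M g"
  shows "automorphism M (inv g)"
proof (rule automorphismI)
  have bij: "bij g" using assms by (rule automorphism_bij)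
  then have gi: "g (inv g m) = m" "inv g (g m) = m" for m
    by (auto simp: bij_def surj_f_inv_f)
  show so: "sort_of M (inv g m) = sort_of M m" for m
    using automorphism_sort[OF assms, of "inv g m"] gi by simp
  have ml: "map g (map (inv g) ms) = ms" for ms using gi by (induction ms) auto
  have ms: "map (sort_of M) (map (inv g) ms) = map (sort_of M) ms" for ms
    using so by simp
  show "bij (inv g)" using bij by (rule bij_imp_bij_inv)
  show "inv g (fun_int M f ms) = fun_int M f (map (inv g) ms)"
    if "fun_type M f = Some (map (sort_of M) ms, s)" for f ms s
  proof -
    have "g (fun_int M f (map (inv g) ms)) = fun_int M f ms"
      using automorphism_fun[OF assms, of f "map (inv g) ms" s] that unfolding ms ml by blast
    then show ?thesis using gi(2) by metis
  qed
  show "rel_int M r (map (inv g) ms) = rel_int M r ms"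
    if "rel_type M r = Some (map (sort_of M) ms)" for r ms
    using automorphism_rel[OF assms, of r "map (inv g) ms"] that unfolding ms ml by blast
qed

section \<open>The big model\<close>

locale monster =
  fixes \<kappa> :: "'k rel" and T :: "('s, 'f, 'r, 'm, 'v) form set" and M :: "('s, 'f, 'r, 'm) struct"
  assumes big: "big_model \<kappa> T M"
begin

lemma is_structure_M: "is_structure M"
  using big by (simp add: big_model_def models_def)

lemma kappa: "Card_order \<kappa>" "natLeq <o \<kappa>" "\<kappa> \<le>o |UNIV :: 'v set|"
  using big by (simp_all add: big_model_def)

section \<open>Small sets and the supply of fresh variables\<close>

lemma infinite_kappa: "\<not> finite (Field \<kappa>)"
  using kappa by (metis Card_order_iff_ordLeq_card_of card_of_Field_ordIso infinite_iff_natLeq_ordLeq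
      ordLess_imp_ordLeq ordLess_ordLeq_trans)

lemma small_mono: "small \<kappa> B \<Longrightarrow> A \<subseteq> B \<Longrightarrow> small \<kappa> A"
  unfolding small_def using card_of_mono1 ordLeq_ordLess_trans by blast

lemma small_image: "small \<kappa> A \<Longrightarrow> small \<kappa> (f ` A)"
  unfolding small_def using card_of_image ordLeq_ordLess_trans by blast

lemma small_nat: "small \<kappa> (UNIV :: nat set)"
  unfolding small_def using card_of_nat kappa(2) ordIso_ordLess_trans by blast

lemma small_finite: "finite A \<Longrightarrow> small \<kappa> A"
  using small_image[OF small_mono[OF small_nat subset_UNIV]] finite_imp_nat_seg_image_inj_on by metis

lemma small_Un: "small \<kappa> A \<Longrightarrow> small \<kappa> B \<Longrightarrow> small \<kappa> (A \<union> B)"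
  unfolding small_def by (rule card_of_Un_ordLess_infinite_Field[OF infinite_kappa kappa(1)])

lemma small_Plus: "small \<kappa> A \<Longrightarrow> small \<kappa> B \<Longrightarrow> small \<kappa> (A <+> B)"
  unfolding small_def by (rule card_of_Plus_ordLess_infinite_Field[OF infinite_kappa kappa(1)])

text \<open>\<open>\<kappa>\<close> may be singular, hence the restriction to finite unions.\<close>

lemma small_UN: "finite I \<Longrightarrow> (\<And>i. i \<in> I \<Longrightarrow> small \<kappa> (A i)) \<Longrightarrow> small \<kappa> (\<Union>i\<in>I. A i)"
  by (induction I rule: finite_induct) (auto intro: small_Un small_finite)

lemma small_Times:
  assumes "small \<kappa> A" "small \<kappa> B"
  shows "small \<kappa> (A \<times> B)"
proof -
  \<comment> \<open>\<open>Z\<close> contains copies of \<open>A\<close>, \<open>B\<close> and the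
    natural numbers; being infinite, it is equinumerous with its square.\<close>
  define Z where "Z = A <+> (B <+> (UNIV :: nat set))"
  have Z: "small \<kappa> Z" unfolding Z_def by (intro small_Plus assms small_nat)
  have "\<not> finite Z" unfolding Z_def by simp
  then have "|Z \<times> Z| =o |Z|" by (rule card_of_Times_same_infinite)
  then have "small \<kappa> (Z \<times> Z)" using Z unfolding small_def using ordIso_ordLess_trans by blast
  moreover have "(A \<times> B) \<subseteq> (\<lambda>(x, y). (projl x, projl (projr y))) ` (Z \<times> Z)"
    unfolding Z_def by (force intro!: image_eqI)
  ultimately show ?thesis using small_image small_mono by blast
qed

text \<open>Freshness and injectivity are arranged in the second components, leaving the sorts
  arbitrary. Fewer than \<open>\<kappa>\<close> second components outside \<open>V\<close> would
  make the whole type \<open>'v\<close> small, against its size in \<open>big_model\<close>.\<close>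

lemma fresh_vars:
  fixes st :: "'a \<Rightarrow> 's" and V :: "('s, 'v) var set"
  assumes "small \<kappa> S" "small \<kappa> V"
  obtains \<rho> :: "'a \<Rightarrow> ('s, 'v) var"
  where "inj_on \<rho> S" "\<And>x. fst (\<rho> x) = st x" "\<And>x. x \<in> S \<Longrightarrow> \<rho> x \<notin> V"
proof -
  let ?U = "UNIV - snd ` V :: 'v set"
  have "\<not> |?U| <o \<kappa>"
  proof
    assume "|?U| <o \<kappa>"
    then have "small \<kappa> (?U \<union> snd ` V)" by (intro small_Un small_image assms) (simp add: small_def)
    then have "|UNIV :: 'v set| <o \<kappa>" by (simp add: small_def)
    with kappa(3) show False by (meson not_ordLess_ordLeq)
  qed
  then have "\<kappa> \<le>o |?U|" using kappa(1) not_ordLess_iff_ordLeq card_of_Well_order card_order_on_well_order_on by blast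
  then have "|S| \<le>o |?U|"
    using assms(1) unfolding small_def by (meson ordLess_imp_ordLeq ordLess_ordLeq_trans)
  then obtain f where f: "inj_on f S" "f ` S \<subseteq> ?U" by (metis card_of_ordLeq)
  show thesis
  proof (rule that[of "\<lambda>x. (st x, f x)"])
    show "inj_on (\<lambda>x. (st x, f x)) S" using f(1) by (auto simp: inj_on_def)
    show "(st x, f x) \<notin> V" if "x \<in> S" for x using f(2) that by force
  qed simp
qed

lemma compat_choice: obtains d where "\<And>s. sort_of M (d s) = s"
  using is_structure_M unfolding is_structure_def by metis

text \<open>Zorn's lemma extends a partial assignment one variable at a time, by 1-saturation.\<close>

theorem compactness:
  fixes X :: "('s, 'v) var set" and F :: "((('s, 'v) var \<Rightarrow> 'm) \<Rightarrow> bool) set"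
  assumes "small \<kappa> X" "small \<kappa> A" "\<And>P. P \<in> F \<Longrightarrow> definable M X A P"
    and fin: "\<And>F0. finite F0 \<Longrightarrow> F0 \<subseteq> F \<Longrightarrow> \<exists>a. compat M X a \<and> (\<forall>P\<in>F0. P a)"
  shows "\<exists>a. compat M X a \<and> (\<forall>P\<in>F. P a)"
proof -
  define Q where "Q F0 G0 a \<longleftrightarrow> compat M X a \<and> (\<forall>P\<in>F0. P a) \<and> (\<forall>w\<in>G0. a (fst w) = snd w)"
    for F0 G0 and a :: "('s, 'v) var \<Rightarrow> 'm"
  \<comment> \<open>A partial assignment is a graph \<open>G\<close> of which every finite part can
    be satisfied along with every finite part of \<open>F\<close>. This condition survives unions of
    chains, and it makes \<open>G\<close> single-valued and sort-respecting.\<close>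
  define fs where "fs = {G. G \<subseteq> X \<times> UNIV \<and>
    (\<forall>F0 G0. finite F0 \<longrightarrow> F0 \<subseteq> F \<longrightarrow> finite G0 \<longrightarrow> G0 \<subseteq> G \<longrightarrow> (\<exists>a. Q F0 G0 a))}"
  have "\<exists>G\<in>fs. \<forall>G'\<in>fs. G \<subseteq> G' \<longrightarrow> G' = G"
  proof (rule subset_Zorn_nonempty)
    have "{} \<in> fs" using fin by (auto simp: fs_def Q_def)
    then show "fs \<noteq> {}" by blast
  next
    fix \<C> assume C: "\<C> \<noteq> {}" "subset.chain fs \<C>"
    have "\<exists>a. Q F0 G0 a" if "finite F0" "F0 \<subseteq> F" "finite G0" "G0 \<subseteq> \<Union>\<C>" for F0 G0
    proof -
      from finite_subset_Union_chain[OF that(3,4) C] obtain G where "G \<in> \<C>" "G0 \<subseteq> G" .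
      moreover have "G \<in> fs" using C(2) \<open>G \<in> \<C>\<close> by (auto simp: subset.chain_def)
      ultimately show ?thesis using that by (auto simp: fs_def)
    qed
    moreover have "\<Union>\<C> \<subseteq> X \<times> UNIV" using C(2) by (auto simp: subset.chain_def fs_def)
    ultimately show "\<Union>\<C> \<in> fs" by (simp add: fs_def)
  qed
  then obtain G where G: "G \<in> fs" and maxl: "\<And>G'. G' \<in> fs \<Longrightarrow> G \<subseteq> G' \<Longrightarrow> G' = G" by blast
  have GQ: "\<exists>a. Q F0 G0 a" if "finite F0" "F0 \<subseteq> F" "finite G0" "G0 \<subseteq> G" for F0 G0
    using G that by (auto simp: fs_def)
  have GX: "Domain G \<subseteq> X" using G by (auto simp: fs_def)
  have sv: "m = m'" if "(v, m) \<in> G" "(v, m') \<in> G" for v m m'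
    using GQ[of "{}" "{(v, m), (v, m')}"] that by (auto simp: Q_def)
  have Gsort: "sort_of M m = fst v" if "(v, m) \<in> G" for v m
    using GQ[of "{}" "{(v, m)}"] that GX by (auto simp: Q_def compat_def)
  \<comment> \<open>Being single-valued, \<open>G\<close> has no more values than \<open>X\<close>
    has variables. These values serve as parameters below, so they must form a small set.\<close>
  have "Range G = (\<lambda>v. THE m. (v, m) \<in> G) ` Domain G"
  proof -
    have "(THE m. (v, m) \<in> G) = m" if "(v, m) \<in> G" for v m using that sv by blast
    then show ?thesis by (force simp: image_iff)
  qed
  then have "small \<kappa> (Range G)" using small_image small_mono[OF assms(1) GX] by metis
  then have smA: "small \<kappa> (A \<union> Range G)" by (intro small_Un assms(2))
  have total: "x \<in> Domain G" if x: "x \<in> X" for x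
  proof (rule ccontr)
    assume nx: "x \<notin> Domain G"
    \<comment> \<open>A missing variable \<open>x\<close> receives a value from the type of all
      projections to \<open>x\<close> of finite parts of the problem, with the values of
      \<open>G\<close> as parameters.\<close>
    define R where "R F0 G0 b \<longleftrightarrow> (\<exists>a. compat M X a \<and> (\<forall>v\<in>{x}. a v = b v) \<and> Q F0 G0 a)"
      for F0 G0 and b :: "('s, 'v) var \<Rightarrow> 'm"
    define ok where "ok F0 G0 \<longleftrightarrow> finite F0 \<and> F0 \<subseteq> F \<and> finite G0 \<and> G0 \<subseteq> G" for F0 G0
    have R: "definable M {x} (A \<union> Range G) (R F0 G0)" if "ok F0 G0" for F0 G0
    proof -
      have "definable M X (A \<union> Range G) P" if "P \<in> F0" for P
        using \<open>ok F0 G0\<close> that assms(3) unfolding ok_def by (blast intro: definable_mono)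
      moreover have "definable M X (A \<union> Range G) (\<lambda>a. a (fst w) = snd w)" if "w \<in> G0" for w
      proof (rule definable_eq_par)
        have "(fst w, snd w) \<in> G" using that \<open>ok F0 G0\<close> by (auto simp: ok_def)
        then show "fst w \<in> X" "snd w \<in> A \<union> Range G" "sort_of M (snd w) = fst (fst w)"
          using GX Gsort by (blast intro: DomainI RangeI)+
      qed
      ultimately have "definable M X (A \<union> Range G) (\<lambda>a. (\<forall>P\<in>F0. P a) \<and> (\<forall>w\<in>G0. a (fst w) = snd w))"
        using \<open>ok F0 G0\<close> unfolding ok_def by (intro definable_conj definable_ball) auto
      then have "definable M X (A \<union> Range G) (Q F0 G0)"
        by (rule definable_cong) (simp add: Q_def)
      then show ?thesis unfolding R_def using x is_structure_M by (intro definable_project) auto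
    qed
    define p where "p = {\<phi> \<in> forms_over M {x} (A \<union> Range G).
      \<exists>F0 G0. ok F0 G0 \<and> (\<forall>b. compat M {x} b \<longrightarrow> (sat M b [] \<phi> \<longleftrightarrow> R F0 G0 b))}"
    have "consistent M {x} p" unfolding consistent_def
    proof (intro allI impI)
      fix q assume q: "q \<subseteq> p" "finite q"
      then have "\<forall>\<phi>\<in>q. \<exists>w. ok (fst w) (snd w) \<and>
          (\<forall>b. compat M {x} b \<longrightarrow> (sat M b [] \<phi> \<longleftrightarrow> R (fst w) (snd w) b))"
        unfolding p_def by fastforce
      then obtain w where w: "\<And>\<phi>. \<phi> \<in> q \<Longrightarrow> ok (fst (w \<phi>)) (snd (w \<phi>))"
        "\<And>\<phi> b. \<phi> \<in> q \<Longrightarrow> compat M {x} b \<Longrightarrow> sat M b [] \<phi> \<longleftrightarrow> R (fst (w \<phi>)) (snd (w \<phi>)) b"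
        by metis
      \<comment> \<open>Finitely many finite parts unite to a finite part, so one assignment meets
        all of \<open>q\<close>.\<close>
      have "\<exists>a. Q (\<Union>\<phi>\<in>q. fst (w \<phi>)) (\<Union>\<phi>\<in>q. snd (w \<phi>)) a"
        using w(1) q(2) unfolding ok_def by (intro GQ) blast+
      then obtain a where a: "Q (\<Union>\<phi>\<in>q. fst (w \<phi>)) (\<Union>\<phi>\<in>q. snd (w \<phi>)) a" ..
      have ca: "compat M {x} a" using a x by (auto simp: Q_def compat_def)
      have "sat M a [] \<phi>" if "\<phi> \<in> q" for \<phi>
      proof -
        have "Q (fst (w \<phi>)) (snd (w \<phi>)) a" using a that unfolding Q_def by blast
        then have "R (fst (w \<phi>)) (snd (w \<phi>)) a" unfolding R_def Q_def by blast
        with w(2)[OF that ca] show ?thesis by blast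
      qed
      with ca show "\<exists>a. realises M {x} a q" unfolding realises_def by blast
    qed
    moreover have "saturated \<kappa> M T" using big by (simp add: big_model_def)
    moreover have "p \<subseteq> forms_over M {x} (A \<union> Range G)" by (auto simp: p_def)
    ultimately obtain b where b: "realises M {x} b p" using smA unfolding saturated_def by blast
    have Rb: "R F0 G0 b" if "ok F0 G0" for F0 G0
      using R[OF that] b that unfolding definable_def realises_def p_def by blast
    have "insert (x, b x) G \<in> fs"
    proof -
      have "\<exists>a. Q F0 G0 a" if "finite F0" "F0 \<subseteq> F" "finite G0" "G0 \<subseteq> insert (x, b x) G" for F0 G0
      proof -
        have "ok F0 (G0 - {(x, b x)})" using that by (auto simp: ok_def)
        from Rb[OF this] obtain a where "a x = b x" "Q F0 (G0 - {(x, b x)}) a"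
          unfolding R_def by auto
        then have "Q F0 G0 a" unfolding Q_def by (metis DiffI fst_conv singletonD snd_conv)
        then show ?thesis by blast
      qed
      then show ?thesis using G x by (simp add: fs_def)
    qed
    from maxl[OF this] nx show False by blast
  qed
  define a where "a v = (THE m. (v, m) \<in> G)" for v
  have a: "(v, a v) \<in> G" if "v \<in> X" for v
    unfolding a_def using total[OF that] sv by (metis DomainE theI)
  have "P a" if "P \<in> F" for P
  proof -
    from assms(3)[OF that] obtain \<phi> where \<phi>: "\<phi> \<in> forms_over M X A"
      "\<And>a. compat M X a \<Longrightarrow> sat M a [] \<phi> \<longleftrightarrow> P a" unfolding definable_def by blast
    have X: "fm_vars \<phi> \<subseteq> X" using \<phi>(1) by (simp add: forms_over_def)
    \<comment> \<open>\<open>P\<close> is decided by the finitely many free variables of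
      \<open>\<phi>\<close>; some assignment satisfies \<open>P\<close> and agrees with
      \<open>a\<close> on those.\<close>
    have "\<exists>a'. Q {P} ((\<lambda>v. (v, a v)) ` fm_vars \<phi>) a'"
      using that X a by (intro GQ) (auto simp: finite_fm_vars)
    then obtain a' where a': "Q {P} ((\<lambda>v. (v, a v)) ` fm_vars \<phi>) a'" ..
    have ca: "compat M X a" using Gsort[OF a] by (simp add: compat_def)
    have "sat M a' [] \<phi>" using a' \<phi>(2) by (auto simp: Q_def)
    moreover have "a v = a' v" if "v \<in> fm_vars \<phi>" for v using a' that by (auto simp: Q_def)
    ultimately have "sat M a [] \<phi>" using sat_cong by metis
    with \<phi>(2)[OF ca] show ?thesis by blast
  qed
  moreover have "compat M X a" using Gsort[OF a] by (simp add: compat_def)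
  ultimately show ?thesis by blast
qed

lemma realise_type:
  fixes X :: "('s, 'v) var set"
  assumes "small \<kappa> X" "small \<kappa> A" "p \<subseteq> forms_over M X A" "consistent M X p"
  shows "\<exists>a. realises M X a p"
proof -
  have "\<exists>a. compat M X a \<and> (\<forall>P\<in>(\<lambda>\<phi> a. sat M a [] \<phi>) ` p. P a)"
  proof (rule compactness[OF assms(1,2)])
    show "definable M X A P" if "P \<in> (\<lambda>\<phi> a. sat M a [] \<phi>) ` p" for P
      using that assms(3) definable_sat by blast
    show "\<exists>a. compat M X a \<and> (\<forall>P\<in>F0. P a)"
      if "finite F0" "F0 \<subseteq> (\<lambda>\<phi> a. sat M a [] \<phi>) ` p" for F0
    proof -
      from finite_subset_image[OF that] obtain q where q: "q \<subseteq> p" "finite q"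
        "F0 = (\<lambda>\<phi> a. sat M a [] \<phi>) ` q" by blast
      with assms(4) obtain a where "realises M X a q" unfolding consistent_def by blast
      then have "compat M X a \<and> (\<forall>P\<in>F0. P a)" unfolding q(3) realises_def by simp
      then show ?thesis by (intro exI[of _ a])
    qed
  qed
  then show ?thesis by (auto simp: realises_def)
qed

end

section \<open>Conjugacy of tuples\<close>

text \<open>For small data this says that \<open>b\<close> and \<open>b'\<close> have the same type
  over \<open>C\<close> (\<open>realises_tp_iff\<close>). The form with automorphisms is convenient
  for composing and for transporting dividing sequences.\<close>

definition conj_tuple ::
  "('s, 'f, 'r, 'm) struct \<Rightarrow> 'm set \<Rightarrow> ('s, 'v) var set \<Rightarrow> (('s, 'v) var \<Rightarrow> 'm) \<Rightarrow>
    (('s, 'v) var \<Rightarrow> 'm) \<Rightarrow> bool" where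
  "conj_tuple M C Y b b' \<longleftrightarrow>
     (\<exists>g. automorphism M g \<and> (\<forall>c\<in>C. g c = c) \<and> (\<forall>v\<in>Y. g (b v) = b' v))"

context monster
begin

lemma conj_tuple_sat:
  fixes Y :: "('s, 'v) var set"
  assumes "conj_tuple M C Y b b'" "compat M Y b" "\<phi> \<in> forms_over M Y C"
  shows "sat M b [] \<phi> \<longleftrightarrow> sat M b' [] \<phi>"
proof -
  obtain g where g: "automorphism M g" "\<And>c. c \<in> C \<Longrightarrow> g c = c" "\<And>v. v \<in> Y \<Longrightarrow> g (b v) = b' v"
    using assms(1) unfolding conj_tuple_def by blast
  have \<phi>: "wf_fm M [] \<phi>" "fm_vars \<phi> \<subseteq> Y" "fm_params \<phi> \<subseteq> C"
    using assms(3) by (auto simp: forms_over_def)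
  have "compat M (fm_vars \<phi>) b" using assms(2) \<phi>(2) by (auto simp: compat_def)
  then have "sat M (\<lambda>v. g (b v)) (map g []) \<phi> \<longleftrightarrow> sat M b [] \<phi>"
    using \<phi> g(2) by (intro sat_automorphism[OF is_structure_M g(1)]) auto
  moreover have "sat M (\<lambda>v. g (b v)) [] \<phi> \<longleftrightarrow> sat M b' [] \<phi>"
    using \<phi>(2) g(3) by (intro sat_cong) blast
  ultimately show ?thesis by simp
qed

lemma conj_tuple_compat:
  assumes "conj_tuple M C Y b b'" "compat M Y b"
  shows "compat M Y b'"
proof -
  obtain g where g: "automorphism M g" "\<And>v. v \<in> Y \<Longrightarrow> g (b v) = b' v"
    using assms(1) unfolding conj_tuple_def by blast
  have "sort_of M (b' v) = fst v" if "v \<in> Y" for v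
    using g(2)[OF that] automorphism_sort[OF g(1), of "b v"] assms(2) that by (simp add: compat_def)
  then show ?thesis by (simp add: compat_def)
qed

text \<open>Strong homogeneity speaks of types over the empty set. The elements of \<open>C\<close>
  are therefore named by fresh variables \<open>\<rho> c\<close> and adjoined to both tuples; the
  resulting automorphism fixes \<open>C\<close>.\<close>

lemma conj_tupleI:
  fixes Y :: "('s, 'v) var set"
  assumes "small \<kappa> Y" "small \<kappa> C" "compat M Y b" "compat M Y b'"
    and imp: "\<And>\<phi>. \<phi> \<in> forms_over M Y C \<Longrightarrow> sat M b [] \<phi> \<Longrightarrow> sat M b' [] \<phi>"
  shows "conj_tuple M C Y b b'"
proof -
  obtain \<rho> :: "'m \<Rightarrow> ('s, 'v) var" where \<rho>: "inj_on \<rho> C" "\<And>c. fst (\<rho> c) = sort_of M c"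
    "\<And>c. c \<in> C \<Longrightarrow> \<rho> c \<notin> Y"
    using fresh_vars[OF assms(2,1), of "sort_of M"] by blast
  define ext where "ext c v = (if v \<in> \<rho> ` C then inv_into C \<rho> v else c v)"
    for c and v :: "('s, 'v) var"
  define \<sigma> :: "('s, 'v) var \<Rightarrow> (('s, 'v) var, 'f, 'm) tm" where "\<sigma> v = (if v \<in> \<rho> ` C then Par (inv_into C \<rho> v) else Var v)"
    for v :: "('s, 'v) var"
  have ext: "ext c (\<rho> x) = x" if "x \<in> C" for c x using that \<rho>(1) by (simp add: ext_def)
  have extY: "ext c v = c v" if "v \<in> Y" for c v using that \<rho>(3) by (auto simp: ext_def)
  have \<sigma>: "atomic_tm (\<sigma> v)" for v by (simp add: \<sigma>_def atomic_tm_def)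
  have eval: "(\<lambda>v. eval M c [] (\<sigma> v)) = ext c" for c by (auto simp: \<sigma>_def ext_def)
  have form: "subst \<sigma> \<phi> \<in> forms_over M Y C" if "\<phi> \<in> forms_over M (Y \<union> \<rho> ` C) {}" for \<phi>
  proof -
    have "has_sort M [] (\<sigma> v) (fst v)" for v using \<rho>(1,2) by (auto simp: \<sigma>_def)
    then have "wf_fm M [] (subst \<sigma> \<phi>)" using that \<sigma> by (intro wf_fm_subst) (auto simp: forms_over_def)
    moreover have "tm_vars (\<sigma> v) \<subseteq> Y" "tm_params (\<sigma> v) \<subseteq> C" if "v \<in> Y \<union> \<rho> ` C" for v
      using that by (auto simp: \<sigma>_def inv_into_into)
    ultimately show ?thesis
      using that unfolding forms_over_def by (fastforce simp: fm_vars_subst fm_params_subst)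
  qed
  have cext: "compat M (Y \<union> \<rho> ` C) (ext c)" if "compat M Y c" for c
    using that extY ext \<rho>(2) unfolding compat_def by auto
  \<comment> \<open>Applying the hypothesis to negations makes the implication an
    equivalence.\<close>
  have iff: "sat M b [] \<phi> \<longleftrightarrow> sat M b' [] \<phi>" if "\<phi> \<in> forms_over M Y C" for \<phi>
    using imp[OF that] imp[of "Neg \<phi>"] that by (auto simp: forms_over_def)
  have "tp M (Y \<union> \<rho> ` C) (ext b) {} = tp M (Y \<union> \<rho> ` C) (ext b') {}"
  proof -
    have "sat M (ext b) [] \<phi> \<longleftrightarrow> sat M (ext b') [] \<phi>"
      if "\<phi> \<in> forms_over M (Y \<union> \<rho> ` C) {}" for \<phi>
      using iff[OF form[OF that]] by (simp add: sat_subst[OF \<sigma>] eval)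
    then show ?thesis by (auto simp: tp_def)
  qed
  moreover have "strongly_homogeneous \<kappa> M T" using big by (simp add: big_model_def)
  ultimately obtain g where g: "automorphism M g" "\<And>v. v \<in> Y \<union> \<rho> ` C \<Longrightarrow> g (ext b v) = ext b' v"
    using cext[OF assms(3)] cext[OF assms(4)] small_Un[OF assms(1) small_image[OF assms(2)]]
    unfolding strongly_homogeneous_def by metis
  have "g c = c" if "c \<in> C" for c using g(2)[of "\<rho> c"] that ext by simp
  moreover have "g (b v) = b' v" if "v \<in> Y" for v using g(2)[of v] that extY by simp
  ultimately show ?thesis using g(1) unfolding conj_tuple_def by blast
qed

lemma realises_tp_iff:
  fixes Y :: "('s, 'v) var set"
  assumes "small \<kappa> Y" "small \<kappa> C" "compat M Y b"
  shows "realises M Y b' (tp M Y b C) \<longleftrightarrow> conj_tuple M C Y b b'"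
proof
  assume r: "realises M Y b' (tp M Y b C)"
  then have "compat M Y b'" by (simp add: realises_def)
  moreover have "sat M b' [] \<phi>" if "\<phi> \<in> forms_over M Y C" "sat M b [] \<phi>" for \<phi>
    using that r unfolding realises_def tp_def by blast
  ultimately show "conj_tuple M C Y b b'" by (intro conj_tupleI assms)
next
  assume c: "conj_tuple M C Y b b'"
  have "sat M b' [] \<phi>" if "\<phi> \<in> tp M Y b C" for \<phi>
    using that conj_tuple_sat[OF c assms(3)] unfolding tp_def by blast
  with conj_tuple_compat[OF c assms(3)] show "realises M Y b' (tp M Y b C)"
    unfolding realises_def by blast
qed

end

section \<open>Dividing\<close>

lemma compat_mono: "compat M X a \<Longrightarrow> Y \<subseteq> X \<Longrightarrow> compat M Y a"
  unfolding compat_def by blast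

abbreviation rvars :: "('s, 'f, 'r, 'm, 'v) ipair \<Rightarrow> ('s, 'v) var set" where
  "rvars e \<equiv> set (rblock e)"

definition wvars :: "('s, 'f, 'r, 'm, 'v) ipair \<Rightarrow> ('s, 'v) var set" where
  "wvars e = (\<Union>ys\<in>set (wblocks e). set ys)"

lemma finite_wvars: "finite (wvars e)"
  by (simp add: wvars_def)

lemma XiD:
  assumes "e \<in> Xi M"
  shows "phi e \<in> forms_over M (lblock e \<union> rvars e) {}" "psi e \<in> forms_over M (wvars e) {}"
    and "\<And>ys. ys \<in> set (wblocks e) \<Longrightarrow> map fst ys = map fst (rblock e)"
    and "\<And>ys. ys \<in> set (wblocks e) \<Longrightarrow> length ys = length (rblock e)"
    and "disjoint_blocks e"
proof -
  show "phi e \<in> forms_over M (lblock e \<union> rvars e) {}"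
    using assms by (auto simp: Xi_def forms_over_def lblock_def)
  show l: "map fst ys = map fst (rblock e)" if "ys \<in> set (wblocks e)" for ys
    using assms that by (simp add: Xi_def)
  show "length ys = length (rblock e)" if "ys \<in> set (wblocks e)" for ys
    using l[OF that] map_eq_imp_length_eq by blast
qed (use assms in \<open>auto simp: Xi_def wvars_def\<close>)

lemma lblock_rvars: "lblock e \<inter> rvars e = {}" "finite (lblock e)"
  by (auto simp: lblock_def finite_fm_vars)

lemma sat_inst:
  "sat M a [] (inst e b) \<longleftrightarrow> sat M (\<lambda>v. if v \<in> rvars e then b v else a v) [] (phi e)"
proof -
  have "(\<lambda>v. eval M a [] (if v \<in> rvars e then Par (b v) else Var v)) =
      (\<lambda>v. if v \<in> rvars e then b v else a v)" by auto
  then show ?thesis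
    unfolding inst_def by (subst sat_subst) (auto simp: atomic_tm_def)
qed

lemma sat_inst_cong:
  assumes "\<And>v. v \<in> lblock e \<Longrightarrow> a v = a' v" "\<And>v. v \<in> rvars e \<Longrightarrow> b v = b' v"
  shows "sat M a [] (inst e b) \<longleftrightarrow> sat M a' [] (inst e b')"
  unfolding sat_inst
proof (rule sat_cong)
  fix v assume "v \<in> fm_vars (phi e)"
  then show "(if v \<in> rvars e then b v else a v) = (if v \<in> rvars e then b' v else a' v)"
    using assms[of v] by (simp add: lblock_def)
qed

lemma fm_vars_inst: "fm_vars (inst e b) = lblock e"
  unfolding inst_def lblock_def fm_vars_subst by (auto split: if_splits)

lemma inst_form:
  assumes "e \<in> Xi M" "compat M (rvars e) b" "lblock e \<subseteq> X" "b ` rvars e \<subseteq> B"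
  shows "inst e b \<in> forms_over M X B"
proof -
  have phi: "wf_fm M [] (phi e)" "fm_params (phi e) = {}"
    using XiD(1)[OF assms(1)] by (auto simp: forms_over_def)
  have "wf_fm M [] (inst e b)" unfolding inst_def
    using assms(2) by (intro wf_fm_subst phi(1)) (simp_all add: atomic_tm_def compat_def)
  moreover have "fm_params (inst e b) \<subseteq> B"
    unfolding inst_def fm_params_subst phi(2) using assms(4) by (auto split: if_splits)
  ultimately show ?thesis using fm_vars_inst[of e b] assms(3) by (simp add: forms_over_def)
qed

lemma sat_inst_automorphism:
  assumes "is_structure M" "automorphism M g" "e \<in> Xi M" "compat M (lblock e) a" "compat M (rvars e) b"
  shows "sat M (\<lambda>v. g (a v)) [] (inst e (\<lambda>v. g (b v))) \<longleftrightarrow> sat M a [] (inst e b)"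
proof -
  let ?c = "\<lambda>v. if v \<in> rvars e then b v else a v"
  have phi: "wf_fm M [] (phi e)" "fm_params (phi e) = {}"
    using XiD(1)[OF assms(3)] by (auto simp: forms_over_def)
  have "compat M (fm_vars (phi e)) ?c" using assms(4,5) by (simp add: compat_def lblock_def)
  then have "sat M (\<lambda>v. g (?c v)) (map g []) (phi e) \<longleftrightarrow> sat M ?c [] (phi e)"
    using phi by (intro sat_automorphism[OF assms(1,2)]) auto
  moreover have "(\<lambda>v. g (?c v)) = (\<lambda>v. if v \<in> rvars e then g (b v) else g (a v))" by auto
  ultimately show ?thesis by (simp only: sat_inst list.map)
qed

lemma psi_holds_cong:
  assumes "psi_holds M e bs" "list_all2 (\<lambda>b b'. \<forall>v\<in>rvars e. b v = b' v) bs bs'"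
  shows "psi_holds M e bs'"
proof -
  obtain s where s: "list_all2 (\<lambda>ys b. map s ys = map b (rblock e)) (wblocks e) bs"
    "sat M s [] (psi e)" using assms(1) unfolding psi_holds_def by blast
  have "list_all2 (\<lambda>ys b. map s ys = map b (rblock e)) (wblocks e) bs'"
    by (rule list_all2_trans[OF _ s(1) assms(2)]) auto
  with s(2) show ?thesis unfolding psi_holds_def by blast
qed

text \<open>The assignment \<open>s\<close> behind \<open>psi_holds\<close> is moved by
  \<open>g\<close> too. It respects sorts on \<open>wvars e\<close> because its values there are the
  entries of the tuples \<open>bs\<close>.\<close>

lemma psi_holds_automorphism:
  assumes "is_structure M" "automorphism M g" "e \<in> Xi M" "\<And>b. b \<in> set bs \<Longrightarrow> compat M (rvars e) b"
    and "psi_holds M e bs"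
  shows "psi_holds M e (map (\<lambda>b v. g (b v)) bs)"
proof -
  obtain s where s: "list_all2 (\<lambda>ys b. map s ys = map b (rblock e)) (wblocks e) bs"
    "sat M s [] (psi e)" using assms(5) unfolding psi_holds_def by blast
  have psi: "wf_fm M [] (psi e)" "fm_params (psi e) = {}" "fm_vars (psi e) \<subseteq> wvars e"
    using XiD(2)[OF assms(3)] by (auto simp: forms_over_def)
  have "compat M (wvars e) s"
  proof -
    have "sort_of M (s v) = fst v" if ys: "ys \<in> set (wblocks e)" and v: "v \<in> set ys" for v ys
    proof -
      obtain j where j: "j < length (wblocks e)" "ys = wblocks e ! j"
        using ys by (auto simp: in_set_conv_nth)
      then have "map s ys = map (bs ! j) (rblock e)" "bs ! j \<in> set bs"
        using list_all2_nthD[OF s(1) j(1)] list_all2_lengthD[OF s(1)] by simp_all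
      then obtain b where b: "b \<in> set bs" "map s ys = map b (rblock e)" by blast
      have "map (sort_of M) (map b (rblock e)) = map fst (rblock e)"
        using assms(4)[OF b(1)] by (simp add: compat_def)
      then have "map (sort_of M) (map s ys) = map fst ys"
        unfolding b(2) using XiD(3)[OF assms(3) ys] by simp
      with v show ?thesis by (simp del: map_map add: map_map[unfolded comp_def])
    qed
    then show ?thesis unfolding compat_def wvars_def by blast
  qed
  then have "compat M (fm_vars (psi e)) s" using psi(3) by (rule compat_mono)
  then have "sat M (\<lambda>v. g (s v)) (map g []) (psi e)"
    using s(2) psi sat_automorphism[OF assms(1,2) psi(1), of "[]" s] by simp
  moreover have "list_all2 (\<lambda>ys b. map (\<lambda>v. g (s v)) ys = map b (rblock e)) (wblocks e)
      (map (\<lambda>b v. g (b v)) bs)"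
    unfolding list.rel_map
  proof (rule list.rel_mono_strong[OF s(1)])
    fix ys b assume "map s ys = map b (rblock e)"
    then have "map g (map s ys) = map g (map b (rblock e))" by simp
    then show "map (\<lambda>v. g (s v)) ys = map (\<lambda>v. g (b v)) (rblock e)" by (simp add: comp_def)
  qed
  ultimately show ?thesis unfolding psi_holds_def by auto
qed

text \<open>The variable \<open>\<rho> i v\<close> holds entry v of the tuple with index i. The
  hidden assignment of \<open>psi_holds\<close> lives on \<open>wvars e\<close>, disjoint from
  \<open>V\<close>; equations link its values to the entries, and then it is projected away.\<close>

lemma definable_psi_holds:
  fixes M :: "('s, 'f, 'r, 'm) struct" and V :: "('s, 'v) var set"
  assumes "is_structure M" "e \<in> Xi M" "length js = length (wblocks e)"
    and \<rho>: "\<And>i v. fst (\<rho> i v) = fst v" "\<And>i v. v \<in> rvars e \<Longrightarrow> \<rho> i v \<in> V" and "V \<inter> wvars e = {}"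
  shows "definable M V A (\<lambda>a. psi_holds M e (map (\<lambda>i v. a (\<rho> i v)) js))"
proof -
  let ?k = "length (wblocks e)" and ?m = "length (rblock e)"
  define Q where "Q a \<longleftrightarrow> (\<forall>j\<in>{..<?k}. \<forall>l\<in>{..<?m}.
      a (wblocks e ! j ! l) = a (\<rho> (js ! j) (rblock e ! l))) \<and> sat M a [] (psi e)"
    for a :: "('s, 'v) var \<Rightarrow> 'm"
  have ws: "wblocks e ! j ! l \<in> wvars e" "fst (wblocks e ! j ! l) = fst (rblock e ! l)"
    if "j < ?k" "l < ?m" for j l
  proof -
    have "map fst (wblocks e ! j) = map fst (rblock e)" "length (wblocks e ! j) = ?m"
      using XiD(3,4)[OF assms(2) nth_mem[OF that(1)]] .
    with that show "wblocks e ! j ! l \<in> wvars e" "fst (wblocks e ! j ! l) = fst (rblock e ! l)"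
      unfolding wvars_def by (metis UN_I nth_mem, metis nth_map)
  qed
  have Q_eq: "list_all2 (\<lambda>ys b. map s ys = map b (rblock e)) (wblocks e) (map (\<lambda>i v. a (\<rho> i v)) js) \<longleftrightarrow>
    (\<forall>j\<in>{..<?k}. \<forall>l\<in>{..<?m}. s (wblocks e ! j ! l) = a (\<rho> (js ! j) (rblock e ! l)))" for s a
    using XiD(4)[OF assms(2)] assms(3)
    by (auto simp: list_all2_conv_all_nth list_eq_iff_nth_eq)
  have "definable M (V \<union> wvars e) A (\<lambda>a. sat M a [] (psi e))"
    using definable_mono[OF definable_sat[OF XiD(2)[OF assms(2)]]] by blast
  moreover have "definable M (V \<union> wvars e) A
      (\<lambda>a. a (wblocks e ! j ! l) = a (\<rho> (js ! j) (rblock e ! l)))" if "j \<in> {..<?k}" "l \<in> {..<?m}" for j l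
    using that ws[of j l] \<rho> by (intro definable_eq_vars) auto
  ultimately have "definable M (V \<union> wvars e) A Q"
    unfolding Q_def by (intro definable_conj definable_ball) auto
  then have "definable M V A (\<lambda>b. \<exists>a. compat M (V \<union> wvars e) a \<and> (\<forall>v\<in>V. a v = b v) \<and> Q a)"
    by (rule definable_project[OF _ _ assms(1)]) simp
  then show ?thesis
  proof (rule definable_cong)
    fix b assume b: "compat M V b"
    show "(\<exists>a. compat M (V \<union> wvars e) a \<and> (\<forall>v\<in>V. a v = b v) \<and> Q a) \<longleftrightarrow>
      psi_holds M e (map (\<lambda>i v. b (\<rho> i v)) js)"
    proof
      assume "\<exists>a. compat M (V \<union> wvars e) a \<and> (\<forall>v\<in>V. a v = b v) \<and> Q a"
      then obtain a where a: "\<And>v. v \<in> V \<Longrightarrow> a v = b v" "Q a" by blast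
      have "list_all2 (\<lambda>ys b. map a ys = map b (rblock e)) (wblocks e) (map (\<lambda>i v. b (\<rho> i v)) js)"
        unfolding Q_eq
      proof (intro ballI)
        fix j l assume jl: "j \<in> {..<?k}" "l \<in> {..<?m}"
        then have "a (wblocks e ! j ! l) = a (\<rho> (js ! j) (rblock e ! l))" using a(2) by (simp add: Q_def)
        with a(1)[of "\<rho> (js ! j) (rblock e ! l)"] \<rho>(2) jl
        show "a (wblocks e ! j ! l) = b (\<rho> (js ! j) (rblock e ! l))" by simp
      qed
      with a(2) show "psi_holds M e (map (\<lambda>i v. b (\<rho> i v)) js)" unfolding psi_holds_def Q_def by blast
    next
      assume "psi_holds M e (map (\<lambda>i v. b (\<rho> i v)) js)"
      then obtain s where s: "\<forall>j\<in>{..<?k}. \<forall>l\<in>{..<?m}. s (wblocks e ! j ! l) = b (\<rho> (js ! j) (rblock e ! l))"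
        "sat M s [] (psi e)" unfolding psi_holds_def Q_eq by blast
      let ?a = "\<lambda>v. if v \<in> wvars e then s v else b v"
      have ab: "?a v = b v" if "v \<in> V" for v using that assms(6) by auto
      have "sort_of M (s v) = fst v" if "v \<in> wvars e" for v
      proof -
        obtain j l where jl: "j < ?k" "l < ?m" "v = wblocks e ! j ! l"
          using \<open>v \<in> wvars e\<close> XiD(4)[OF assms(2)] unfolding wvars_def by (metis UN_E in_set_conv_nth)
        then have "s v = b (\<rho> (js ! j) (rblock e ! l))" using s(1) by simp
        moreover have "\<rho> (js ! j) (rblock e ! l) \<in> V" using \<rho>(2) jl(2) by simp
        ultimately show ?thesis using b \<rho>(1) ws(2)[OF jl(1,2)] jl(3) by (simp add: compat_def)
      qed
      then have "compat M (V \<union> wvars e) ?a" using b unfolding compat_def ball_Un by simp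
      moreover have "Q ?a" unfolding Q_def
      proof (intro conjI ballI)
        fix j l assume jl: "j \<in> {..<?k}" "l \<in> {..<?m}"
        then have "?a (\<rho> (js ! j) (rblock e ! l)) = b (\<rho> (js ! j) (rblock e ! l))"
          using \<rho>(2) by (intro ab) simp
        moreover have "?a (wblocks e ! j ! l) = s (wblocks e ! j ! l)" using ws(1) jl by simp
        ultimately show "?a (wblocks e ! j ! l) = ?a (\<rho> (js ! j) (rblock e ! l))"
          using s(1) jl by (simp only:)
      next
        have "fm_vars (psi e) \<subseteq> wvars e" using XiD(2)[OF assms(2)] by (simp add: forms_over_def)
        then show "sat M ?a [] (psi e)" using s(2) by (subst sat_cong[of _ _ s]) auto
      qed
      ultimately show "\<exists>a. compat M (V \<union> wvars e) a \<and> (\<forall>v\<in>V. a v = b v) \<and> Q a"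
        using ab by blast
    qed
  qed
qed

lemma divides_mono:
  assumes "divides M e b C" "C' \<subseteq> C"
  shows "divides M e b C'"
proof -
  have "tp M Y b C' \<subseteq> tp M Y b C" for Y using assms(2) by (auto simp: tp_def forms_over_def)
  with assms(1) show ?thesis unfolding divides_def realises_def by blast
qed

context monster
begin

lemma divides_iff:
  fixes e :: "('s, 'f, 'r, 'm, 'v) ipair"
  assumes "small \<kappa> C" "compat M (rvars e) b"
  shows "divides M e b C \<longleftrightarrow> (\<exists>\<beta> :: nat \<Rightarrow> ('s, 'v) var \<Rightarrow> 'm. (\<forall>i. conj_tuple M C (rvars e) b (\<beta> i)) \<and>
    (\<forall>js. sorted_wrt (<) js \<longrightarrow> length js = length (wblocks e) \<longrightarrow> psi_holds M e (map \<beta> js)))"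
  unfolding divides_def realises_tp_iff[OF small_finite[OF finite_set] assms] ..

lemma divides_cong:
  assumes "\<And>v. v \<in> rvars e \<Longrightarrow> b v = b' v"
  shows "divides M e b C \<longleftrightarrow> divides M e b' C"
proof -
  have "tp M (rvars e) b C = tp M (rvars e) b' C"
  proof -
    have "sat M b [] \<phi> \<longleftrightarrow> sat M b' [] \<phi>" if "\<phi> \<in> forms_over M (rvars e) C" for \<phi>
      using that assms by (intro sat_cong) (auto simp: forms_over_def)
    then show ?thesis unfolding tp_def by blast
  qed
  then show ?thesis by (simp add: divides_def)
qed

lemma compat_automorphism:
  "automorphism M g \<Longrightarrow> compat M Y b \<Longrightarrow> compat M Y (\<lambda>v. g (b v))"
  by (simp add: compat_def automorphism_sort)

text \<open>If \<open>h\<close> moves \<open>b\<close> to a term of the dividing sequence over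
  \<open>C\<close>, its conjugate by \<open>g\<close> does the same for the images.\<close>

lemma divides_automorphism:
  fixes e :: "('s, 'f, 'r, 'm, 'v) ipair"
  assumes "automorphism M g" "e \<in> Xi M" "small \<kappa> C" "compat M (rvars e) b" "divides M e b C"
  shows "divides M e (\<lambda>v. g (b v)) (g ` C)"
proof -
  obtain \<beta> :: "nat \<Rightarrow> ('s, 'v) var \<Rightarrow> 'm" where \<beta>: "\<And>i. conj_tuple M C (rvars e) b (\<beta> i)"
    "\<And>js. sorted_wrt (<) js \<Longrightarrow> length js = length (wblocks e) \<Longrightarrow> psi_holds M e (map \<beta> js)"
    using assms(5) unfolding divides_iff[OF assms(3,4)] by blast
  have inv: "inv g (g x) = x" for x using automorphism_bij[OF assms(1)] by (simp add: bij_def)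
  have "conj_tuple M (g ` C) (rvars e) (\<lambda>v. g (b v)) (\<lambda>v. g (\<beta> i v))" for i
  proof -
    obtain h where h: "automorphism M h" "\<And>c. c \<in> C \<Longrightarrow> h c = c"
      "\<And>v. v \<in> rvars e \<Longrightarrow> h (b v) = \<beta> i v"
      using \<beta>(1)[of i] unfolding conj_tuple_def by blast
    have "automorphism M (\<lambda>x. g (h (inv g x)))"
      by (intro automorphism_comp[OF assms(1)] automorphism_comp[OF h(1)] automorphism_inv assms(1))
    then show ?thesis unfolding conj_tuple_def
      by (intro exI[of _ "\<lambda>x. g (h (inv g x))"]) (simp add: inv h)
  qed
  moreover have "psi_holds M e (map (\<lambda>i v. g (\<beta> i v)) js)"
    if "sorted_wrt (<) js" "length js = length (wblocks e)" for js
  proof -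
    have "compat M (rvars e) c" if "c \<in> set (map \<beta> js)" for c
      using that conj_tuple_compat[OF \<beta>(1) assms(4)] by auto
    from psi_holds_automorphism[OF is_structure_M assms(1,2) this \<beta>(2)[OF that]]
    show ?thesis by (simp add: comp_def)
  qed
  ultimately show ?thesis
    unfolding divides_iff[OF small_image[OF assms(3)] compat_automorphism[OF assms(1,4)]]
    by (intro exI[of _ "\<lambda>i v. g (\<beta> i v)"]) blast
qed

text \<open>By compactness and the pigeonhole principle, the sequence witnessing that \<open>\<phi>(x;b)\<close> divides over
  \<open>C\<close> may be taken in a single type over the larger set \<open>C'\<close>.\<close>

lemma divides_extend_base:
  fixes e :: "('s, 'f, 'r, 'm, 'v) ipair"
  assumes "e \<in> Xi M" "small \<kappa> C'" "C \<subseteq> C'" "compat M (rvars e) b" "divides M e b C"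
  obtains g where "automorphism M g" "\<And>c. c \<in> C \<Longrightarrow> g c = c" "divides M e (\<lambda>v. g (b v)) C'"
proof -
  let ?Y = "rvars e"
  note smC = small_mono[OF assms(2,3)]
  note smY = small_finite[OF finite_set, of "rblock e"]
  obtain \<beta> :: "nat \<Rightarrow> ('s, 'v) var \<Rightarrow> 'm" where \<beta>: "\<And>i. conj_tuple M C ?Y b (\<beta> i)"
    "\<And>js. sorted_wrt (<) js \<Longrightarrow> length js = length (wblocks e) \<Longrightarrow> psi_holds M e (map \<beta> js)"
    using assms(5) unfolding divides_iff[OF smC assms(4)] by blast
  have c\<beta>: "compat M ?Y (\<beta> i)" for i using conj_tuple_compat[OF \<beta>(1) assms(4)] .
  let ?S = "(UNIV :: nat set) \<times> ?Y"
  have smS: "small \<kappa> ?S" by (intro small_Times small_nat smY)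
  obtain \<rho>' :: "nat \<times> ('s, 'v) var \<Rightarrow> ('s, 'v) var" where \<rho>': "inj_on \<rho>' ?S"
    "\<And>x. fst (\<rho>' x) = fst (snd x)" "\<And>x. x \<in> ?S \<Longrightarrow> \<rho>' x \<notin> wvars e"
    using fresh_vars[OF smS small_finite[OF finite_wvars], of "\<lambda>x. fst (snd x)"] by blast
  define \<rho> where "\<rho> n v = \<rho>' (n, v)" for n v
  define V where "V = \<rho>' ` ?S"
  have \<rho>: "fst (\<rho> n v) = fst v" "v \<in> ?Y \<Longrightarrow> \<rho> n v \<in> V" for n v
    using \<rho>'(2)[of "(n, v)"] by (auto simp: \<rho>_def V_def)
  have VW: "V \<inter> wvars e = {}" using \<rho>'(3) by (auto simp: V_def)
  define P1 where "P1 \<chi> n a \<longleftrightarrow> sat M (\<lambda>v. a (\<rho> n v)) [] \<chi>"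
    for \<chi> :: "('s, 'f, 'r, 'm, 'v) form" and n and a :: "('s, 'v) var \<Rightarrow> 'm"
  define P3 where "P3 js a \<longleftrightarrow> psi_holds M e (map (\<lambda>i v. a (\<rho> i v)) js)"
    for js and a :: "('s, 'v) var \<Rightarrow> 'm"
  \<comment> \<open>The variable \<open>\<rho> n v\<close> is entry v of term n. \<open>F1\<close>
    puts every term in the type of \<open>b\<close> over \<open>C\<close>, \<open>F2\<close> makes
    all terms equal in type over \<open>C'\<close>, and \<open>F3\<close> states the instances of
    \<open>psi e\<close> along increasing indices.\<close>
  define F1 where "F1 = {P1 \<chi> n |\<chi> n. \<chi> \<in> tp M ?Y b C}"
  define F2 where "F2 \<chi> = range (\<lambda>n a. P1 \<chi> n a \<longleftrightarrow> P1 \<chi> 0 a)" for \<chi>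
  define F3 where "F3 = {P3 js |js. sorted_wrt (<) js \<and> length js = length (wblocks e)}"
  let ?F = "F1 \<union> (\<Union>\<chi>\<in>forms_over M ?Y C'. F2 \<chi>) \<union> F3"
  have P1def: "definable M V C' (P1 \<chi> n)" if "\<chi> \<in> forms_over M ?Y C'" for \<chi> n
  proof -
    have "\<rho> n ` ?Y \<subseteq> V" using \<rho>(2) by blast
    from definable_rename[OF definable_sat[OF that] \<rho>(1) this] show ?thesis
      unfolding P1_def by simp
  qed
  have "\<exists>a. compat M V a \<and> (\<forall>P\<in>?F. P a)"
  proof (rule compactness)
    show "small \<kappa> V" unfolding V_def by (intro small_image smS)
    show "small \<kappa> C'" by fact
  next
    fix P assume "P \<in> ?F"
    then consider "P \<in> F1" | \<chi> where "\<chi> \<in> forms_over M ?Y C'" "P \<in> F2 \<chi>" | "P \<in> F3" by blast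
    then show "definable M V C' P"
    proof cases
      case 1
      then obtain \<chi> n where "P = P1 \<chi> n" "\<chi> \<in> forms_over M ?Y C" unfolding F1_def tp_def by blast
      with assms(3) P1def show ?thesis unfolding forms_over_def by blast
    next
      case 2
      then obtain n where "P = (\<lambda>a. P1 \<chi> n a \<longleftrightarrow> P1 \<chi> 0 a)" unfolding F2_def by blast
      with P1def[OF 2(1)] show ?thesis by (auto intro: definable_iff)
    next
      case 3
      then obtain js where "P = P3 js" "length js = length (wblocks e)" unfolding F3_def by blast
      then show ?thesis unfolding P3_def
        by (simp add: definable_psi_holds[OF is_structure_M assms(1) _ \<rho>(1,2) VW])
    qed
  next
    fix F0 assume F0: "finite F0" "F0 \<subseteq> ?F"
    have "\<exists>K. finite K \<and> K \<subseteq> forms_over M ?Y C' \<and> F0 \<subseteq> F1 \<union> (\<Union>\<chi>\<in>K. F2 \<chi>) \<union> F3"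
      using F0
    proof (induction F0 rule: finite_induct)
      case (insert P F0)
      then obtain K where K: "finite K" "K \<subseteq> forms_over M ?Y C'" "F0 \<subseteq> F1 \<union> (\<Union>\<chi>\<in>K. F2 \<chi>) \<union> F3" by blast
      from insert.prems have "P \<in> F1 \<union> F3 \<or> (\<exists>\<chi>\<in>forms_over M ?Y C'. P \<in> F2 \<chi>)" by blast
      then show ?case
      proof
        assume "P \<in> F1 \<union> F3"
        with K show ?thesis by blast
      next
        assume "\<exists>\<chi>\<in>forms_over M ?Y C'. P \<in> F2 \<chi>"
        then obtain \<chi> where "P \<in> F2 \<chi>" "\<chi> \<in> forms_over M ?Y C'" ..
        with K show ?thesis by (intro exI[of _ "insert \<chi> K"]) blast
      qed
    qed auto
    then obtain K where K: "finite K" "K \<subseteq> forms_over M ?Y C'" "F0 \<subseteq> F1 \<union> (\<Union>\<chi>\<in>K. F2 \<chi>) \<union> F3" by blast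
    \<comment> \<open>Colour the index i by the formulas of \<open>K\<close> true of
      \<open>\<beta> i\<close>. Infinitely many indices share a colour, and along them
      \<open>F2\<close> holds for \<open>K\<close>; taking them in increasing order preserves
      \<open>F3\<close>.\<close>
    have "finite (range (\<lambda>i. {\<chi>\<in>K. sat M (\<beta> i) [] \<chi>}))"
      by (rule finite_subset[of _ "Pow K"]) (use K(1) in auto)
    then obtain i0 where "infinite {i. {\<chi>\<in>K. sat M (\<beta> i) [] \<chi>} = {\<chi>\<in>K. sat M (\<beta> i0) [] \<chi>}}"
      using pigeonhole_infinite[of UNIV "\<lambda>i. {\<chi>\<in>K. sat M (\<beta> i) [] \<chi>}"] by auto
    from infinite_enumerate[OF this] obtain r where r: "strict_mono (r :: nat \<Rightarrow> nat)"
      "\<forall>n. r n \<in> {i. {\<chi>\<in>K. sat M (\<beta> i) [] \<chi>} = {\<chi>\<in>K. sat M (\<beta> i0) [] \<chi>}}" by blast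
    have rK: "sat M (\<beta> (r n)) [] \<chi> \<longleftrightarrow> sat M (\<beta> (r 0)) [] \<chi>" if "\<chi> \<in> K" for \<chi> n
      using r(2)[rule_format, of n] r(2)[rule_format, of 0] that by blast
    obtain d where d: "\<And>s. sort_of M (d s) = s" using compat_choice by blast
    define a where "a w = (if w \<in> V then \<beta> (r (fst (inv_into ?S \<rho>' w))) (snd (inv_into ?S \<rho>' w)) else d (fst w))"
      for w
    have a: "a (\<rho> n v) = \<beta> (r n) v" if "v \<in> ?Y" for n v
    proof -
      have "inv_into ?S \<rho>' (\<rho> n v) = (n, v)"
        unfolding \<rho>_def using \<rho>'(1) that by (intro inv_into_f_f) auto
      then show ?thesis using \<rho>(2)[OF that, of n] by (simp add: a_def)
    qed
    have ca: "compat M V a" unfolding compat_def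
    proof
      fix w assume "w \<in> V"
      then obtain n v where w: "v \<in> ?Y" "w = \<rho> n v" unfolding V_def \<rho>_def by auto
      show "sort_of M (a w) = fst w"
        unfolding w(2) a[OF w(1)] \<rho>(1) using c\<beta> w(1) by (simp add: compat_def)
    qed
    have P1: "P1 \<chi> n a \<longleftrightarrow> sat M (\<beta> (r n)) [] \<chi>" if "fm_vars \<chi> \<subseteq> ?Y" for \<chi> n
      unfolding P1_def using that a by (intro sat_cong) blast
    have "P a" if "P \<in> F0" for P
    proof -
      from that K F0 consider "P \<in> F1" | \<chi> where "\<chi> \<in> K" "P \<in> F2 \<chi>" | "P \<in> F3" by blast
      then show "P a"
      proof cases
        case 1
        then obtain \<chi> n where \<chi>: "P = P1 \<chi> n" "\<chi> \<in> tp M ?Y b C" unfolding F1_def by blast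
        then have "sat M (\<beta> (r n)) [] \<chi>" using conj_tuple_sat[OF \<beta>(1) assms(4)] unfolding tp_def by blast
        with \<chi> P1 show ?thesis unfolding tp_def forms_over_def by blast
      next
        case 2
        then obtain n where n: "P = (\<lambda>a. P1 \<chi> n a \<longleftrightarrow> P1 \<chi> 0 a)" unfolding F2_def by blast
        have "fm_vars \<chi> \<subseteq> ?Y" using K(2) 2(1) by (auto simp: forms_over_def)
        from P1[OF this] rK[OF 2(1)] show ?thesis unfolding n by simp
      next
        case 3
        then obtain js where js: "P = P3 js" "sorted_wrt (<) js" "length js = length (wblocks e)"
          unfolding F3_def by blast
        have "sorted_wrt (<) (map r js)"
          unfolding sorted_wrt_map using js(2) by (rule sorted_wrt_mono_rel[rotated]) (simp add: r(1) strict_mono_less)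
        then have "psi_holds M e (map \<beta> (map r js))"
          by (rule \<beta>(2)) (simp add: js(3))
        then have "psi_holds M e (map (\<lambda>i v. a (\<rho> i v)) js)"
          by (rule psi_holds_cong) (simp add: list.rel_map a list_all2_same)
        then show ?thesis unfolding js(1) P3_def .
      qed
    qed
    with ca show "\<exists>a. compat M V a \<and> (\<forall>P\<in>F0. P a)" by (intro exI[of _ a]) blast
  qed
  then obtain a where a: "compat M V a" "\<And>P. P \<in> ?F \<Longrightarrow> P a" by blast
  define \<gamma> where "\<gamma> n = (\<lambda>v. a (\<rho> n v))" for n
  have c\<gamma>: "compat M ?Y (\<gamma> n)" for n
    using a(1) \<rho> unfolding compat_def \<gamma>_def by simp
  \<comment> \<open>The new sequence starts with a conjugate of \<open>b\<close> over
    \<open>C\<close>, which gives \<open>g\<close>; by \<open>F2\<close> and \<open>F3\<close> it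
    witnesses dividing over \<open>C'\<close>.\<close>
  have "conj_tuple M C ?Y b (\<gamma> 0)"
  proof (rule conj_tupleI[OF smY smC assms(4) c\<gamma>])
    fix \<phi> assume "\<phi> \<in> forms_over M ?Y C" "sat M b [] \<phi>"
    then have "P1 \<phi> 0 \<in> ?F" unfolding F1_def tp_def by blast
    from a(2)[OF this] show "sat M (\<gamma> 0) [] \<phi>" by (simp add: P1_def \<gamma>_def)
  qed
  then obtain g where g: "automorphism M g" "\<And>c. c \<in> C \<Longrightarrow> g c = c"
    "\<And>v. v \<in> ?Y \<Longrightarrow> g (b v) = \<gamma> 0 v" unfolding conj_tuple_def by blast
  have "conj_tuple M C' ?Y (\<gamma> 0) (\<gamma> n)" for n
  proof (rule conj_tupleI[OF smY assms(2) c\<gamma> c\<gamma>])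
    fix \<phi> assume \<phi>: "\<phi> \<in> forms_over M ?Y C'" "sat M (\<gamma> 0) [] \<phi>"
    then have "(\<lambda>a. P1 \<phi> n a \<longleftrightarrow> P1 \<phi> 0 a) \<in> ?F" unfolding F2_def by blast
    from a(2)[OF this] \<phi>(2) show "sat M (\<gamma> n) [] \<phi>" by (simp add: P1_def \<gamma>_def)
  qed
  moreover have "psi_holds M e (map \<gamma> js)"
    if "sorted_wrt (<) js" "length js = length (wblocks e)" for js
  proof -
    have "P3 js \<in> ?F" using that unfolding F3_def by blast
    from a(2)[OF this] show ?thesis unfolding P3_def \<gamma>_def .
  qed
  ultimately have "divides M e (\<gamma> 0) C'" unfolding divides_iff[OF assms(2) c\<gamma>] by blast
  then have "divides M e (\<lambda>v. g (b v)) C'" using divides_cong[of e "\<lambda>v. g (b v)" "\<gamma> 0"] g(3) by blast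
  with g(1,2) that show thesis by blast
qed

end

section \<open>Independence\<close>

lemma sat_foldr_Conj: "sat M a e (foldr Conj \<phi>s Tru) \<longleftrightarrow> (\<forall>\<phi>\<in>set \<phi>s. sat M a e \<phi>)"
  by (induction \<phi>s) auto

lemma sat_all_equal:
  fixes M :: "('s, 'f, 'r, 'm) struct" and s :: "('s, 'v) var \<Rightarrow> 'm"
  assumes "\<And>zs. zs \<in> set zss \<Longrightarrow> map s zs = cs"
  shows "sat M s [] (all_equal zss)"
  unfolding all_equal_def sat_foldr_Conj
proof
  fix \<phi> :: "('s, 'f, 'r, 'm, 'v) form"
  assume "\<phi> \<in> set (concat (map (\<lambda>(zs, zs'). map2 (\<lambda>z z'. Eq (Var z) (Var z')) zs zs') (zip zss (tl zss))))"
  then obtain zs zs' z z' where z: "(zs, zs') \<in> set (zip zss (tl zss))" "(z, z') \<in> set (zip zs zs')"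
    "\<phi> = Eq (Var z) (Var z')" by auto
  have "zs \<in> set zss" "zs' \<in> set (tl zss)" using z(1) by (auto dest: set_zip_leftD set_zip_rightD)
  moreover have "set (tl zss) \<subseteq> set zss" by (cases zss) auto
  ultimately have eq: "map s zs = map s zs'" using assms by (metis subsetD)
  obtain i where i: "i < length zs" "i < length zs'" "z = zs ! i" "z' = zs' ! i"
    using z(2) by (auto simp: in_set_zip)
  have "map s zs ! i = map s zs' ! i" using eq by simp
  then have "s z = s z'" using i by simp
  with z(3) show "sat M s [] \<phi>" by simp
qed

context monster
begin

lemma indep_iff:
  "indep \<kappa> M \<Omega> A C B \<longleftrightarrow> (\<forall>X a e b. small \<kappa> X \<longrightarrow> compat M X a \<longrightarrow> a ` X \<subseteq> A \<longrightarrow> e \<in> \<Omega> \<longrightarrow>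
     compat M (rvars e) b \<longrightarrow> b ` rvars e \<subseteq> B \<union> C \<longrightarrow> inst e b \<in> tp M X a (B \<union> C) \<longrightarrow>
     \<not> divides M e b C)"
  unfolding indep_def type_divides_def by meson

lemma indepD:
  assumes "indep \<kappa> M \<Omega> A C B" "small \<kappa> X" "compat M X a" "a ` X \<subseteq> A" "e \<in> \<Omega>"
    and "compat M (rvars e) b" "b ` rvars e \<subseteq> B \<union> C" "inst e b \<in> tp M X a (B \<union> C)"
  shows "\<not> divides M e b C"
  using assms(1)[unfolded indep_iff, rule_format, OF assms(2-8)] .

lemma indep_mono:
  assumes "indep \<kappa> M \<Omega> A C B" "B' \<subseteq> B"
  shows "indep \<kappa> M \<Omega> A C B'"
  unfolding indep_iff
proof (intro allI impI)
  fix X a e b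
  assume a: "small \<kappa> X" "compat M X a" "a ` X \<subseteq> A" "e \<in> \<Omega>" "compat M (rvars e) b"
    and b: "b ` rvars e \<subseteq> B' \<union> C" "inst e b \<in> tp M X a (B' \<union> C)"
  have "tp M X a (B' \<union> C) \<subseteq> tp M X a (B \<union> C)" using assms(2) by (auto simp: tp_def forms_over_def)
  with b(2) have tp: "inst e b \<in> tp M X a (B \<union> C)" by (rule subsetD[rotated])
  have "b ` rvars e \<subseteq> B \<union> C" using b(1) assms(2) by blast
  then show "\<not> divides M e b C" using tp by (rule indepD[OF assms(1) a])
qed

text \<open>The inverse of \<open>g\<close> pulls a dividing instance among the images back to one
  for \<open>A\<close> and \<open>B\<close> over \<open>C\<close>.\<close>

lemma indep_automorphism:
  fixes \<Omega> :: "('s, 'f, 'r, 'm, 'v) ipair set"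
  assumes "indep \<kappa> M \<Omega> A C B" "automorphism M g" "\<Omega> \<subseteq> Xi M" "small \<kappa> C"
  shows "indep \<kappa> M \<Omega> (g ` A) (g ` C) (g ` B)"
  unfolding indep_iff
proof (intro allI impI notI)
  fix X a e b
  assume X: "small \<kappa> X" "compat M X a" "a ` X \<subseteq> g ` A"
    and e: "e \<in> \<Omega>" "compat M (rvars e) b" "b ` rvars e \<subseteq> g ` B \<union> g ` C"
    and tp: "inst e b \<in> tp M X a (g ` B \<union> g ` C)" and div: "divides M e b (g ` C)"
  let ?h = "inv g"
  have h: "automorphism M ?h" by (rule automorphism_inv[OF assms(2)])
  have hg: "?h (g x) = x" for x using automorphism_bij[OF assms(2)] by (simp add: bij_def)
  then have hgC: "?h ` g ` C = C" by (simp add: image_image)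
  have Xi: "e \<in> Xi M" using e(1) assms(3) by blast
  have lX: "lblock e \<subseteq> X" using tp fm_vars_inst[of e b] by (auto simp: tp_def forms_over_def)
  have ca: "compat M X (\<lambda>v. ?h (a v))" by (rule compat_automorphism[OF h X(2)])
  have im: "(\<lambda>v. ?h (a v)) ` X \<subseteq> A" using X(3) hg by force
  have cb: "compat M (rvars e) (\<lambda>v. ?h (b v))" by (rule compat_automorphism[OF h e(2)])
  have sub: "(\<lambda>v. ?h (b v)) ` rvars e \<subseteq> B \<union> C" using e(3) hg by force
  have "inst e (\<lambda>v. ?h (b v)) \<in> tp M X (\<lambda>v. ?h (a v)) (B \<union> C)"
    using sat_inst_automorphism[OF is_structure_M h Xi compat_mono[OF X(2) lX] e(2)]
      inst_form[OF Xi cb lX sub] tp by (simp add: tp_def)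
  from indepD[OF assms(1) X(1) ca im e(1) cb sub this]
  have "\<not> divides M e (\<lambda>v. ?h (b v)) C" .
  moreover have "divides M e (\<lambda>v. ?h (b v)) C"
    using divides_automorphism[OF h Xi small_image[OF assms(4)] e(2) div] hgC by simp
  ultimately show False by contradiction
qed

text \<open>Normality moves the entries of a tuple that lie in \<open>D\<close> to the side of the parameters.\<close>

lemma indep_normal:
  fixes \<Omega> :: "('s, 'f, 'r, 'm, 'v) ipair set"
  assumes "indep \<kappa> M \<Omega> B C E" "normal \<Omega>" "\<Omega> \<subseteq> Xi M" "small \<kappa> D" "C \<subseteq> D" "D \<subseteq> C \<union> E"
  shows "indep \<kappa> M \<Omega> (B \<union> D) D E"
  unfolding indep_iff
proof (intro allI impI notI)
  fix X a e d
  assume X: "small \<kappa> X" "compat M X a" "a ` X \<subseteq> B \<union> D"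
    and e: "e \<in> \<Omega>" "compat M (rvars e) d" "d ` rvars e \<subseteq> E \<union> D"
    and tp: "inst e d \<in> tp M X a (E \<union> D)" and div: "divides M e d D"
  have Xi: "e \<in> Xi M" using e(1) assms(3) by blast
  have lX: "lblock e \<subseteq> X" using tp fm_vars_inst[of e d] by (auto simp: tp_def forms_over_def)
  let ?k = "length (wblocks e)"
  \<comment> \<open>\<open>Z\<close> collects the left-hand variables with values in
    \<open>D\<close>. They become parameters, so the entries that stay on the left lie in
    \<open>B\<close>.\<close>
  define Z where "Z = {v \<in> lblock e. a v \<in> D}"
  have Zl: "Z \<subseteq> lblock e" by (auto simp: Z_def)
  then have finZ: "finite Z" using lblock_rvars(2) finite_subset by blast
  then obtain zs where zs: "set zs = Z" "distinct zs" using finite_distinct_list by blast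
  let ?S = "{..<?k} \<times> Z"
  have "small \<kappa> ?S" using finZ by (intro small_finite) simp
  moreover have "small \<kappa> (lblock e \<union> rvars e \<union> wvars e)"
    by (intro small_finite) (simp add: lblock_rvars(2) finite_wvars)
  ultimately obtain \<rho> :: "nat \<times> ('s, 'v) var \<Rightarrow> ('s, 'v) var" where \<rho>: "inj_on \<rho> ?S"
    "\<And>x. fst (\<rho> x) = fst (snd x)" "\<And>x. x \<in> ?S \<Longrightarrow> \<rho> x \<notin> lblock e \<union> rvars e \<union> wvars e"
    using fresh_vars[of ?S _ "\<lambda>x. fst (snd x)"] by blast
  \<comment> \<open>Each of the k witness blocks receives its own fresh copy of \<open>zs\<close>,
    as normality requires disjoint tuples.\<close>
  define zss where "zss = map (\<lambda>j. map (\<lambda>v. \<rho> (j, v)) zs) [0..<?k]"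
  have lz: "length zss = ?k" by (simp add: zss_def)
  have zj: "zss ! j = map (\<lambda>v. \<rho> (j, v)) zs" if "j < ?k" for j using that by (simp add: zss_def)
  have zsort: "map fst zs' = map fst zs" if "zs' \<in> set zss" for zs'
    using that \<rho>(2) by (auto simp: zss_def)
  have zset: "set zs' \<subseteq> \<rho> ` ?S" if "zs' \<in> set zss" for zs' using that zs(1) by (auto simp: zss_def)
  have blocks: "disjnt (lblock e) (rvars e)" "sorted_wrt disjnt (map set (wblocks e))"
    "\<And>ys. ys \<in> set (wblocks e) \<Longrightarrow> disjnt (lblock e) (set ys) \<and> disjnt (rvars e) (set ys)"
    using XiD(5)[OF Xi] by (auto simp: disjoint_blocks_def)
  have zfresh: "disjnt (lblock e) (set zs') \<and> disjnt (rvars e) (set zs') \<and> disjnt (set zs') (wvars e)"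
    if "zs' \<in> set zss" for zs'
    using zset[OF that] \<rho>(3) unfolding disjnt_def by blast
  have "sorted_wrt disjnt (map set zss)"
    unfolding sorted_wrt_iff_nth_less
  proof (intro allI impI)
    fix i j assume ij: "i < j" "j < length (map set zss)"
    then have "set (zss ! i) = \<rho> ` ({i} \<times> Z)" "set (zss ! j) = \<rho> ` ({j} \<times> Z)"
      using zj[of i] zj[of j] lz zs(1) by auto
    moreover have "\<rho> ` ({i} \<times> Z) \<inter> \<rho> ` ({j} \<times> Z) = \<rho> ` (({i} \<times> Z) \<inter> ({j} \<times> Z))"
      using ij lz by (intro inj_on_image_Int[OF \<rho>(1), symmetric]) auto
    moreover have "({i} \<times> Z) \<inter> ({j} \<times> Z) = {}" using ij(1) by auto
    ultimately show "disjnt (map set zss ! i) (map set zss ! j)" using ij lz by (simp add: disjnt_def)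
  qed
  have zw: "disjnt (set zs') (set ys)" if "zs' \<in> set zss" "ys \<in> set (wblocks e)" for zs' ys
    using zfresh[OF that(1)] that(2) unfolding wvars_def disjnt_def by blast
  have "sorted_wrt disjnt ((lblock e - set zs) # set zs # rvars e # map set zss @ map set (wblocks e))"
  proof -
    have sub: "disjnt (lblock e - Z) S \<and> disjnt Z S" if "disjnt (lblock e) S" for S
      using that Zl unfolding disjnt_def by blast
    have "disjnt (lblock e - Z) Z" unfolding disjnt_def by blast
    moreover note sub[OF blocks(1)] blocks(2)
    moreover have "disjnt (lblock e - Z) (set zs') \<and> disjnt Z (set zs') \<and> disjnt (rvars e) (set zs')"
      if "zs' \<in> set zss" for zs' using zfresh[OF that] sub by blast
    moreover have "disjnt (lblock e - Z) (set ys) \<and> disjnt Z (set ys) \<and> disjnt (rvars e) (set ys)"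
      if "ys \<in> set (wblocks e)" for ys using blocks(3)[OF that] sub by blast
    ultimately show ?thesis
      using \<open>sorted_wrt disjnt (map set zss)\<close> zw
      by (simp add: sorted_wrt_append zs(1) ball_Un)
  qed
  with assms(2) e(1) lz zsort have e': "shift_ipair zs zss e \<in> \<Omega>" unfolding normal_def by blast
  let ?e = "shift_ipair zs zss e"
  have rb: "rblock ?e = zs @ rblock e" and ph: "phi ?e = phi e"
    and wb: "wblocks ?e = map2 (@) zss (wblocks e)" and ps: "psi ?e = Conj (psi e) (all_equal zss)"
    by (simp_all add: shift_ipair_def)
  have rv: "rvars ?e = Z \<union> rvars e" by (simp add: rb zs(1))
  have Zr: "Z \<inter> rvars e = {}" using Zl lblock_rvars(1)[of e] by blast
  have lb: "lblock ?e = lblock e - Z" unfolding lblock_def rv ph by blast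
  \<comment> \<open>The enlarged parameter tuple still has its entries in
    \<open>E \<union> C\<close>, by \<open>D \<subseteq> C \<union> E\<close>.\<close>
  define b where "b v = (if v \<in> Z then a v else d v)" for v
  have cb: "compat M (rvars ?e) b"
    using e(2) X(2) lX Zl unfolding rv compat_def b_def by auto
  have bE: "b ` rvars ?e \<subseteq> E \<union> C"
  proof
    fix m assume "m \<in> b ` rvars ?e"
    then obtain v where v: "v \<in> Z \<union> rvars e" "m = b v" unfolding rv by blast
    then have "m \<in> E \<union> D" using e(3) unfolding b_def Z_def by (auto split: if_splits)
    then show "m \<in> E \<union> C" using assms(6) by blast
  qed
  have sl: "small \<kappa> (lblock ?e)" using lblock_rvars(2) by (rule small_finite)
  have cl: "compat M (lblock ?e) a" using X(2) lX lb by (auto intro: compat_mono)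
  have al: "a ` lblock ?e \<subseteq> B" using X(3) lX unfolding lb Z_def by blast
  have "inst ?e b \<in> tp M (lblock ?e) a (E \<union> C)"
  proof -
    have Xi': "?e \<in> Xi M" using e' assms(3) by blast
    have "sat M a [] (inst ?e b) \<longleftrightarrow> sat M a [] (inst e d)"
    proof -
      have "(\<lambda>v. if v \<in> rvars ?e then b v else a v) = (\<lambda>v. if v \<in> rvars e then d v else a v)"
      proof
        fix v show "(if v \<in> rvars ?e then b v else a v) = (if v \<in> rvars e then d v else a v)"
          using Zr unfolding rv b_def by (cases "v \<in> Z") auto
      qed
      then show ?thesis unfolding sat_inst ph by simp
    qed
    then show ?thesis
      using inst_form[OF Xi' cb subset_refl bE] tp by (simp add: tp_def)
  qed
  from indepD[OF assms(1) sl cl al e' cb bE this] have "\<not> divides M ?e b C" .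
  moreover have "divides M ?e b C"
  proof -
    obtain \<beta> :: "nat \<Rightarrow> ('s, 'v) var \<Rightarrow> 'm" where \<beta>: "\<And>i. conj_tuple M D (rvars e) d (\<beta> i)"
      "\<And>js. sorted_wrt (<) js \<Longrightarrow> length js = ?k \<Longrightarrow> psi_holds M e (map \<beta> js)"
      using div unfolding divides_iff[OF assms(4) e(2)] by blast
    \<comment> \<open>The entries moved over lie in \<open>D\<close>, so conjugations over
      \<open>D\<close> fix them; keeping them constant along the sequence is what the added
      equations ask.\<close>
    define \<gamma> where "\<gamma> i v = (if v \<in> Z then a v else \<beta> i v)" for i v
    have "conj_tuple M D (rvars ?e) b (\<gamma> i)" for i
    proof -
      obtain g where g: "automorphism M g" "\<And>c. c \<in> D \<Longrightarrow> g c = c" "\<And>v. v \<in> rvars e \<Longrightarrow> g (d v) = \<beta> i v"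
        using \<beta>(1)[of i] unfolding conj_tuple_def by blast
      have "g (b v) = \<gamma> i v" if "v \<in> rvars ?e" for v
        using that g(2)[of "a v"] g(3)[of v] unfolding rv b_def \<gamma>_def Z_def by auto
      with g show ?thesis unfolding conj_tuple_def by blast
    qed
    moreover have "psi_holds M ?e (map \<gamma> js)"
      if js: "sorted_wrt (<) js" "length js = length (wblocks ?e)" for js
    proof -
      have ljs: "length js = ?k" using js(2) lz by (simp add: wb)
      obtain s where s: "list_all2 (\<lambda>ys b. map s ys = map b (rblock e)) (wblocks e) (map \<beta> js)"
        "sat M s [] (psi e)" using \<beta>(2)[OF js(1) ljs] unfolding psi_holds_def by blast
      \<comment> \<open>The fresh copies of \<open>zs\<close> all take the values of
        \<open>a\<close>, hence agree across the blocks; on \<open>wvars e\<close> nothing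
        changes.\<close>
      define t where "t w = (if w \<in> \<rho> ` ?S then a (snd (inv_into ?S \<rho> w)) else s w)" for w
      have t\<rho>: "t (\<rho> (j, v)) = a v" if "j < ?k" "v \<in> Z" for j v
      proof -
        have "(j, v) \<in> ?S" using that by simp
        then show ?thesis using \<rho>(1) by (simp add: t_def del: mem_Sigma_iff)
      qed
      have ts: "t w = s w" if "w \<in> wvars e" for w using that \<rho>(3) by (auto simp: t_def)
      have tz: "map t (zss ! j) = map a zs" if "j < ?k" for j
        using that zs(1) by (simp add: zj t\<rho>)
      have "sat M t [] (all_equal zss)"
        using tz lz by (intro sat_all_equal[of _ _ "map a zs"]) (metis in_set_conv_nth)
      moreover have "sat M t [] (psi e)"
      proof -
        have "fm_vars (psi e) \<subseteq> wvars e" using XiD(2)[OF Xi] by (simp add: forms_over_def)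
        then show ?thesis using s(2) ts by (subst sat_cong[of _ _ s]) auto
      qed
      moreover have "list_all2 (\<lambda>ys b. map t ys = map b (rblock ?e)) (wblocks ?e) (map \<gamma> js)"
        unfolding list_all2_conv_all_nth
      proof (intro conjI allI impI)
        show "length (wblocks ?e) = length (map \<gamma> js)" using js(2) by simp
        fix j assume "j < length (wblocks ?e)"
        then have j: "j < ?k" using lz by (simp add: wb)
        have "map t (wblocks e ! j) = map s (wblocks e ! j)"
          using ts nth_mem[OF j] unfolding wvars_def by auto
        also have "\<dots> = map (\<beta> (js ! j)) (rblock e)" using list_all2_nthD[OF s(1) j] j ljs by simp
        also have "\<dots> = map (\<gamma> (js ! j)) (rblock e)" using Zr unfolding \<gamma>_def by auto
        finally have "map t (wblocks e ! j) = map (\<gamma> (js ! j)) (rblock e)" .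
        moreover have "map a zs = map (\<gamma> (js ! j)) zs" using zs(1) by (simp add: \<gamma>_def)
        ultimately show "map t (wblocks ?e ! j) = map (map \<gamma> js ! j) (rblock ?e)"
          using j ljs lz tz[OF j] by (simp add: wb rb)
      qed
      ultimately show ?thesis unfolding psi_holds_def ps by auto
    qed
    ultimately have "divides M ?e b D" unfolding divides_iff[OF assms(4) cb] by blast
    then show ?thesis using assms(5) by (rule divides_mono)
  qed
  ultimately show False by contradiction
qed

end

section \<open>Dividing patterns\<close>

lemma image_fixed: "(\<And>x. x \<in> A \<Longrightarrow> g x = x) \<Longrightarrow> g ` A = A"
  by simp

definition earlier ::
  "(nat \<Rightarrow> ('s, 'f, 'r, 'm, 'v) ipair) \<Rightarrow> (nat \<Rightarrow> ('s, 'v) var \<Rightarrow> 'm) \<Rightarrow> nat \<Rightarrow> 'm set" where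
  "earlier \<xi> b i = (\<Union>j<i. b j ` rvars (\<xi> j))"

text \<open>The bases \<open>C i\<close> may vary with \<open>i\<close> so that a pattern can be moved to a larger base step by step.\<close>

definition realised_pattern ::
  "('s, 'f, 'r, 'm) struct \<Rightarrow> (nat \<Rightarrow> 'm set) \<Rightarrow> nat \<Rightarrow> (nat \<Rightarrow> ('s, 'f, 'r, 'm, 'v) ipair) \<Rightarrow>
    (('s, 'v) var \<Rightarrow> 'm) \<Rightarrow> (nat \<Rightarrow> ('s, 'v) var \<Rightarrow> 'm) \<Rightarrow> bool" where
  "realised_pattern M C n \<xi> a b \<longleftrightarrow>
     (\<forall>i<n. compat M (rvars (\<xi> i)) (b i) \<and> sat M a [] (inst (\<xi> i) (b i)) \<and>
        divides M (\<xi> i) (b i) (C i \<union> earlier \<xi> b i))"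

lemma earlier_mono: "i \<le> j \<Longrightarrow> earlier \<xi> b i \<subseteq> earlier \<xi> b j"
  unfolding earlier_def by (intro UN_mono) auto

lemma earlier_automorphism: "earlier \<xi> (\<lambda>i v. g (b i v)) i = g ` earlier \<xi> b i"
  unfolding earlier_def by (simp add: image_UN image_image)

lemma realised_pattern_cong:
  assumes "realised_pattern M C n \<xi> a b" "\<And>i. i < n \<Longrightarrow> lblock (\<xi> i) \<subseteq> X"
    and "\<And>v. v \<in> X \<Longrightarrow> a v = a' v"
  shows "realised_pattern M C n \<xi> a' b"
proof -
  have "sat M a [] (inst (\<xi> i) (b i)) \<longleftrightarrow> sat M a' [] (inst (\<xi> i) (b i))" if "i < n" for i
    using assms(2)[OF that] assms(3) by (intro sat_inst_cong) auto
  with assms(1) show ?thesis unfolding realised_pattern_def by blast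
qed

context monster
begin

lemma small_earlier: "small \<kappa> (earlier \<xi> b i)"
  unfolding earlier_def by (intro small_UN small_finite) auto

lemma realised_pattern_automorphism:
  fixes \<xi> :: "nat \<Rightarrow> ('s, 'f, 'r, 'm, 'v) ipair"
  assumes "realised_pattern M C n \<xi> a b" "automorphism M g" "\<And>i. i < n \<Longrightarrow> small \<kappa> (C i)"
    and "\<And>i. i < n \<Longrightarrow> \<xi> i \<in> Xi M" "compat M X a" "\<And>i. i < n \<Longrightarrow> lblock (\<xi> i) \<subseteq> X"
  shows "realised_pattern M (\<lambda>i. g ` C i) n \<xi> (\<lambda>v. g (a v)) (\<lambda>i v. g (b i v))"
  unfolding realised_pattern_def
proof (intro allI impI)
  fix i assume i: "i < n"
  then have p: "compat M (rvars (\<xi> i)) (b i)" "sat M a [] (inst (\<xi> i) (b i))"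
    "divides M (\<xi> i) (b i) (C i \<union> earlier \<xi> b i)"
    using assms(1) by (auto simp: realised_pattern_def)
  have "sat M (\<lambda>v. g (a v)) [] (inst (\<xi> i) (\<lambda>v. g (b i v)))"
    using sat_inst_automorphism[OF is_structure_M assms(2) assms(4)[OF i]
        compat_mono[OF assms(5) assms(6)[OF i]] p(1)] p(2) by simp
  moreover have "divides M (\<xi> i) (\<lambda>v. g (b i v)) (g ` C i \<union> earlier \<xi> (\<lambda>i v. g (b i v)) i)"
    unfolding earlier_automorphism image_Un[symmetric]
    by (rule divides_automorphism[OF assms(2) assms(4)[OF i] small_Un[OF assms(3)[OF i] small_earlier] p(1,3)])
  ultimately show "compat M (rvars (\<xi> i)) (\<lambda>v. g (b i v)) \<and>
      sat M (\<lambda>v. g (a v)) [] (inst (\<xi> i) (\<lambda>v. g (b i v))) \<and>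
      divides M (\<xi> i) (\<lambda>v. g (b i v)) (g ` C i \<union> earlier \<xi> (\<lambda>i v. g (b i v)) i)"
    using compat_automorphism[OF assms(2) p(1)] by blast
qed

text \<open>The bases are enlarged one position at a time. At position m the extension is done over
  the parameters before m as well, so the automorphism fixes these, while later positions are moved
  along with \<open>C\<close> fixed.\<close>

lemma realised_pattern_extend_base:
  fixes \<xi> :: "nat \<Rightarrow> ('s, 'f, 'r, 'm, 'v) ipair"
  assumes "realised_pattern M (\<lambda>_. C) n \<xi> a b" "small \<kappa> C'" "C \<subseteq> C'"
    and "\<And>i. i < n \<Longrightarrow> \<xi> i \<in> Xi M" "compat M X a" "\<And>i. i < n \<Longrightarrow> lblock (\<xi> i) \<subseteq> X"
  obtains g b' where "automorphism M g" "\<And>c. c \<in> C \<Longrightarrow> g c = c"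
    "realised_pattern M (\<lambda>_. C') n \<xi> (\<lambda>v. g (a v)) b'"
proof -
  have "\<exists>g b'. automorphism M g \<and> (\<forall>c\<in>C. g c = c) \<and>
    realised_pattern M (\<lambda>i. if i < m then C' else C) n \<xi> (\<lambda>v. g (a v)) b'" if "m \<le> n" for m
    using that
  proof (induction m)
    case 0
    show ?case using assms(1) by (intro exI[of _ "\<lambda>x. x"] exI[of _ b]) (simp add: automorphism_id)
  next
    case (Suc m)
    let ?C = "\<lambda>i. if i < m then C' else C"
    from Suc obtain g b' where g: "automorphism M g" "\<And>c. c \<in> C \<Longrightarrow> g c = c"
      and p: "realised_pattern M ?C n \<xi> (\<lambda>v. g (a v)) b'" by auto
    have m: "m < n" using Suc.prems by simp
    let ?U = "earlier \<xi> b' m"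
    have "divides M (\<xi> m) (b' m) (C \<union> ?U)" "compat M (rvars (\<xi> m)) (b' m)"
      using p m by (auto simp: realised_pattern_def)
    then obtain h where h: "automorphism M h" "\<And>c. c \<in> C \<union> ?U \<Longrightarrow> h c = c"
      "divides M (\<xi> m) (\<lambda>v. h (b' m v)) (C' \<union> ?U)"
      using divides_extend_base[OF assms(4)[OF m], of "C' \<union> ?U" "C \<union> ?U" "b' m"]
        small_Un[OF assms(2) small_earlier] assms(3) by blast
    have smC: "small \<kappa> C" using small_mono assms(2,3) by blast
    have "realised_pattern M (\<lambda>i. h ` ?C i) n \<xi> (\<lambda>v. h (g (a v))) (\<lambda>i v. h (b' i v))"
      using smC assms(2)
      by (intro realised_pattern_automorphism[OF p h(1) _ assms(4) compat_automorphism[OF g(1) assms(5)] assms(6)])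
        auto
    then have p': "compat M (rvars (\<xi> i)) (\<lambda>v. h (b' i v))"
      "sat M (\<lambda>v. h (g (a v))) [] (inst (\<xi> i) (\<lambda>v. h (b' i v)))"
      "divides M (\<xi> i) (\<lambda>v. h (b' i v)) (h ` ?C i \<union> earlier \<xi> (\<lambda>i v. h (b' i v)) i)" if "i < n" for i
      using that by (auto simp: realised_pattern_def)
    have hC: "h ` C = C" using h(2) by (intro image_fixed) simp
    have hU: "earlier \<xi> (\<lambda>i v. h (b' i v)) i = earlier \<xi> b' i" if "i \<le> m" for i
    proof -
      have "h x = x" if "x \<in> earlier \<xi> b' i" for x 
        using that earlier_mono[OF \<open>i \<le> m\<close>, of \<xi> b'] by (intro h(2)) blast
      then show ?thesis unfolding earlier_automorphism by (rule image_fixed)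
    qed
    have "realised_pattern M (\<lambda>i. if i < Suc m then C' else C) n \<xi> (\<lambda>v. h (g (a v))) (\<lambda>i v. h (b' i v))"
      unfolding realised_pattern_def
    proof (intro allI impI conjI p')
      fix i assume i: "i < n"
      consider "i < m" | "i = m" | "m < i" by linarith
      then show "divides M (\<xi> i) (\<lambda>v. h (b' i v))
          ((if i < Suc m then C' else C) \<union> earlier \<xi> (\<lambda>i v. h (b' i v)) i)"
      proof cases
        case 1
        \<comment> \<open>\<open>h\<close> may move \<open>C'\<close>, so dividing at earlier
          positions is taken from the previous stage, their parameters being fixed by
          \<open>h\<close>.\<close>
        have "h (b' i v) = b' i v" if "v \<in> rvars (\<xi> i)" for v
          using that 1 by (intro h(2)) (auto simp: earlier_def)
        then have "divides M (\<xi> i) (\<lambda>v. h (b' i v)) (C' \<union> earlier \<xi> b' i) \<longleftrightarrow>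
            divides M (\<xi> i) (b' i) (C' \<union> earlier \<xi> b' i)"
          by (rule divides_cong)
        with p i 1 hU[of i] show ?thesis by (auto simp: realised_pattern_def)
      next
        case 2
        with h(3) hU[of m] show ?thesis by simp
      next
        case 3
        with p'(3)[OF i] hC show ?thesis by simp
      qed
    qed
    moreover have "h (g c) = c" if "c \<in> C" for c using that h(2) g(2) by simp
    ultimately show ?case
      by (intro exI[of _ "\<lambda>x. h (g x)"] exI[of _ "\<lambda>i v. h (b' i v)"]) (simp add: automorphism_comp h(1) g(1))
  qed
  from this[of n] obtain g b' where g: "automorphism M g" "\<And>c. c \<in> C \<Longrightarrow> g c = c"
    "realised_pattern M (\<lambda>i. if i < n then C' else C) n \<xi> (\<lambda>v. g (a v)) b'" by auto
  moreover have "realised_pattern M (\<lambda>_. C') n \<xi> (\<lambda>v. g (a v)) b'"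
    using g(3) by (simp add: realised_pattern_def)
  ultimately show thesis using that by blast
qed

text \<open>Only the parameters change. The automorphism that moves them fixes \<open>C\<close> and
  the entries of \<open>a\<close>, so the result is again a pattern realised by \<open>a\<close>
  itself.\<close>

lemma realised_pattern_transfer:
  fixes \<xi> :: "nat \<Rightarrow> ('s, 'f, 'r, 'm, 'v) ipair"
  assumes p: "realised_pattern M (\<lambda>_. C) n \<xi> a b" and star: "indep_star \<kappa> M \<Omega> B C (a ` X)"
    and "\<Omega> \<subseteq> Xi M" "transitive \<kappa> M \<Omega>" "normal \<Omega>" "small \<kappa> X" "small \<kappa> B" "small \<kappa> C"
    and \<xi>: "\<And>i. i < n \<Longrightarrow> \<xi> i \<in> \<Omega>" and "compat M X a" "\<And>i. i < n \<Longrightarrow> lblock (\<xi> i) \<subseteq> X"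
  obtains b' where "realised_pattern M (\<lambda>_. B \<union> C) n \<xi> a b'"
proof -
  have Xi: "\<xi> i \<in> Xi M" if "i < n" for i using \<xi>[OF that] assms(3) by blast
  \<comment> \<open>The enlargement includes all parameters of the pattern, so that
    \<open>B'\<close> is independent from them too; the inverse of \<open>g\<close> then carries
    \<open>B'\<close> back to \<open>B\<close>.\<close>
  let ?B = "a ` X \<union> earlier \<xi> b n"
  have "small \<kappa> ?B" by (intro small_Un small_image small_earlier assms(6))
  then obtain B' where "conj_over M (a ` X \<union> C) B B'" and B': "indep \<kappa> M \<Omega> B' C ?B"
    using star unfolding indep_star_def by blast
  then obtain g where g: "automorphism M g" "\<And>c. c \<in> a ` X \<union> C \<Longrightarrow> g c = c" "g ` B = B'"
    unfolding conj_over_def by blast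
  let ?h = "inv g"
  have h: "automorphism M ?h" by (rule automorphism_inv[OF g(1)])
  have hg: "?h (g x) = x" for x using automorphism_bij[OF g(1)] by (simp add: bij_def)
  have hfix: "?h c = c" if "c \<in> a ` X \<union> C" for c using hg[of c] g(2)[OF that] by simp
  have hC: "?h ` C = C" using hfix by (intro image_fixed) simp
  have hB: "?h ` B' = B" unfolding g(3)[symmetric] image_image hg by simp
  define b' where "b' i v = ?h (b i v)" for i v
  have b': "earlier \<xi> b' i = ?h ` earlier \<xi> b i" for i
    unfolding b'_def by (rule earlier_automorphism)
  have "realised_pattern M (\<lambda>_. ?h ` C) n \<xi> (\<lambda>v. ?h (a v)) (\<lambda>i v. ?h (b i v))"
    by (rule realised_pattern_automorphism[OF p h assms(8) Xi assms(10,11)])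
  then have "realised_pattern M (\<lambda>_. C) n \<xi> (\<lambda>v. ?h (a v)) b'"
    unfolding hC b'_def .
  then have p': "realised_pattern M (\<lambda>_. C) n \<xi> a b'"
    by (rule realised_pattern_cong[OF _ assms(11)]) (use hfix in auto)
  have ind: "indep \<kappa> M \<Omega> B C (earlier \<xi> b' n)"
  proof (rule indep_mono)
    show "indep \<kappa> M \<Omega> B C (?h ` ?B)"
      using indep_automorphism[OF B' h assms(3,8)] unfolding hC hB .
    show "earlier \<xi> b' n \<subseteq> ?h ` ?B" unfolding b' by blast
  qed
  have "divides M (\<xi> i) (b' i) (B \<union> C \<union> earlier \<xi> b' i)" if i: "i < n" for i
  proof -
    \<comment> \<open>Position i is handled over \<open>C\<close> with the earlier parameters. In
      \<open>transitive\<close> the independent set is the larger of the two bases; hence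
      \<open>indep_normal\<close>, which puts \<open>B \<union> ?D\<close> on the left.\<close>
    let ?D = "C \<union> earlier \<xi> b' i"
    have smD: "small \<kappa> ?D" by (intro small_Un assms(8) small_earlier)
    have "earlier \<xi> b' i \<subseteq> earlier \<xi> b' n" using i by (intro earlier_mono) simp
    then have "indep \<kappa> M \<Omega> (B \<union> ?D) ?D (earlier \<xi> b' n)"
      by (intro indep_normal[OF ind assms(5,3) smD]) auto
    moreover have "b' i ` rvars (\<xi> i) \<subseteq> earlier \<xi> b' n" using i by (auto simp: earlier_def)
    ultimately have "indep \<kappa> M \<Omega> (B \<union> ?D) ?D (b' i ` rvars (\<xi> i))" by (rule indep_mono)
    moreover have "compat M (rvars (\<xi> i)) (b' i)" "divides M (\<xi> i) (b' i) ?D"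
      using p' i by (auto simp: realised_pattern_def)
    ultimately have "divides M (\<xi> i) (b' i) (B \<union> ?D)"
      using assms(4) \<xi>[OF i] small_Un[OF assms(7) smD] unfolding transitive_def by blast
    then show ?thesis by (simp add: Un_assoc)
  qed
  then have "realised_pattern M (\<lambda>_. B \<union> C) n \<xi> a b'"
    using p' unfolding realised_pattern_def by blast
  then show thesis by (rule that)
qed

text \<open>All parameters form a small set, so saturation turns consistency into a realisation
  \<open>a\<close>.\<close>

lemma dividing_pattern_iff:
  fixes \<xi> :: "nat \<Rightarrow> ('s, 'f, 'r, 'm, 'v) ipair"
  assumes "small \<kappa> X" "small \<kappa> C" "p \<subseteq> forms_over M X C" "\<Delta> \<subseteq> restrict_left (Xi M) X"
  shows "dividing_pattern M X \<Delta> p C {..<n} {(i, j). i \<le> j} \<xi> \<longleftrightarrow>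
    (\<forall>i<n. \<xi> i \<in> \<Delta>) \<and> (\<exists>a b. realises M X a p \<and> realised_pattern M (\<lambda>_. C) n \<xi> a b)"
proof -
  have ear: "(\<Union>j\<in>{j \<in> {..<n}. j \<noteq> i \<and> (j, i) \<in> {(i, j). i \<le> j}}. b j ` rvars (\<xi> j)) = earlier \<xi> b i"
    if "i < n" for b :: "nat \<Rightarrow> ('s, 'v) var \<Rightarrow> 'm" and i
    unfolding earlier_def using that by (intro SUP_cong) auto
  have cons: "consistent M X (p \<union> {inst (\<xi> i) (b i) |i. i \<in> {..<n}}) \<longleftrightarrow>
      (\<exists>a. realises M X a p \<and> (\<forall>i<n. sat M a [] (inst (\<xi> i) (b i))))"
    if \<xi>: "\<forall>i<n. \<xi> i \<in> \<Delta>" and cb: "\<forall>i<n. compat M (rvars (\<xi> i)) (b i)" for b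
  proof
    assume c: "consistent M X (p \<union> {inst (\<xi> i) (b i) |i. i \<in> {..<n}})"
    have "inst (\<xi> i) (b i) \<in> forms_over M X (C \<union> earlier \<xi> b n)" if i: "i < n" for i
    proof (rule inst_form)
      show "\<xi> i \<in> Xi M" "lblock (\<xi> i) \<subseteq> X"
        using \<xi> i assms(4) unfolding restrict_left_def by blast+
      show "compat M (rvars (\<xi> i)) (b i)" using cb i by blast
      show "b i ` rvars (\<xi> i) \<subseteq> C \<union> earlier \<xi> b n" using i by (auto simp: earlier_def)
    qed
    then have "p \<union> {inst (\<xi> i) (b i) |i. i \<in> {..<n}} \<subseteq> forms_over M X (C \<union> earlier \<xi> b n)"
      using assms(3) by (auto simp: forms_over_def)
    from realise_type[OF assms(1) small_Un[OF assms(2) small_earlier] this c]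
    obtain a where "realises M X a (p \<union> {inst (\<xi> i) (b i) |i. i \<in> {..<n}})" ..
    then show "\<exists>a. realises M X a p \<and> (\<forall>i<n. sat M a [] (inst (\<xi> i) (b i)))"
      unfolding realises_def by (intro exI[of _ a]) auto
  next
    assume "\<exists>a. realises M X a p \<and> (\<forall>i<n. sat M a [] (inst (\<xi> i) (b i)))"
    then obtain a where "realises M X a p" "\<forall>i<n. sat M a [] (inst (\<xi> i) (b i))" by blast
    then have "realises M X a (p \<union> {inst (\<xi> i) (b i) |i. i \<in> {..<n}})"
      unfolding realises_def by auto
    then show "consistent M X (p \<union> {inst (\<xi> i) (b i) |i. i \<in> {..<n}})"
      unfolding consistent_def realises_def by blast
  qed
  show ?thesis
  proof
    assume d: "dividing_pattern M X \<Delta> p C {..<n} {(i, j). i \<le> j} \<xi>"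
    then have \<xi>: "\<forall>i<n. \<xi> i \<in> \<Delta>" unfolding dividing_pattern_def by blast
    from d obtain b where b: "\<forall>i<n. compat M (rvars (\<xi> i)) (b i)"
      "consistent M X (p \<union> {inst (\<xi> i) (b i) |i. i \<in> {..<n}})"
      "\<forall>i<n. divides M (\<xi> i) (b i) (C \<union> earlier \<xi> b i)"
      unfolding dividing_pattern_def by (metis (no_types, lifting) ear lessThan_iff)
    with cons[OF \<xi> b(1)] \<xi> show "(\<forall>i<n. \<xi> i \<in> \<Delta>) \<and> (\<exists>a b. realises M X a p \<and> realised_pattern M (\<lambda>_. C) n \<xi> a b)"
      unfolding realised_pattern_def by blast
  next
    assume d: "(\<forall>i<n. \<xi> i \<in> \<Delta>) \<and> (\<exists>a b. realises M X a p \<and> realised_pattern M (\<lambda>_. C) n \<xi> a b)"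
    then obtain a b where ab: "realises M X a p" "realised_pattern M (\<lambda>_. C) n \<xi> a b" by blast
    then have b: "\<forall>i<n. compat M (rvars (\<xi> i)) (b i)" by (simp add: realised_pattern_def)
    have "consistent M X (p \<union> {inst (\<xi> i) (b i) |i. i \<in> {..<n}})"
      using cons[OF conjunct1[OF d] b] ab unfolding realised_pattern_def by blast
    moreover have "\<forall>i\<in>{..<n}. divides M (\<xi> i) (b i)
        (C \<union> (\<Union>j\<in>{j \<in> {..<n}. j \<noteq> i \<and> (j, i) \<in> {(i, j). i \<le> j}}. b j ` rvars (\<xi> j)))"
    proof
      fix i assume "i \<in> {..<n}"
      then have i: "i < n" by simp
      show "divides M (\<xi> i) (b i)
        (C \<union> (\<Union>j\<in>{j \<in> {..<n}. j \<noteq> i \<and> (j, i) \<in> {(i, j). i \<le> j}}. b j ` rvars (\<xi> j)))"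
        unfolding ear[OF i] using ab(2) i by (simp add: realised_pattern_def)
    qed
    ultimately show "dividing_pattern M X \<Delta> p C {..<n} {(i, j). i \<le> j} \<xi>"
      unfolding dividing_pattern_def using d b by blast
  qed
qed

text \<open>Any realisation of the type is conjugate to \<open>a\<close> over \<open>C\<close>, and
  the parameters can be moved back along with it.\<close>

lemma dividing_pattern_tp:
  fixes \<xi> :: "nat \<Rightarrow> ('s, 'f, 'r, 'm, 'v) ipair"
  assumes "small \<kappa> X" "small \<kappa> C" "compat M X a" "\<Delta> \<subseteq> restrict_left (Xi M) X"
  shows "dividing_pattern M X \<Delta> (tp M X a C) C {..<n} {(i, j). i \<le> j} \<xi> \<longleftrightarrow>
    (\<forall>i<n. \<xi> i \<in> \<Delta>) \<and> (\<exists>b. realised_pattern M (\<lambda>_. C) n \<xi> a b)"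
proof -
  have tp: "tp M X a C \<subseteq> forms_over M X C" by (auto simp: tp_def)
  have "\<exists>b. realised_pattern M (\<lambda>_. C) n \<xi> a b"
    if \<xi>: "\<forall>i<n. \<xi> i \<in> \<Delta>" and r: "realises M X a' (tp M X a C)"
      and p: "realised_pattern M (\<lambda>_. C) n \<xi> a' b" for a' b
  proof -
    have Xi: "\<xi> i \<in> Xi M" "lblock (\<xi> i) \<subseteq> X" if "i < n" for i
      using \<xi> that assms(4) by (auto simp: restrict_left_def)
    from r have "conj_tuple M C X a a'" using realises_tp_iff[OF assms(1-3)] by simp
    then obtain g where g: "automorphism M g" "\<And>c. c \<in> C \<Longrightarrow> g c = c" "\<And>v. v \<in> X \<Longrightarrow> g (a v) = a' v"
      unfolding conj_tuple_def by blast
    let ?h = "inv g"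
    have h: "automorphism M ?h" by (rule automorphism_inv[OF g(1)])
    have hg: "?h (g x) = x" for x using automorphism_bij[OF g(1)] by (simp add: bij_def)
    have "?h c = c" if "c \<in> C" for c using hg[of c] g(2)[OF that] by simp
    then have hC: "?h ` C = C" by (rule image_fixed)
    have "compat M X a'" using r by (simp add: realises_def)
    from realised_pattern_automorphism[OF p h assms(2) Xi(1) this Xi(2)]
    have p': "realised_pattern M (\<lambda>_. C) n \<xi> (\<lambda>v. ?h (a' v)) (\<lambda>i v. ?h (b i v))" unfolding hC .
    have ha: "?h (a' v) = a v" if "v \<in> X" for v using g(3)[OF that] hg[of "a v"] by simp
    have "realised_pattern M (\<lambda>_. C) n \<xi> a (\<lambda>i v. ?h (b i v))"
      by (rule realised_pattern_cong[OF p' Xi(2) ha])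
    then show ?thesis by blast
  qed
  moreover have "realises M X a (tp M X a C)" using assms(3) by (simp add: realises_def tp_def)
  ultimately show ?thesis
    unfolding dividing_pattern_iff[OF assms(1,2) tp assms(4)] by blast
qed

end

section \<open>Finiteness of the rank\<close>

lemma dividing_pattern_mono:
  assumes "dividing_pattern M X \<Delta> p C I r \<xi>" "p' \<subseteq> p" "C' \<subseteq> C"
  shows "dividing_pattern M X \<Delta> p' C' I r \<xi>"
proof -
  obtain b where b: "\<forall>i\<in>I. compat M (rvars (\<xi> i)) (b i)"
    "consistent M X (p \<union> {inst (\<xi> i) (b i) |i. i \<in> I})"
    "\<forall>i\<in>I. divides M (\<xi> i) (b i) (C \<union> (\<Union>j\<in>{j \<in> I. j \<noteq> i \<and> (j, i) \<in> r}. b j ` rvars (\<xi> j)))"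
    using assms(1) unfolding dividing_pattern_def by blast
  have "consistent M X (p' \<union> {inst (\<xi> i) (b i) |i. i \<in> I})"
    using b(2) assms(2) unfolding consistent_def by (meson Un_mono subset_refl subset_trans)
  moreover have "\<forall>i\<in>I. divides M (\<xi> i) (b i)
      (C' \<union> (\<Union>j\<in>{j \<in> I. j \<noteq> i \<and> (j, i) \<in> r}. b j ` rvars (\<xi> j)))"
    using b(3) divides_mono Un_mono[OF assms(3) subset_refl] by meson
  ultimately show ?thesis using assms(1) b(1) unfolding dividing_pattern_def by blast
qed

context monster
begin

text \<open>Compactness turns constant patterns of all finite lengths into constant patterns of any small
  order type. The variable \<open>\<rho> i 0 v\<close> stands for an entry of the parameter \<open>b\<^sup>i\<close> and the \<open>\<rho> i (Suc n) v\<close>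
  for the entries of the sequence witnessing that \<open>\<phi>(x;b\<^sup>i)\<close> divides.\<close>

lemma constant_pattern:
  fixes e :: "('s, 'f, 'r, 'm, 'v) ipair" and X :: "('s, 'v) var set" and I :: "'k set"
  assumes "small \<kappa> X" "e \<in> Xi M" "lblock e \<subseteq> X" "small \<kappa> I" "linear_order_on I r"
    and pat: "\<And>N. \<exists>a b. compat M X a \<and> realised_pattern M (\<lambda>_. {}) N (\<lambda>_. e) a b"
  shows "dividing_pattern M X {e} {} {} I r (\<lambda>_. e)"
proof -
  let ?Y = "rvars e"
  let ?S = "I \<times> ((UNIV :: nat set) \<times> ?Y)"
  have smY: "small \<kappa> ?Y" by (intro small_finite) simp
  have smS: "small \<kappa> ?S" by (intro small_Times small_nat smY assms(4))
  have "small \<kappa> (X \<union> ?Y \<union> wvars e)"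
    by (intro small_Un assms(1) smY small_finite[OF finite_wvars])
  then obtain \<rho>' :: "'k \<times> nat \<times> ('s, 'v) var \<Rightarrow> ('s, 'v) var" where \<rho>': "inj_on \<rho>' ?S"
    "\<And>x. fst (\<rho>' x) = fst (snd (snd x))" "\<And>x. x \<in> ?S \<Longrightarrow> \<rho>' x \<notin> X \<union> ?Y \<union> wvars e"
    using fresh_vars[OF smS, of _ "\<lambda>x. fst (snd (snd x))"] by blast
  define \<rho> where "\<rho> i n v = \<rho>' (i, n, v)" for i n v
  define V where "V = \<rho>' ` ?S"
  have \<rho>: "fst (\<rho> i n v) = fst v" for i n v using \<rho>'(2)[of "(i, n, v)"] by (simp add: \<rho>_def)
  have \<rho>V: "\<rho> i n v \<in> V" if "i \<in> I" "v \<in> ?Y" for i n v using that by (auto simp: \<rho>_def V_def)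
  have Vd: "V \<inter> (X \<union> ?Y \<union> wvars e) = {}" using \<rho>'(3) unfolding V_def by blast
  have smV: "small \<kappa> V" unfolding V_def by (intro small_image smS)
  define sub where "sub a i n w = (if w \<in> ?Y then a (\<rho> i n w) else a w)"
    for a :: "('s, 'v) var \<Rightarrow> 'm" and i n w
  define below where "below J i = {j \<in> J. j \<noteq> i \<and> (j, i) \<in> r}" for J i
  define U where "U J i = {\<rho> j 0 v |j v. j \<in> below J i \<and> v \<in> ?Y}" for J i
  \<comment> \<open>\<open>PA\<close> is the i-th formula of the pattern. \<open>PB\<close> gives a
    term of the i-th sequence the type of the i-th parameter over the earlier ones, and
    \<open>PC\<close> is the condition on \<open>psi e\<close>. The earlier parameters are unknowns
    themselves, so they enter as the variables in \<open>U\<close>, in formulas free of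
    parameters.\<close>
  define PA where "PA i a \<longleftrightarrow> sat M (sub a i 0) [] (phi e)" for i a
  define PB where "PB i n \<chi> a \<longleftrightarrow> (sat M (sub a i (Suc n)) [] \<chi> \<longleftrightarrow> sat M (sub a i 0) [] \<chi>)"
    for i n and \<chi> :: "('s, 'f, 'r, 'm, 'v) form" and a
  define PC where "PC i js a \<longleftrightarrow> psi_holds M e (map (\<lambda>n v. a (\<rho> i (Suc n) v)) js)"
    for i js and a :: "('s, 'v) var \<Rightarrow> 'm"
  \<comment> \<open>Restricting to \<open>J\<close> also restricts the earlier parameters that may
    be mentioned; a finite part of \<open>F I\<close> will be shown to lie in \<open>F J\<close> for
    a finite \<open>J\<close>.\<close>
  define F where "F J = {PA i |i. i \<in> J} \<union> {PB i n \<chi> |i n \<chi>. i \<in> J \<and> \<chi> \<in> forms_over M (?Y \<union> U J i) {}}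
    \<union> {PC i js |i js. i \<in> J \<and> sorted_wrt (<) js \<and> length js = length (wblocks e)}" for J
  have UV: "U J i \<subseteq> V" if "J \<subseteq> I" for J i using that \<rho>V unfolding U_def below_def by blast
  have Umono: "U J i \<subseteq> U J' i" if "J \<subseteq> J'" for J J' i using that unfolding U_def below_def by blast
  have sub_def': "definable M (X \<union> V) {} (\<lambda>a. sat M (sub a i n) [] \<chi>)"
    if "i \<in> I" "\<chi> \<in> forms_over M (?Y \<union> Z) {}" "Z \<subseteq> X \<union> V" for i n \<chi> Z
  proof -
    let ?\<sigma> = "\<lambda>w. if w \<in> ?Y then \<rho> i n w else w"
    have "?\<sigma> ` (?Y \<union> Z) \<subseteq> X \<union> V" using \<rho>V[OF that(1)] that(3) by auto
    from definable_rename[OF definable_sat[OF that(2)] _ this] \<rho>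
    have "definable M (X \<union> V) {} (\<lambda>a. sat M (\<lambda>w. a (?\<sigma> w)) [] \<chi>)" by simp
    moreover have "(\<lambda>w. a (?\<sigma> w)) = sub a i n" for a by (auto simp: sub_def)
    ultimately show ?thesis by simp
  qed
  have comp_sub: "compat M (?Y \<union> Z) (sub a i n)" if "compat M (X \<union> V) a" "i \<in> I" "Z \<subseteq> X \<union> V" for a i n Z
    unfolding compat_def
  proof
    fix w assume "w \<in> ?Y \<union> Z"
    then show "sort_of M (sub a i n w) = fst w"
      using that \<rho>V[OF that(2), of w n] \<rho>[of i n w] unfolding compat_def sub_def by auto
  qed
  have "\<exists>a. compat M (X \<union> V) a \<and> (\<forall>P\<in>F I. P a)"
  proof (rule compactness)
    show "small \<kappa> (X \<union> V)" by (intro small_Un assms(1) smV)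
    show "small \<kappa> {}" by (simp add: small_finite)
  next
    fix P assume "P \<in> F I"
    then consider i where "i \<in> I" "P = PA i"
      | i n \<chi> where "i \<in> I" "\<chi> \<in> forms_over M (?Y \<union> U I i) {}" "P = PB i n \<chi>"
      | i js where "i \<in> I" "length js = length (wblocks e)" "P = PC i js"
      unfolding F_def by blast
    then show "definable M (X \<union> V) {} P"
    proof cases
      case 1
      have "phi e \<in> forms_over M (?Y \<union> lblock e) {}" using XiD(1)[OF assms(2)] by (simp add: Un_commute)
      from sub_def'[OF 1(1) this] assms(3) show ?thesis unfolding 1(2) PA_def by blast
    next
      case 2
      have "U I i \<subseteq> X \<union> V" using UV by blast
      from sub_def'[OF 2(1,2) this] show ?thesis unfolding 2(3) PB_def by (intro definable_iff)
    next
      case 3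
      have "definable M V {} (P)" unfolding 3(3) PC_def
      proof (rule definable_psi_holds[OF is_structure_M assms(2) 3(2)])
        show "V \<inter> wvars e = {}" using Vd by blast
      qed (use \<rho> \<rho>V[OF 3(1)] in blast)+
      then show ?thesis by (rule definable_mono) auto
    qed
  next
    fix F0 assume F0: "finite F0" "F0 \<subseteq> F I"
    have Fmono: "F J \<subseteq> F J'" if "J \<subseteq> J'" for J J'
    proof -
      have "forms_over M (?Y \<union> U J i) {} \<subseteq> forms_over M (?Y \<union> U J' i) {}" for i
        using Umono[OF that, of i] by (auto simp: forms_over_def)
      then show ?thesis using that unfolding F_def by blast
    qed
    have "\<exists>J. finite J \<and> J \<subseteq> I \<and> F0 \<subseteq> F J"
      using F0
    proof (induction F0 rule: finite_induct)
      case (insert P F0)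
      then obtain J where J: "finite J" "J \<subseteq> I" "F0 \<subseteq> F J" by blast
      have "\<exists>J'. finite J' \<and> J' \<subseteq> I \<and> P \<in> F J'"
      proof -
        have "P \<in> F I" using insert.prems by blast
        then consider i where "i \<in> I" "P = PA i"
          | i n \<chi> where "i \<in> I" "\<chi> \<in> forms_over M (?Y \<union> U I i) {}" "P = PB i n \<chi>"
          | i js where "i \<in> I" "sorted_wrt (<) js" "length js = length (wblocks e)" "P = PC i js"
          unfolding F_def by blast
        then show ?thesis
        proof cases
          case 1
          then have "P \<in> F {i}" unfolding F_def by blast
          with 1(1) show ?thesis by (intro exI[of _ "{i}"]) simp
        next
          case 3
          then have "P \<in> F {i}" unfolding F_def by blast
          with 3(1) show ?thesis by (intro exI[of _ "{i}"]) simp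
        next
          case 2
          \<comment> \<open>Besides i, the set needs the indices whose parameters occur in
            \<open>\<chi>\<close>, and these are finitely many.\<close>
          let ?J = "insert i {j \<in> I. \<exists>v\<in>?Y. \<rho> j 0 v \<in> fm_vars \<chi>}"
          have "j \<in> (\<lambda>w. fst (inv_into ?S \<rho>' w)) ` fm_vars \<chi>"
            if "j \<in> I" "v \<in> ?Y" "\<rho> j 0 v \<in> fm_vars \<chi>" for j v
          proof -
            have "inv_into ?S \<rho>' (\<rho> j 0 v) = (j, 0, v)"
              unfolding \<rho>_def using \<rho>'(1) that by (intro inv_into_f_f) auto
            then show ?thesis using that(3) by (metis fst_conv image_eqI)
          qed
          then have "{j \<in> I. \<exists>v\<in>?Y. \<rho> j 0 v \<in> fm_vars \<chi>} \<subseteq> (\<lambda>w. fst (inv_into ?S \<rho>' w)) ` fm_vars \<chi>"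
            by blast
          then have "finite ?J"
            unfolding finite_insert by (rule finite_subset[OF _ finite_imageI[OF finite_fm_vars]])
          moreover have "?J \<subseteq> I" using 2(1) by blast
          moreover have "fm_vars \<chi> \<subseteq> ?Y \<union> U ?J i"
          proof
            fix w assume w: "w \<in> fm_vars \<chi>"
            then have "w \<in> ?Y \<union> U I i" using 2(2) by (auto simp: forms_over_def)
            with w show "w \<in> ?Y \<union> U ?J i" unfolding U_def below_def by blast
          qed
          then have "\<chi> \<in> forms_over M (?Y \<union> U ?J i) {}" using 2(2) by (simp add: forms_over_def)
          then have "P \<in> F ?J" using 2(3) unfolding F_def by blast
          ultimately show ?thesis by blast
        qed
      qed
      then obtain J' where J': "finite J'" "J' \<subseteq> I" "P \<in> F J'" by blast
      have "insert P F0 \<subseteq> F (J \<union> J')" using J(3) J'(3) Fmono[of J "J \<union> J'"] Fmono[of J' "J \<union> J'"] by blast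
      with J J' show ?case by (intro exI[of _ "J \<union> J'"]) simp
    qed auto
    then obtain J where J: "finite J" "J \<subseteq> I" "F0 \<subseteq> F J" by blast
    \<comment> \<open>\<open>pos\<close> is the rank of an index in the finite order
      \<open>J\<close>; it selects a position in a finite pattern of length
      \<open>card J\<close>.\<close>
    define pos where "pos i = card (below J i)" for i
    have finb: "finite (below J i)" for i using J(1) by (simp add: below_def)
    have posN: "pos i < card J" if "i \<in> J" for i
      unfolding pos_def using that J(1) by (intro psubset_card_mono) (auto simp: below_def)
    have pos: "pos j < pos i" if "j \<in> below J i" "i \<in> J" for i j
      unfolding pos_def
    proof (rule psubset_card_mono[OF finb])
      have tr: "trans r" and an: "antisym r"
        using assms(5) by (auto simp: linear_order_on_def partial_order_on_def preorder_on_def)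
      have "below J j \<subseteq> below J i"
        using that tr an unfolding below_def by (auto dest: transD antisymD)
      then show "below J j \<subset> below J i" using that(1) by (auto simp: below_def)
    qed
    obtain a0 b where a0: "compat M X a0" and p: "realised_pattern M (\<lambda>_. {}) (card J) (\<lambda>_. e) a0 b"
      using pat by blast
    have cb: "compat M ?Y (b k)" "sat M a0 [] (inst e (b k))" "divides M e (b k) (earlier (\<lambda>_. e) b k)"
      if "k < card J" for k
      using p that by (auto simp: realised_pattern_def)
    have "\<exists>\<beta> :: nat \<Rightarrow> ('s, 'v) var \<Rightarrow> 'm. (\<forall>n. conj_tuple M (earlier (\<lambda>_. e) b k) ?Y (b k) (\<beta> n)) \<and>
      (\<forall>js. sorted_wrt (<) js \<longrightarrow> length js = length (wblocks e) \<longrightarrow> psi_holds M e (map \<beta> js))"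
      if "k < card J" for k
      using cb(3)[OF that] unfolding divides_iff[OF small_earlier cb(1)[OF that]] .
    then obtain \<beta> :: "nat \<Rightarrow> nat \<Rightarrow> ('s, 'v) var \<Rightarrow> 'm" where
      \<beta>: "\<And>k n. k < card J \<Longrightarrow> conj_tuple M (earlier (\<lambda>_. e) b k) ?Y (b k) (\<beta> k n)"
      "\<And>k js. k < card J \<Longrightarrow> sorted_wrt (<) js \<Longrightarrow> length js = length (wblocks e) \<Longrightarrow>
        psi_holds M e (map (\<beta> k) js)" by metis
    obtain d where d: "\<And>s. sort_of M (d s) = s" using compat_choice by blast
    \<comment> \<open>Slot 0 holds the parameter itself and slot \<open>Suc n\<close> term n of its
      dividing sequence. In \<open>a\<close> the indices outside \<open>J\<close> get default
      elements of the right sort.\<close>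
    define val where "val i n = (case n of 0 \<Rightarrow> b (pos i) | Suc n \<Rightarrow> \<beta> (pos i) n)" for i n
    define a where "a w = (if w \<in> V then
        (case inv_into ?S \<rho>' w of (i, n, v) \<Rightarrow> if i \<in> J then val i n v else d (fst w))
        else if w \<in> X then a0 w else d (fst w))" for w
    have a\<rho>: "a (\<rho> i n v) = (if i \<in> J then val i n v else d (fst v))" if "i \<in> I" "v \<in> ?Y" for i n v
    proof -
      have "inv_into ?S \<rho>' (\<rho> i n v) = (i, n, v)"
        unfolding \<rho>_def using \<rho>'(1) that by (intro inv_into_f_f) auto
      then show ?thesis using \<rho>V[OF that, of n] \<rho>[of i n v] by (simp add: a_def)
    qed
    have aX: "a w = a0 w" if "w \<in> X" for w using that Vd by (auto simp: a_def)
    have cval: "compat M ?Y (val i n)" if "i \<in> J" for i n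
      using cb(1)[OF posN[OF that]] conj_tuple_compat[OF \<beta>(1)[OF posN[OF that]] cb(1)[OF posN[OF that]]]
      by (cases n) (auto simp: val_def)
    have ca: "compat M (X \<union> V) a" unfolding compat_def
    proof
      fix w assume "w \<in> X \<union> V"
      then consider "w \<in> X" | i n v where "i \<in> I" "v \<in> ?Y" "w = \<rho> i n v"
        unfolding V_def \<rho>_def by auto
      then show "sort_of M (a w) = fst w"
      proof cases
        case 1
        then show ?thesis using aX a0 by (simp add: compat_def)
      next
        case 2
        show ?thesis using cval[of i n] d a\<rho>[OF 2(1,2)] \<rho>[of i n v] 2(2) unfolding 2(3)
          by (simp add: compat_def)
      qed
    qed
    have "P a" if "P \<in> F J" for P
    proof -
      from that consider i where "i \<in> J" "P = PA i"
        | i n \<chi> where "i \<in> J" "\<chi> \<in> forms_over M (?Y \<union> U J i) {}" "P = PB i n \<chi>"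
        | i js where "i \<in> J" "sorted_wrt (<) js" "length js = length (wblocks e)" "P = PC i js"
        unfolding F_def by blast
      then show ?thesis
      proof cases
        case 1
        have iI: "i \<in> I" using 1(1) J(2) by blast
        have "sat M (sub a i 0) [] (phi e) \<longleftrightarrow>
            sat M (\<lambda>v. if v \<in> ?Y then b (pos i) v else a0 v) [] (phi e)"
        proof (rule sat_cong)
          fix v assume "v \<in> fm_vars (phi e)"
          then have "v \<in> ?Y \<or> v \<in> X" using assms(3) unfolding lblock_def by blast
          then show "sub a i 0 v = (if v \<in> ?Y then b (pos i) v else a0 v)"
            using a\<rho>[OF iI, of v 0] aX[of v] 1(1) by (auto simp: sub_def val_def)
        qed
        with cb(2)[OF posN[OF 1(1)]] show ?thesis unfolding 1(2) PA_def sat_inst by simp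
      next
        case 2
        have iI: "i \<in> I" using 2(1) J(2) by blast
        obtain g where g: "automorphism M g" "\<And>c. c \<in> earlier (\<lambda>_. e) b (pos i) \<Longrightarrow> g c = c"
          "\<And>v. v \<in> ?Y \<Longrightarrow> g (b (pos i) v) = \<beta> (pos i) n v"
          using \<beta>(1)[OF posN[OF 2(1)], of n] unfolding conj_tuple_def by blast
        have "g (sub a i 0 w) = sub a i (Suc n) w" if "w \<in> ?Y \<union> U J i" for w
        proof (cases "w \<in> ?Y")
          case True
          then show ?thesis using a\<rho>[OF iI True] 2(1) g(3)[OF True] by (simp add: sub_def val_def)
        next
          case False
          then obtain j v where j: "j \<in> below J i" "v \<in> ?Y" "w = \<rho> j 0 v"
            using \<open>w \<in> ?Y \<union> U J i\<close> unfolding U_def by blast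
          have jJ: "j \<in> J" "j \<in> I" using j(1) J(2) by (auto simp: below_def)
          have "a w = b (pos j) v" unfolding j(3) using a\<rho>[OF jJ(2) j(2)] jJ(1) by (simp add: val_def)
          moreover have "b (pos j) v \<in> earlier (\<lambda>_. e) b (pos i)"
            using pos[OF j(1) 2(1)] j(2) unfolding earlier_def by blast
          ultimately show ?thesis using False g(2) by (simp add: sub_def)
        qed
        then have "conj_tuple M {} (?Y \<union> U J i) (sub a i 0) (sub a i (Suc n))"
          using g(1) unfolding conj_tuple_def by blast
        moreover have "U J i \<subseteq> X \<union> V" using UV[OF J(2)] by blast
        ultimately show ?thesis unfolding 2(3) PB_def
          using conj_tuple_sat[OF _ comp_sub[OF ca iI] 2(2)] by blast
      next
        case 3
        have iI: "i \<in> I" using 3(1) J(2) by blast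
        have "psi_holds M e (map (\<lambda>n v. a (\<rho> i (Suc n) v)) js)"
          using \<beta>(2)[OF posN[OF 3(1)] 3(2,3)]
        proof (rule psi_holds_cong)
          show "list_all2 (\<lambda>b b'. \<forall>v\<in>?Y. b v = b' v) (map (\<beta> (pos i)) js)
              (map (\<lambda>n v. a (\<rho> i (Suc n) v)) js)"
            using a\<rho>[OF iI] 3(1) by (simp add: list.rel_map list_all2_same val_def)
        qed
        then show ?thesis unfolding 3(4) PC_def .
      qed
    qed
    then have "\<forall>P\<in>F0. P a" using J(3) by blast
    with ca show "\<exists>a. compat M (X \<union> V) a \<and> (\<forall>P\<in>F0. P a)" by (intro exI[of _ a]) (rule conjI)
  qed
  then obtain a where a: "compat M (X \<union> V) a" "\<And>P. P \<in> F I \<Longrightarrow> P a" by blast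
  define \<gamma> where "\<gamma> i n = (\<lambda>v. a (\<rho> i n v))" for i n
  have c\<gamma>: "compat M ?Y (\<gamma> i n)" if "i \<in> I" for i n
    using a(1) \<rho>V[OF that] \<rho> unfolding compat_def \<gamma>_def by simp
  have "divides M e (\<gamma> i 0) ({} \<union> (\<Union>j\<in>{j \<in> I. j \<noteq> i \<and> (j, i) \<in> r}. \<gamma> j 0 ` ?Y))" if i: "i \<in> I" for i
  proof -
    let ?C = "\<Union>j\<in>below I i. \<gamma> j 0 ` ?Y"
    have "?C \<subseteq> a ` V" using \<rho>V unfolding below_def \<gamma>_def by blast
    then have smC: "small \<kappa> ?C" using small_image[OF smV] small_mono by blast
    have "conj_tuple M ?C ?Y (\<gamma> i 0) (\<gamma> i (Suc n))" for n
    proof -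
      have UX: "U I i \<subseteq> X \<union> V" using UV by blast
      \<comment> \<open>The two assignments agree on \<open>U I i\<close>, so a conjugation between
        them over the empty set fixes the earlier parameters.\<close>
      have "conj_tuple M {} (?Y \<union> U I i) (sub a i 0) (sub a i (Suc n))"
      proof (rule conj_tupleI[OF _ _ comp_sub[OF a(1) i UX] comp_sub[OF a(1) i UX]])
        show "small \<kappa> (?Y \<union> U I i)" using UV by (intro small_Un smY small_mono[OF smV]) blast
        show "small \<kappa> {}" by (simp add: small_finite)
        fix \<phi> assume \<phi>: "\<phi> \<in> forms_over M (?Y \<union> U I i) {}" "sat M (sub a i 0) [] \<phi>"
        then have "PB i n \<phi> \<in> F I" using i unfolding F_def by blast
        from a(2)[OF this] \<phi>(2) show "sat M (sub a i (Suc n)) [] \<phi>" by (simp add: PB_def)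
      qed
      then obtain g where g: "automorphism M g" "\<And>w. w \<in> ?Y \<union> U I i \<Longrightarrow> g (sub a i 0 w) = sub a i (Suc n) w"
        unfolding conj_tuple_def by blast
      have "g c = c" if "c \<in> ?C" for c
      proof -
        obtain j v where j: "j \<in> below I i" "v \<in> ?Y" "c = a (\<rho> j 0 v)"
          using \<open>c \<in> ?C\<close> unfolding \<gamma>_def by blast
        then have w: "\<rho> j 0 v \<in> U I i" unfolding U_def by blast
        then have "\<rho> j 0 v \<notin> ?Y" using UV[of I i] Vd by blast
        with g(2)[of "\<rho> j 0 v"] w j(3) show ?thesis by (simp add: sub_def)
      qed
      moreover have "g (\<gamma> i 0 v) = \<gamma> i (Suc n) v" if "v \<in> ?Y" for v
        using g(2)[of v] that by (simp add: sub_def \<gamma>_def)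
      ultimately show ?thesis using g(1) unfolding conj_tuple_def by blast
    qed
    moreover have "psi_holds M e (map (\<lambda>n. \<gamma> i (Suc n)) js)"
      if "sorted_wrt (<) js" "length js = length (wblocks e)" for js
    proof -
      have "PC i js \<in> F I" using that i unfolding F_def by blast
      from a(2)[OF this] show ?thesis unfolding PC_def \<gamma>_def .
    qed
    ultimately have "divides M e (\<gamma> i 0) ?C"
      unfolding divides_iff[OF smC c\<gamma>[OF i]] by (intro exI[of _ "\<lambda>n. \<gamma> i (Suc n)"]) blast
    then show ?thesis by (simp add: below_def)
  qed
  moreover have "consistent M X ({} \<union> {inst e (\<gamma> i 0) |i. i \<in> I})"
  proof -
    have "sat M a [] (inst e (\<gamma> i 0))" if "i \<in> I" for i
    proof -
      have "PA i \<in> F I" using that unfolding F_def by blast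
      from a(2)[OF this] have "sat M (sub a i 0) [] (phi e)" by (simp add: PA_def)
      moreover have "sub a i 0 = (\<lambda>v. if v \<in> ?Y then \<gamma> i 0 v else a v)" by (auto simp: sub_def \<gamma>_def)
      ultimately show ?thesis unfolding sat_inst by simp
    qed
    moreover have "compat M X a" using a(1) by (rule compat_mono) simp
    ultimately show ?thesis unfolding consistent_def realises_def by (intro allI impI exI[of _ a]) auto
  qed
  ultimately show ?thesis unfolding dividing_pattern_def using c\<gamma> by (intro conjI exI[of _ "\<lambda>i. \<gamma> i 0"]) auto
qed

text \<open>Deleting the other positions only shrinks the sets of earlier parameters, and dividing
  passes to smaller bases.\<close>

lemma constant_subpattern:
  fixes \<xi> :: "nat \<Rightarrow> ('s, 'f, 'r, 'm, 'v) ipair"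
  assumes "realised_pattern M (\<lambda>_. {}) n \<xi> a b" "N \<le> card {i. i < n \<and> \<xi> i = e}"
  shows "\<exists>b'. realised_pattern M (\<lambda>_. {}) N (\<lambda>_. e) a b'"
proof -
  let ?K = "{i. i < n \<and> \<xi> i = e}"
  define f where "f k = sorted_list_of_set ?K ! k" for k
  have fK: "f k < n \<and> \<xi> (f k) = e" if "k < N" for k
  proof -
    have "f k \<in> set (sorted_list_of_set ?K)" unfolding f_def using that assms(2) by (intro nth_mem) simp
    then show ?thesis by simp
  qed
  have f_mono: "f j < f k" if "j < k" "k < N" for j k
    using sorted_wrt_nth_less[OF strict_sorted_list_of_set[of ?K] that(1)] that(2) assms(2)
    by (simp add: f_def)
  have "realised_pattern M (\<lambda>_. {}) N (\<lambda>_. e) a (\<lambda>k. b (f k))"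
    unfolding realised_pattern_def
  proof (intro allI impI)
    fix k assume k: "k < N"
    have p: "compat M (rvars e) (b (f k))" "sat M a [] (inst e (b (f k)))"
      "divides M e (b (f k)) ({} \<union> earlier \<xi> b (f k))"
      using assms(1) fK[OF k] unfolding realised_pattern_def by auto
    have "earlier (\<lambda>_. e) (\<lambda>k. b (f k)) k \<subseteq> earlier \<xi> b (f k)"
    proof
      fix m assume "m \<in> earlier (\<lambda>_. e) (\<lambda>k. b (f k)) k"
      then obtain j where j: "j < k" "m \<in> b (f j) ` rvars e" unfolding earlier_def by blast
      then have "f j < f k" "\<xi> (f j) = e" using f_mono k fK by auto
      with j(2) show "m \<in> earlier \<xi> b (f k)" unfolding earlier_def by blast
    qed
    then have "divides M e (b (f k)) ({} \<union> earlier (\<lambda>_. e) (\<lambda>k. b (f k)) k)"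
      by (intro divides_mono[OF p(3)]) simp
    with p(1,2) show "compat M (rvars e) (b (f k)) \<and> sat M a [] (inst e (b (f k))) \<and>
        divides M e (b (f k)) ({} \<union> earlier (\<lambda>_. e) (\<lambda>k. b (f k)) k)" by blast
  qed
  then show ?thesis by blast
qed

text \<open>A pattern for any \<open>p\<close> is one for the empty type, hence a bound independent
  of \<open>p\<close> and \<open>C\<close>. For each pair the constant patterns have bounded length,
  since otherwise \<open>constant_pattern\<close> would supply all the order types that make the
  rank infinite.\<close>

lemma pattern_length_bounded:
  fixes \<Delta> :: "('s, 'f, 'r, 'm, 'v) ipair set"
  assumes "small \<kappa> X" "finite \<Delta>" "\<Delta> \<subseteq> restrict_left (Xi M) X" "D_rank \<kappa> M X \<Delta> {} {} < \<infinity>"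
  obtains N :: nat where "\<And>p C n \<xi>. dividing_pattern M X \<Delta> p C {..<n} {(i, j). i \<le> j} \<xi> \<Longrightarrow> n \<le> N"
proof -
  have iff: "dividing_pattern M X \<Delta> {} {} {..<n} {(i, j). i \<le> j} \<xi> \<longleftrightarrow>
    (\<forall>i<n. \<xi> i \<in> \<Delta>) \<and> (\<exists>a b. compat M X a \<and> realised_pattern M (\<lambda>_. {}) n \<xi> a b)" for n \<xi>
    using dividing_pattern_iff[OF assms(1) small_finite[OF finite.emptyI] empty_subsetI assms(3)]
    by (simp add: realises_def)
  have "\<exists>N. \<not> (\<exists>a b. compat M X a \<and> realised_pattern M (\<lambda>_. {}) N (\<lambda>_. e) a b)" if e: "e \<in> \<Delta>" for e
  proof (rule ccontr)
    assume "\<not> ?thesis"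
    then have pat: "\<exists>a b. compat M X a \<and> realised_pattern M (\<lambda>_. {}) N (\<lambda>_. e) a b" for N by blast
    have "\<exists>\<xi>. dividing_pattern M X \<Delta> {} {} I r \<xi>"
      if I: "small \<kappa> I" "linear_order_on I r" for I :: "'k set" and r
    proof -
      have "dividing_pattern M X {e} {} {} I r (\<lambda>_. e)"
        using constant_pattern[OF assms(1) _ _ I pat] e assms(3) by (auto simp: restrict_left_def)
      then have "dividing_pattern M X \<Delta> {} {} I r (\<lambda>_. e)"
        using e unfolding dividing_pattern_def by blast
      then show ?thesis by (intro exI[of _ "\<lambda>_. e"])
    qed
    then have "D_rank \<kappa> M X \<Delta> {} {} = \<infinity>" unfolding D_rank_def by simp
    with assms(4) show False by simp
  qed
  then obtain N where N: "\<And>e. e \<in> \<Delta> \<Longrightarrow>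
      \<not> (\<exists>a b. compat M X a \<and> realised_pattern M (\<lambda>_. {}) (N e) (\<lambda>_. e) a b)"
    by metis
  show thesis
  \<comment> \<open>Each pair e occurs at most \<open>N e\<close> times, as its occurrences form a
    constant pattern; the sum bounds the length.\<close>
  proof (rule that[of "\<Sum>e\<in>\<Delta>. N e"])
    fix p C and n :: nat and \<xi> assume "dividing_pattern M X \<Delta> p C {..<n} {(i, j). i \<le> j} \<xi>"
    then have "dividing_pattern M X \<Delta> {} {} {..<n} {(i, j). i \<le> j} \<xi>"
      by (rule dividing_pattern_mono) auto
    then obtain a b where \<xi>: "\<forall>i<n. \<xi> i \<in> \<Delta>" and a: "compat M X a"
      and p: "realised_pattern M (\<lambda>_. {}) n \<xi> a b" unfolding iff by blast
    have "card {i. i < n \<and> \<xi> i = e} \<le> N e" if "e \<in> \<Delta>" for e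
    proof (rule ccontr)
      assume "\<not> ?thesis"
      with constant_subpattern[OF p, of "N e" e] N[OF that] a show False by auto
    qed
    then have "(\<Sum>e\<in>\<Delta>. card {i. i < n \<and> \<xi> i = e}) \<le> (\<Sum>e\<in>\<Delta>. N e)" by (rule sum_mono)
    moreover have "(\<Sum>e\<in>\<Delta>. card {i. i < n \<and> \<xi> i = e}) = card (\<Union>e\<in>\<Delta>. {i. i < n \<and> \<xi> i = e})"
      using assms(2) by (intro card_UN_disjoint[symmetric]) auto
    moreover have "(\<Union>e\<in>\<Delta>. {i. i < n \<and> \<xi> i = e}) = {..<n}" using \<xi> by auto
    ultimately show "n \<le> (\<Sum>e\<in>\<Delta>. N e)" by simp
  qed
qed

text \<open>Bounded lengths make the \<open>GREATEST\<close> in \<open>D_rank\<close> an attained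
  maximum; the empty pattern ensures that some length occurs at all.\<close>

lemma D_tp_value:
  fixes \<Delta> :: "('s, 'f, 'r, 'm, 'v) ipair set"
  assumes "small \<kappa> X" "finite \<Delta>" "\<Delta> \<subseteq> restrict_left (Xi M) X" "D_rank \<kappa> M X \<Delta> {} {} < \<infinity>"
    and "small \<kappa> C" "compat M X a"
  obtains n where "D_tp \<kappa> M X \<Delta> a C = enat n"
    and "\<exists>\<xi>. dividing_pattern M X \<Delta> (tp M X a C) C {..<n} {(i, j). i \<le> j} \<xi>"
    and "\<And>m \<xi>. dividing_pattern M X \<Delta> (tp M X a C) C {..<m} {(i, j). i \<le> j} \<xi> \<Longrightarrow> m \<le> n"
proof -
  let ?P = "\<lambda>n :: nat. \<exists>\<xi>. dividing_pattern M X \<Delta> (tp M X a C) C {..<n} {(i, j). i \<le> j} \<xi>"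
  obtain N :: nat where N: "\<And>p C n \<xi>. dividing_pattern M X \<Delta> p C {..<n} {(i, j). i \<le> j} \<xi> \<Longrightarrow> n \<le> N"
    using pattern_length_bounded[OF assms(1-4)] by blast
  have "\<not> (\<forall>(I :: 'k set) r. small \<kappa> I \<longrightarrow> linear_order_on I r \<longrightarrow>
      (\<exists>\<xi>. dividing_pattern M X \<Delta> {} {} I r \<xi>))"
    using assms(4) unfolding D_rank_def by (auto split: if_splits)
  then have "\<not> (\<forall>(I :: 'k set) r. small \<kappa> I \<longrightarrow> linear_order_on I r \<longrightarrow>
      (\<exists>\<xi>. dividing_pattern M X \<Delta> (tp M X a C) C I r \<xi>))"
    using dividing_pattern_mono by (metis empty_subsetI)
  then have "D_tp \<kappa> M X \<Delta> a C = enat (GREATEST n. ?P n)" unfolding D_tp_def D_rank_def by simp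
  moreover have P0: "?P 0"
    using dividing_pattern_tp[OF assms(1,5,6,3), of 0] by (simp add: realised_pattern_def)
  then have "?P (GREATEST n. ?P n)" by (rule GreatestI_nat[of ?P 0 N]) (use N in blast)
  moreover have "m \<le> (GREATEST n. ?P n)" if "?P m" for m
    using that by (rule Greatest_le_nat[of ?P m N]) (use N in blast)
  ultimately show thesis using that by blast
qed

text \<open>A formula in variables outside \<open>X\<close> is renamed to one in the variables \<open>X\<close>, by choosing for each
  entry of the tuple \<open>c\<close> a variable at which \<open>a\<close> takes this value.\<close>

lemma rename_to_left:
  fixes \<Omega> :: "('s, 'f, 'r, 'm, 'v) ipair set"
  assumes "subst_closed \<Omega>" "\<Omega> \<subseteq> Xi M" "e \<in> \<Omega>" "small \<kappa> X" "compat M X a"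
    and "compat M (lblock e) c" "c ` lblock e \<subseteq> a ` X" "compat M (rvars e) b" "sat M c [] (inst e b)"
    and "small \<kappa> C" "divides M e b C"
  obtains e' b' where "e' \<in> restrict_left \<Omega> X" "compat M (rvars e') b'" "b' ` rvars e' = b ` rvars e"
    "sat M a [] (inst e' b')" "divides M e' b' C"
proof -
  have Xi: "e \<in> Xi M" using assms(2,3) by blast
  have "\<exists>x\<in>X. a x = c v" if "v \<in> lblock e" for v using that assms(7) by (metis image_eqI imageE subsetD)
  \<comment> \<open>\<open>h\<close> may identify variables at which \<open>c\<close> has equal
    values; closure under variable substitution allows repetitions inside a tuple.\<close>
  then obtain h where h: "\<And>v. v \<in> lblock e \<Longrightarrow> h v \<in> X \<and> a (h v) = c v" by metis
  have hsort: "fst (h v) = fst v" if "v \<in> lblock e" for v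
    using h[OF that] assms(5,6) that unfolding compat_def by metis
  let ?S = "rvars e \<union> wvars e"
  \<comment> \<open>Right-hand and witness variables go to fresh ones outside \<open>X\<close>, as
    \<open>restrict_left\<close> demands for the former. Here the renaming is injective, so
    assignments can be carried along by \<open>pull\<close>.\<close>
  obtain \<rho>1 :: "('s, 'v) var \<Rightarrow> ('s, 'v) var" where \<rho>1: "inj_on \<rho>1 ?S" "\<And>v. fst (\<rho>1 v) = fst v"
    "\<And>v. v \<in> ?S \<Longrightarrow> \<rho>1 v \<notin> X"
    using fresh_vars[OF small_finite assms(4), of ?S fst] finite_wvars by blast
  define \<rho> where "\<rho> v = (if v \<in> lblock e then h v else \<rho>1 v)" for v
  have blocks: "disjnt (lblock e) (rvars e)" "sorted_wrt disjnt (map set (wblocks e))"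
    "\<And>ys. ys \<in> set (wblocks e) \<Longrightarrow> disjnt (lblock e) (set ys) \<and> disjnt (rvars e) (set ys)"
    using XiD(5)[OF Xi] by (auto simp: disjoint_blocks_def)
  have lS: "lblock e \<inter> ?S = {}" using blocks unfolding wvars_def disjnt_def by blast
  then have \<rho>S: "\<rho> v = \<rho>1 v" if "v \<in> ?S" for v using that by (auto simp: \<rho>_def)
  have inj: "inj_on \<rho> ?S" using \<rho>1(1) inj_on_cong[of ?S \<rho> \<rho>1] \<rho>S by blast
  have "\<rho> v \<notin> X" if "v \<in> ?S" for v using \<rho>1(3)[OF that] \<rho>S[OF that] by simp
  then have fresh: "\<rho> ` ?S \<inter> X = {}" by blast
  have \<rho>l: "\<rho> ` lblock e \<subseteq> X" using h by (auto simp: \<rho>_def)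
  have \<rho>sort: "fst (\<rho> v) = fst v" for v using hsort \<rho>1(2) by (simp add: \<rho>_def)
  let ?e = "rename_ipair \<rho> e"
  have sel: "phi ?e = subst (\<lambda>v. Var (\<rho> v)) (phi e)" "rblock ?e = map \<rho> (rblock e)"
    "psi ?e = subst (\<lambda>v. Var (\<rho> v)) (psi e)" "wblocks ?e = map (map \<rho>) (wblocks e)"
    by (simp_all add: rename_ipair_def)
  have rv: "rvars ?e = \<rho> ` rvars e" by (simp add: sel)
  have lb: "lblock ?e = \<rho> ` lblock e"
  proof -
    have "fm_vars (phi ?e) = \<rho> ` fm_vars (phi e)" unfolding sel fm_vars_subst by auto
    also have "\<dots> = \<rho> ` lblock e \<union> \<rho> ` (fm_vars (phi e) \<inter> rvars e)"
      unfolding lblock_def by blast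
    finally have "lblock ?e = (\<rho> ` lblock e \<union> \<rho> ` (fm_vars (phi e) \<inter> rvars e)) - \<rho> ` rvars e"
      by (simp add: lblock_def[of ?e] rv)
    also have "\<dots> = \<rho> ` lblock e" using \<rho>l fresh by blast
    finally show ?thesis .
  qed
  have ws: "set ys \<subseteq> ?S" if "ys \<in> set (wblocks e)" for ys using that by (auto simp: wvars_def)
  have disj: "disjnt (\<rho> ` P) (\<rho> ` Q)" if "P \<subseteq> ?S" "Q \<subseteq> ?S" "disjnt P Q" for P Q
    using that inj by (simp add: disjnt_def inj_on_image_Int[symmetric])
  have "disjoint_blocks ?e"
  proof -
    have "sorted_wrt disjnt (map (\<lambda>ys. \<rho> ` set ys) (wblocks e))"
      using blocks(2) unfolding sorted_wrt_map
      by (rule sorted_wrt_mono_rel[rotated]) (use disj ws in blast)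
    moreover have "disjnt (\<rho> ` lblock e) (\<rho> ` rvars e)" using \<rho>l fresh unfolding disjnt_def by blast
    moreover have "disjnt (\<rho> ` lblock e) (\<rho> ` set ys) \<and> disjnt (\<rho> ` rvars e) (\<rho> ` set ys)"
      if "ys \<in> set (wblocks e)" for ys
      using disj[of "rvars e" "set ys"] ws[OF that] blocks(3)[OF that] \<rho>l fresh unfolding disjnt_def by blast
    ultimately show ?thesis unfolding disjoint_blocks_def lb rv by (simp add: sel comp_def)
  qed
  moreover have lr: "disjnt (\<rho> ` lblock e) (\<rho> ` rvars e)" using \<rho>l fresh unfolding disjnt_def by blast
  ultimately have e\<Omega>: "?e \<in> \<Omega>" using assms(1,3) \<rho>sort unfolding subst_closed_def by blast
  have "disjnt X (rvars ?e)" using fresh unfolding rv disjnt_def by blast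
  with e\<Omega> have "?e \<in> restrict_left \<Omega> X" using \<rho>l by (simp add: restrict_left_def lb)
  moreover define pull where "pull f v = f (inv_into ?S \<rho> v)" for f :: "('s, 'v) var \<Rightarrow> 'm" and v
  have pull: "pull f (\<rho> v) = f v" if "v \<in> ?S" for f v using inj that by (simp add: pull_def)
  moreover have cb: "compat M (rvars ?e) (pull b)"
    unfolding rv compat_def using assms(8) pull \<rho>sort by (simp add: compat_def)
  moreover have "pull b ` rvars ?e = b ` rvars e" unfolding rv image_image using pull by simp
  moreover have "sat M a [] (inst ?e (pull b))"
  proof -
    have "sat M a [] (inst ?e (pull b)) \<longleftrightarrow>
      sat M (\<lambda>v. if \<rho> v \<in> rvars ?e then pull b (\<rho> v) else a (\<rho> v)) [] (phi e)"
      unfolding sat_inst sel(1) by (subst sat_subst) (simp_all add: atomic_tm_def)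
    also have "\<dots> \<longleftrightarrow> sat M (\<lambda>v. if v \<in> rvars e then b v else c v) [] (phi e)"
    proof (rule sat_cong)
      fix v assume "v \<in> fm_vars (phi e)"
      then consider "v \<in> rvars e" | "v \<in> lblock e" "v \<notin> rvars e" by (auto simp: lblock_def)
      then show "(if \<rho> v \<in> rvars ?e then pull b (\<rho> v) else a (\<rho> v)) = (if v \<in> rvars e then b v else c v)"
      proof cases
        case 1
        then show ?thesis using pull by (simp add: rv)
      next
        case 2
        then have "\<rho> v \<notin> rvars ?e" using lr unfolding rv disjnt_def by blast
        with 2 h show ?thesis by (simp add: \<rho>_def)
      qed
    qed
    finally show ?thesis using assms(9) unfolding sat_inst by simp
  qed
  moreover have "divides M ?e (pull b) C"
  proof -
    obtain \<beta> :: "nat \<Rightarrow> ('s, 'v) var \<Rightarrow> 'm" where \<beta>: "\<And>i. conj_tuple M C (rvars e) b (\<beta> i)"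
      "\<And>js. sorted_wrt (<) js \<Longrightarrow> length js = length (wblocks e) \<Longrightarrow> psi_holds M e (map \<beta> js)"
      using assms(11) unfolding divides_iff[OF assms(10,8)] by blast
    have "conj_tuple M C (rvars ?e) (pull b) (pull (\<beta> i))" for i
    proof -
      obtain g where g: "automorphism M g" "\<And>c. c \<in> C \<Longrightarrow> g c = c" "\<And>v. v \<in> rvars e \<Longrightarrow> g (b v) = \<beta> i v"
        using \<beta>(1)[of i] unfolding conj_tuple_def by blast
      have "g (pull b w) = pull (\<beta> i) w" if "w \<in> rvars ?e" for w
        using that pull g(3) unfolding rv by auto
      with g(1,2) show ?thesis unfolding conj_tuple_def by blast
    qed
    moreover have "psi_holds M ?e (map (\<lambda>i. pull (\<beta> i)) js)"
      if js: "sorted_wrt (<) js" "length js = length (wblocks ?e)" for js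
    proof -
      have "length js = length (wblocks e)" using js(2) by (simp add: sel)
      from \<beta>(2)[OF js(1) this] obtain s where
        s: "list_all2 (\<lambda>ys b. map s ys = map b (rblock e)) (wblocks e) (map \<beta> js)" "sat M s [] (psi e)"
        unfolding psi_holds_def by blast
      have "sat M (pull s) [] (psi ?e) \<longleftrightarrow> sat M (\<lambda>v. pull s (\<rho> v)) [] (psi e)"
        unfolding sel by (subst sat_subst) (simp_all add: atomic_tm_def)
      also have "\<dots> \<longleftrightarrow> sat M s [] (psi e)"
      proof (rule sat_cong)
        fix v assume "v \<in> fm_vars (psi e)"
        then have "v \<in> wvars e" using XiD(2)[OF Xi] unfolding forms_over_def by blast
        then show "pull s (\<rho> v) = s v" by (intro pull) simp
      qed
      finally have "sat M (pull s) [] (psi ?e)" using s(2) by simp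
      moreover have "list_all2 (\<lambda>ys b. map (pull s) ys = map b (rblock ?e)) (wblocks ?e)
          (map (\<lambda>i. pull (\<beta> i)) js)"
        unfolding sel list.rel_map
        using s(1)[unfolded list.rel_map]
      proof (rule list.rel_mono_strong)
        fix ys i assume ys: "ys \<in> set (wblocks e)" "map s ys = map (\<beta> i) (rblock e)"
        have "map (pull s) (map \<rho> ys) = map s ys" using ws[OF ys(1)] pull by auto
        also note ys(2)
        also have "map (\<beta> i) (rblock e) = map (pull (\<beta> i)) (map \<rho> (rblock e))" using pull by auto
        finally show "map (pull s) (map \<rho> ys) = map (pull (\<beta> i)) (map \<rho> (rblock e))" .
      qed
      ultimately show ?thesis unfolding psi_holds_def by blast
    qed
    ultimately show ?thesis
      unfolding divides_iff[OF assms(10) cb] by (intro exI[of _ "\<lambda>i. pull (\<beta> i)"]) blast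
  qed
  ultimately show thesis using that by blast
qed

end

section \<open>Rank and independence\<close>

context monster
begin

text \<open>The rank over the larger base is at most the other by monotonicity of patterns;
  independence gives the converse inequality, through the transfer of a pattern of maximal
  length.\<close>

lemma rank_eq_if_indep_star:
  fixes \<Delta> :: "('s, 'f, 'r, 'm, 'v) ipair set"
  assumes "\<Omega> \<subseteq> Xi M" "transitive \<kappa> M \<Omega>" "normal \<Omega>" "small \<kappa> X" "compat M X a" "small \<kappa> B" "small \<kappa> C"
    and "indep_star \<kappa> M \<Omega> B C (a ` X)" "finite \<Delta>" "\<Delta> \<subseteq> restrict_left \<Omega> X"
    and "D_rank \<kappa> M X \<Delta> {} {} < \<infinity>"
  shows "D_tp \<kappa> M X \<Delta> a (B \<union> C) = D_tp \<kappa> M X \<Delta> a C"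
proof -
  note smBC = small_Un[OF assms(6,7)]
  have \<Delta>: "\<Delta> \<subseteq> restrict_left (Xi M) X" using assms(1,10) by (auto simp: restrict_left_def)
  obtain n where n: "D_tp \<kappa> M X \<Delta> a C = enat n"
    "\<exists>\<xi>. dividing_pattern M X \<Delta> (tp M X a C) C {..<n} {(i, j). i \<le> j} \<xi>"
    "\<And>m \<xi>. dividing_pattern M X \<Delta> (tp M X a C) C {..<m} {(i, j). i \<le> j} \<xi> \<Longrightarrow> m \<le> n"
    using D_tp_value[OF assms(4,9) \<Delta> assms(11,7,5)] by blast
  obtain n' where n': "D_tp \<kappa> M X \<Delta> a (B \<union> C) = enat n'"
    "\<exists>\<xi>. dividing_pattern M X \<Delta> (tp M X a (B \<union> C)) (B \<union> C) {..<n'} {(i, j). i \<le> j} \<xi>"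
    "\<And>m \<xi>. dividing_pattern M X \<Delta> (tp M X a (B \<union> C)) (B \<union> C) {..<m} {(i, j). i \<le> j} \<xi> \<Longrightarrow> m \<le> n'"
    using D_tp_value[OF assms(4,9) \<Delta> assms(11) smBC assms(5)] by blast
  have "n' \<le> n"
  proof -
    obtain \<xi> where "dividing_pattern M X \<Delta> (tp M X a (B \<union> C)) (B \<union> C) {..<n'} {(i, j). i \<le> j} \<xi>"
      using n'(2) by blast
    then have "dividing_pattern M X \<Delta> (tp M X a C) C {..<n'} {(i, j). i \<le> j} \<xi>"
      by (rule dividing_pattern_mono) (auto simp: tp_def forms_over_def)
    then show ?thesis by (rule n(3))
  qed
  moreover have "n \<le> n'"
  proof -
    obtain \<xi> b where \<xi>: "\<forall>i<n. \<xi> i \<in> \<Delta>" and p: "realised_pattern M (\<lambda>_. C) n \<xi> a b"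
      using n(2) unfolding dividing_pattern_tp[OF assms(4,7,5) \<Delta>] by blast
    have \<xi>': "\<xi> i \<in> \<Omega>" "lblock (\<xi> i) \<subseteq> X" if "i < n" for i
      using \<xi> that assms(10) by (auto simp: restrict_left_def)
    obtain b' where "realised_pattern M (\<lambda>_. B \<union> C) n \<xi> a b'"
      using realised_pattern_transfer[OF p assms(8,1,2,3,4,6,7) \<xi>'(1) assms(5) \<xi>'(2)] by blast
    then have "dividing_pattern M X \<Delta> (tp M X a (B \<union> C)) (B \<union> C) {..<n} {(i, j). i \<le> j} \<xi>"
      unfolding dividing_pattern_tp[OF assms(4) smBC assms(5) \<Delta>] using \<xi> by blast
    then show ?thesis by (rule n'(3))
  qed
  ultimately show ?thesis using n(1) n'(1) by simp
qed

lemma indep_star_if_rank_eq: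
  fixes \<Omega> :: "('s, 'f, 'r, 'm, 'v) ipair set"
  assumes "\<Omega> \<subseteq> Xi M" "subst_closed \<Omega>" "small \<kappa> X" "compat M X a" "small \<kappa> B" "small \<kappa> C"
    and fin: "\<And>\<Delta>. finite \<Delta> \<Longrightarrow> \<Delta> \<subseteq> restrict_left \<Omega> X \<Longrightarrow> D_rank \<kappa> M X \<Delta> {} {} < \<infinity>"
    and eq: "\<And>\<Delta>. finite \<Delta> \<Longrightarrow> \<Delta> \<subseteq> restrict_left \<Omega> X \<Longrightarrow>
      D_tp \<kappa> M X \<Delta> a (B \<union> C) = D_tp \<kappa> M X \<Delta> a C"
  shows "indep_star \<kappa> M \<Omega> (a ` X) C B"
  unfolding indep_star_def
proof (intro allI impI)
  fix B' assume B': "small \<kappa> B'" "B \<subseteq> B'"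
  let ?E = "B' \<union> C" and ?p = "tp M X a (B \<union> C)"
  note smE = small_Un[OF B'(1) assms(6)] and smBC = small_Un[OF assms(5,6)]
  \<comment> \<open>A realisation of \<open>?p\<close> that falsifies every instance in
    \<open>S\<close> yields the required conjugate: a dividing instance in other variables can be
    renamed to one whose left-hand variables are in \<open>X\<close>.\<close>
  define S where "S = {(e, b). e \<in> restrict_left \<Omega> X \<and> compat M (rvars e) b \<and> b ` rvars e \<subseteq> ?E \<and> divides M e b C}"
  define neg where "neg eb = Neg (inst (fst eb) (snd eb))"
    for eb :: "('s, 'f, 'r, 'm, 'v) ipair \<times> (('s, 'v) var \<Rightarrow> 'm)"
  have "consistent M X (?p \<union> neg ` S)"
  proof (rule ccontr)
    assume "\<not> ?thesis"
    then obtain q where q: "q \<subseteq> ?p \<union> neg ` S" "finite q" "\<And>a. \<not> realises M X a q"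
      unfolding consistent_def by blast
    have "q \<inter> neg ` S \<subseteq> neg ` S" "finite (q \<inter> neg ` S)" using q(2) by auto
    from finite_subset_image[OF this(2,1)] obtain K where
      K: "K \<subseteq> S" "finite K" "q \<inter> neg ` S = neg ` K" by blast
    let ?\<Delta> = "fst ` K"
    have fin\<Delta>: "finite ?\<Delta>" using K(2) by simp
    have \<Delta>\<Omega>: "?\<Delta> \<subseteq> restrict_left \<Omega> X" using K(1) unfolding S_def by force
    have \<Delta>: "?\<Delta> \<subseteq> restrict_left (Xi M) X" using \<Delta>\<Omega> assms(1) by (auto simp: restrict_left_def)
    obtain n where n: "D_tp \<kappa> M X ?\<Delta> a C = enat n"
      "\<And>m \<xi>. dividing_pattern M X ?\<Delta> (tp M X a C) C {..<m} {(i, j). i \<le> j} \<xi> \<Longrightarrow> m \<le> n"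
      by (rule D_tp_value[OF assms(3) fin\<Delta> \<Delta> fin[OF fin\<Delta> \<Delta>\<Omega>] assms(6,4)], rule that)
    obtain n' where n': "D_tp \<kappa> M X ?\<Delta> a (B \<union> C) = enat n'"
      "\<exists>\<xi>. dividing_pattern M X ?\<Delta> ?p (B \<union> C) {..<n'} {(i, j). i \<le> j} \<xi>"
      by (rule D_tp_value[OF assms(3) fin\<Delta> \<Delta> fin[OF fin\<Delta> \<Delta>\<Omega>] smBC assms(4)], rule that)
    have nn: "n' = n" using eq[OF fin\<Delta> \<Delta>\<Omega>] n(1) n'(1) by simp
    obtain \<xi> b where \<xi>: "\<forall>i<n. \<xi> i \<in> ?\<Delta>" and p: "realised_pattern M (\<lambda>_. B \<union> C) n \<xi> a b"
      using n'(2) unfolding nn dividing_pattern_tp[OF assms(3) smBC assms(4) \<Delta>] by blast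
    have Xi: "\<xi> i \<in> Xi M" "lblock (\<xi> i) \<subseteq> X" if "i < n" for i
      using \<xi> that \<Delta> by (auto simp: restrict_left_def)
    have sub: "B \<union> C \<subseteq> ?E" using B'(2) by blast
    \<comment> \<open>The pattern is moved over all of \<open>?E\<close> before it is known which
      formula from \<open>K\<close> holds of the new tuple; the parameters of that formula lie in
      \<open>?E\<close> in any case.\<close>
    obtain g b' where g: "automorphism M g" "\<And>c. c \<in> B \<union> C \<Longrightarrow> g c = c"
      and p': "realised_pattern M (\<lambda>_. ?E) n \<xi> (\<lambda>v. g (a v)) b'"
      using realised_pattern_extend_base[OF p smE sub Xi(1) assms(4) Xi(2)] by blast
    let ?a = "\<lambda>v. g (a v)"
    have "conj_tuple M (B \<union> C) X a ?a" using g unfolding conj_tuple_def by blast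
    then have rp: "realises M X ?a ?p" using realises_tp_iff[OF assms(3) smBC assms(4)] by blast
    have "\<exists>eb\<in>K. sat M ?a [] (inst (fst eb) (snd eb))"
    proof (rule ccontr)
      assume no: "\<not> ?thesis"
      have "sat M ?a [] \<phi>" if "\<phi> \<in> q" for \<phi>
      proof (cases "\<phi> \<in> neg ` S")
        case True
        then have "\<phi> \<in> neg ` K" using that K(3) by blast
        then obtain eb where "eb \<in> K" "\<phi> = neg eb" by blast
        with no show ?thesis by (simp add: neg_def)
      next
        case False
        then have "\<phi> \<in> ?p" using that q(1) by blast
        with rp show ?thesis unfolding realises_def by blast
      qed
      with rp q(3)[of ?a] show False by (simp add: realises_def)
    qed
    then obtain e0 b0 where eb: "(e0, b0) \<in> K" "sat M ?a [] (inst e0 b0)" by auto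
    have S0: "compat M (rvars e0) b0" "b0 ` rvars e0 \<subseteq> ?E" "divides M e0 b0 C"
      using eb(1) K(1) unfolding S_def by auto
    \<comment> \<open>The pair \<open>e0\<close> with \<open>b0\<close> goes first, where dividing
      over \<open>C\<close> is what is asked. The later formulas divide over \<open>?E\<close>,
      which contains \<open>C\<close> and the entries of \<open>b0\<close>. The length
      \<open>Suc n\<close> exceeds the rank over \<open>C\<close>.\<close>
    define \<xi>' where "\<xi>' i = (case i of 0 \<Rightarrow> e0 | Suc i \<Rightarrow> \<xi> i)" for i
    define b'' where "b'' i = (case i of 0 \<Rightarrow> b0 | Suc i \<Rightarrow> b' i)" for i
    have ear: "earlier \<xi>' b'' (Suc i) = b0 ` rvars e0 \<union> earlier \<xi> b' i" for i
      unfolding earlier_def lessThan_Suc_eq_insert_0 by (simp add: \<xi>'_def b''_def image_image)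
    have "realised_pattern M (\<lambda>_. C) (Suc n) \<xi>' ?a b''"
      unfolding realised_pattern_def
    proof (intro allI impI)
      fix i assume i: "i < Suc n"
      show "compat M (rvars (\<xi>' i)) (b'' i) \<and> sat M ?a [] (inst (\<xi>' i) (b'' i)) \<and>
          divides M (\<xi>' i) (b'' i) (C \<union> earlier \<xi>' b'' i)"
      proof (cases i)
        case 0
        then show ?thesis using S0 eb(2) by (simp add: \<xi>'_def b''_def earlier_def)
      next
        case (Suc k)
        then have k: "compat M (rvars (\<xi> k)) (b' k)" "sat M ?a [] (inst (\<xi> k) (b' k))"
          "divides M (\<xi> k) (b' k) (?E \<union> earlier \<xi> b' k)"
          using p' i unfolding realised_pattern_def by auto
        have "divides M (\<xi> k) (b' k) (C \<union> earlier \<xi>' b'' (Suc k))"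
          unfolding ear by (rule divides_mono[OF k(3)]) (use S0(2) in blast)
        with k(1,2) show ?thesis unfolding Suc by (simp add: \<xi>'_def b''_def)
      qed
    qed
    moreover have "\<xi>' i \<in> ?\<Delta>" if "i < Suc n" for i
      using that \<xi> eb(1) by (cases i) (force simp: \<xi>'_def)+
    moreover have "realises M X ?a (tp M X a C)"
    proof -
      have "tp M X a C \<subseteq> ?p" by (auto simp: tp_def forms_over_def)
      with rp show ?thesis unfolding realises_def by blast
    qed
    moreover have "tp M X a C \<subseteq> forms_over M X C" by (auto simp: tp_def)
    ultimately have "dividing_pattern M X ?\<Delta> (tp M X a C) C {..<Suc n} {(i, j). i \<le> j} \<xi>'"
      using dividing_pattern_iff[OF assms(3,6) _ \<Delta>] by blast
    from n(2)[OF this] show False by simp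
  qed
  moreover have "?p \<union> neg ` S \<subseteq> forms_over M X (B \<union> C \<union> ?E)"
  proof -
    have "neg eb \<in> forms_over M X (B \<union> C \<union> ?E)" if "eb \<in> S" for eb
    proof -
      obtain e b where eb: "eb = (e, b)" by fastforce
      have e: "e \<in> Xi M" "lblock e \<subseteq> X" "compat M (rvars e) b" "b ` rvars e \<subseteq> B \<union> C \<union> ?E"
        using that assms(1) unfolding eb S_def restrict_left_def by auto
      show ?thesis using inst_form[OF e(1,3,2,4)] by (simp add: neg_def eb forms_over_def)
    qed
    then show ?thesis by (auto simp: tp_def forms_over_def)
  qed
  ultimately obtain a' where a': "realises M X a' (?p \<union> neg ` S)"
    using realise_type[OF assms(3) small_Un[OF smBC smE]] by blast
  then have ca': "compat M X a'" by (simp add: realises_def)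
  have "realises M X a' ?p" using a' by (simp add: realises_def)
  then have "conj_tuple M (B \<union> C) X a a'" using realises_tp_iff[OF assms(3) smBC assms(4)] by blast
  then obtain g where g: "automorphism M g" "\<forall>c\<in>B \<union> C. g c = c" "\<forall>v\<in>X. g (a v) = a' v"
    unfolding conj_tuple_def by blast
  have "g ` a ` X = a' ` X" unfolding image_image using g(3) by simp
  then have "conj_over M (B \<union> C) (a ` X) (a' ` X)" using g(1,2) unfolding conj_over_def by blast
  moreover have "indep \<kappa> M \<Omega> (a' ` X) C B'"
    unfolding indep_iff
  proof (intro allI impI notI)
    fix Y c e b
    assume Y: "small \<kappa> Y" "compat M Y c" "c ` Y \<subseteq> a' ` X"
      and e: "e \<in> \<Omega>" "compat M (rvars e) b" "b ` rvars e \<subseteq> ?E"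
      and tp: "inst e b \<in> tp M Y c ?E" and div: "divides M e b C"
    have lY: "lblock e \<subseteq> Y" using tp fm_vars_inst[of e b] by (auto simp: tp_def forms_over_def)
    have cl: "c ` lblock e \<subseteq> a' ` X" using Y(3) lY by blast
    have sc: "sat M c [] (inst e b)" using tp by (simp add: tp_def)
    obtain e' b' where e': "e' \<in> restrict_left \<Omega> X" "compat M (rvars e') b'"
      "b' ` rvars e' = b ` rvars e" "sat M a' [] (inst e' b')" "divides M e' b' C"
      using rename_to_left[OF assms(2,1) e(1) assms(3) ca' compat_mono[OF Y(2) lY] cl e(2) sc assms(6) div]
      by blast
    have "(e', b') \<in> S" using e' e(3) by (simp add: S_def)
    then have "neg (e', b') \<in> ?p \<union> neg ` S" by blast
    then have "sat M a' [] (neg (e', b'))" using a' unfolding realises_def by blast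
    with e'(4) show False by (simp add: neg_def)
  qed
  ultimately show "\<exists>A'. conj_over M (B \<union> C) (a ` X) A' \<and> indep \<kappa> M \<Omega> A' C B'" by blast
qed

text \<open>Ranks are defined for tuples, so a set that takes over the role of \<open>a\<close> must
  be listed by one; each element gets a variable of its own sort.\<close>

lemma enumerate_small:
  assumes "small \<kappa> B"
  obtains Y :: "('s, 'v) var set" and b where "small \<kappa> Y" "compat M Y b" "b ` Y = B"
proof -
  obtain \<rho> :: "'m \<Rightarrow> ('s, 'v) var" where \<rho>: "inj_on \<rho> B" "\<And>x. fst (\<rho> x) = sort_of M x"
    using fresh_vars[OF assms small_finite[OF finite.emptyI], of "sort_of M"] by blast
  have inv: "inv_into B \<rho> (\<rho> x) = x" if "x \<in> B" for x using \<rho>(1) that by simp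
  show thesis
  proof (rule that)
    show "small \<kappa> (\<rho> ` B)" by (rule small_image[OF assms])
    show "compat M (\<rho> ` B) (inv_into B \<rho>)" unfolding compat_def using inv \<rho>(2) by simp
    show "inv_into B \<rho> ` \<rho> ` B = B" unfolding image_image using inv by simp
  qed
qed

end

theorem theorem2p27:
  fixes \<kappa> :: "'k rel"
    and T :: "('s, 'f, 'r, 'm, 'v) form set"
    and M :: "('s, 'f, 'r, 'm) struct"
    and \<Omega> :: "('s, 'f, 'r, 'm, 'v) ipair set"
    and X :: "('s, 'v) var set"
    and a :: "('s, 'v) var \<Rightarrow> 'm"
    and B C :: "'m set"
  assumes "complete_theory M T"
    and "big_model \<kappa> T M"
    and "\<Omega> \<subseteq> Xi M"
    and "subst_closed \<Omega>"
    and "transitive \<kappa> M \<Omega>"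
    and "normal \<Omega>"
    and "\<And>Y \<Delta>. small \<kappa> Y \<Longrightarrow> finite \<Delta> \<Longrightarrow> \<Delta> \<subseteq> restrict_left \<Omega> Y \<Longrightarrow>
           D_rank \<kappa> M Y \<Delta> {} {} < \<infinity>"
    and "small \<kappa> X" and "compat M X a"
    and "small \<kappa> B" and "small \<kappa> C"
  shows "(indep_star \<kappa> M \<Omega> (a ` X) C B \<longleftrightarrow>
           (\<forall>\<Delta>. finite \<Delta> \<longrightarrow> \<Delta> \<subseteq> restrict_left \<Omega> X \<longrightarrow>
              D_tp \<kappa> M X \<Delta> a (B \<union> C) = D_tp \<kappa> M X \<Delta> a C))
       \<and> ((\<forall>\<Delta>. finite \<Delta> \<longrightarrow> \<Delta> \<subseteq> restrict_left \<Omega> X \<longrightarrow>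
              D_tp \<kappa> M X \<Delta> a (B \<union> C) = D_tp \<kappa> M X \<Delta> a C)
           \<longleftrightarrow> indep_star \<kappa> M \<Omega> B C (a ` X))"
proof -
  interpret monster \<kappa> T M by (rule monster.intro) (rule assms(2))
  \<comment> \<open>This implication and the next are kept general in the tuple and the set, because
    the symmetric part uses them for an enumeration of \<open>B\<close> as well.\<close>
  have 32: "D_tp \<kappa> M Y \<Delta> c (B \<union> C) = D_tp \<kappa> M Y \<Delta> c C"
    if "small \<kappa> Y" "compat M Y c" "small \<kappa> B" "indep_star \<kappa> M \<Omega> B C (c ` Y)"
      "finite \<Delta>" "\<Delta> \<subseteq> restrict_left \<Omega> Y" for Y c B \<Delta>
    using rank_eq_if_indep_star[OF assms(3,5,6) that(1-3) assms(11) that(4-6) assms(7)[OF that(1,5,6)]] .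
  have 21: "indep_star \<kappa> M \<Omega> (c ` Y) C B"
    if "small \<kappa> Y" "compat M Y c" "small \<kappa> B"
      "\<And>\<Delta>. finite \<Delta> \<Longrightarrow> \<Delta> \<subseteq> restrict_left \<Omega> Y \<Longrightarrow> D_tp \<kappa> M Y \<Delta> c (B \<union> C) = D_tp \<kappa> M Y \<Delta> c C"
    for Y c B
    using indep_star_if_rank_eq[OF assms(3,4) that(1-3) assms(11) assms(7)[OF that(1)] that(4)] .
  have 13: "indep_star \<kappa> M \<Omega> B C (a ` X)" if star: "indep_star \<kappa> M \<Omega> (a ` X) C B"
  proof -
    obtain Y :: "('s, 'v) var set" and b where Y: "small \<kappa> Y" "compat M Y b" "b ` Y = B"
      using enumerate_small[OF assms(10)] by blast
    note smX = small_image[OF assms(8), of a]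
    have "indep_star \<kappa> M \<Omega> (b ` Y) C (a ` X)"
      using 21[OF Y(1,2) smX] 32[OF Y(1,2) smX] star unfolding Y(3) by blast
    then show ?thesis unfolding Y(3) .
  qed
  show ?thesis using 32[OF assms(8,9,10)] 21[OF assms(8,9,10)] 13 by blast
qed

end
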